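(* Let $p:[-1,1]\to\mathbb R$ be an even continuous function with $p(x)\ge1$ for all $x\in[-1,1]$. Let $\mathcal I(u)=\int_{-1}^{1}(1+|u'(x)|^2)^{p(x)/2}\,dx\in[0,\infty]$ and let $u^*$ denote the symmetrization of $u$. (1) If the function $x\mapsto(p(x)-1)^{0.37}$ is convex on $[-1,1]$, then $\mathcal I(u^* )\le\mathcal I(u)$ holds for every nonnegative function $u\in\mathring{W}{}^1_1(-1,1)$. (2) If $p(x)\le 2.36$ for all $x\in[-1,1]$ and the function $x\mapsto\sqrt{p(x)-1}$ is convex on $[-1,1]$, then $\mathcal I(u^* )\le\mathcal I(u)$ holds for every nonnegative function $u\in\mathring{W}{}^1_1(-1,1)$.
   Context: $\mathring{W}{}^1_1(-1,1)$ is the Sobolev space of absolutely continuous functions on $[-1,1]$ with integrable derivative that vanish at $\pm1$. For a measurable set $E\subset[-1,1]$ put $E^*=\left[-\frac{|E|}{2},\frac{|E|}{2}\right]$, where $|E|$ is Lebesgue measure. For a nonnegative $u\in\mathring{W}{}^1_1(-1,1)$ put $\mathcal A_t=\{x\in[-1,1]: u(x)>t\}$; the symmetrization (symmetric rearrangement) of $u$ is $u^*(x)=\int_0^\infty \chi_{\mathcal A_t^*}(x)\,dt$, where $\chi$ denotes the characteristic function. *)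

theory Defs
  imports "HOL-Analysis.Analysis"
begin

definition abs_continuous_on_interval :: "real \<Rightarrow> real \<Rightarrow> (real \<Rightarrow> real) \<Rightarrow> bool" where
  "abs_continuous_on_interval a b f \<longleftrightarrow>
     (\<forall>\<epsilon>>0. \<exists>\<delta>>0. \<forall>I :: (real \<times> real) set.
        finite I \<longrightarrow>
        (\<forall>(x, y)\<in>I. a \<le> x \<and> x < y \<and> y \<le> b) \<longrightarrow>
        disjoint_family_on (\<lambda>(x, y). {x<..<y}) I \<longrightarrow>
        (\<Sum>(x, y)\<in>I. y - x) < \<delta> \<longrightarrow>
        (\<Sum>(x, y)\<in>I. \<bar>f y - f x\<bar>) < \<epsilon>)"

(* Functions on [-1,1] are modelled by total functions; values outside [-1,1] play no role.
   An absolutely continuous function is differentiable almost everywhere, so deriv is the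
   genuine derivative up to a null set. *)
definition W11_0 :: "(real \<Rightarrow> real) set" where
  "W11_0 = {u. abs_continuous_on_interval (-1) 1 u \<and>
               integrable (lebesgue_on {-1..1}) (deriv u) \<and>
               u (-1) = 0 \<and> u 1 = 0}"

(* The empty set is symmetrized to the empty set rather than to [0,0] = {0}: otherwise
   every level above the maximum of u would contribute at x = 0, and the symmetrization
   of u would be infinite there. *)
definition symmetrized_set :: "real set \<Rightarrow> real set" where
  "symmetrized_set E =
     (if E = {} then {} else {- (measure lebesgue E / 2) .. measure lebesgue E / 2})"

definition superlevel_set :: "(real \<Rightarrow> real) \<Rightarrow> real \<Rightarrow> real set" where
  "superlevel_set u t = {x \<in> {-1..1}. u x > t}"

(* For u bounded on [-1,1] the integrand vanishes for large t, so the Bochner integral is a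
   genuine finite value. *)
definition symmetrization :: "(real \<Rightarrow> real) \<Rightarrow> real \<Rightarrow> real" where
  "symmetrization u x =
     (LBINT t:{0..}. indicat_real (symmetrized_set (superlevel_set u t)) x)"

definition var_exp_functional :: "(real \<Rightarrow> real) \<Rightarrow> (real \<Rightarrow> real) \<Rightarrow> ennreal" where
  "var_exp_functional p u =
     (\<integral>\<^sup>+ x. ennreal ((1 + \<bar>deriv u x\<bar>\<^sup>2) powr (p x / 2)) \<partial>lebesgue_on {-1..1})"

end

theory Submission
  imports Defs
begin

text \<open>
  Let \<open>F p s = (1 + s\<^sup>2) powr (p / 2)\<close> be the energy density at slope \<open>s\<close>. A monotone branch of the graph
  of \<open>u\<close> that crosses a thin band of levels with inverse slope \<open>\<sigma>\<close> spends the energy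
  \<open>K p \<sigma> = \<sigma> * F p (1 / \<sigma>)\<close> per unit of height. Every band of levels below the maximum of \<open>u\<close> is
  crossed at least twice, on an outermost branch on the left and on an outermost branch on the
  right, whereas \<open>u\<^sup>*\<close> crosses it exactly twice, at opposite points and with the same inverse slope.
  Reflect the left branch. If \<open>K (p x) \<sigma>\<close> is midpoint convex in \<open>(x, \<sigma>)\<close>, two branches at the
  averaged position with the averaged inverse slope cost no more than the original pair. Since \<open>p\<close> is
  even and increases with \<open>\<bar>x\<bar>\<close>, moving them further inward to the position prescribed by \<open>u\<^sup>*\<close> does
  not raise the cost. The part of the band outside the two branches costs at least \<open>1\<close> per unit of
  length, and stretching a branch over it costs at most that much. This is
  \<open>two_branch_estimate\<close>.

  The comparison is carried out on finitely many bands: with \<open>v = u\<^sup>*\<close>, the bands are bounded by the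
  levels \<open>v (k / n)\<close>. Summation gives a lower bound of the energy of \<open>u\<close> that is the energy of a
  discretization of \<open>u\<^sup>*\<close> (\<open>discrete_energy_le\<close>). The slopes of the discretization converge almost
  everywhere because \<open>u\<^sup>*\<close> is monotone on each half of the interval, and Fatou's lemma yields
  \<open>polya_szego_variable_exponent\<close>. This needs two facts of real analysis: monotone functions are
  differentiable almost everywhere, and the increments of an absolutely continuous function
  are bounded by the integral of the absolute value of its derivative.

  It remains to see that \<open>K\<close> is midpoint convex. Put \<open>w = (p - 1) powr \<alpha>\<close> with \<open>\<alpha> = 0.37\<close> or \<open>\<alpha> = 1/2\<close>.
  As \<open>K\<close> increases with \<open>p\<close> and \<open>w\<close> is convex in \<open>x\<close>, it suffices that
  \<open>K (1 + w powr (1 / \<alpha>)) \<sigma>\<close> is jointly convex in \<open>(w, \<sigma>)\<close>. Nonnegativity of the Hessian determinant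
  is an inequality between \<open>z = \<sigma>\<^sup>2\<close>, \<open>q = p - 1\<close> and \<open>ln (1 + 1 / z)\<close>; in the variable
  \<open>t = 1 / (2 * z + 1)\<close> it says that a quadratic polynomial in \<open>q\<close>, whose coefficients involve only \<open>t\<close> and
  \<open>artanh t / t\<close>, is nonnegative. For \<open>\<alpha> = 0.37\<close> all three coefficients are nonnegative. For \<open>\<alpha> = 1/2\<close> the
  leading coefficient changes sign; where it is negative the polynomial is concave in \<open>q\<close>, so
  that only the endpoint \<open>q = 1.36\<close> has to be checked. Pade minorants of \<open>artanh\<close> reduce these
  inequalities to polynomial ones on the unit interval.
\<close>

section \<open>Rational bounds for the inverse hyperbolic tangent\<close>

text \<open>The minorant is a Pade approximant of \<open>artanh\<close> at \<open>0\<close>. High-order contact leaves a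
  single monomial in the numerator of the derivative of the difference, so its sign is visible.\<close>

lemma artanh_ge_pade_3_2:
  fixes t :: real
  assumes "0 \<le> t" "t < 1"
  shows "t * (15 - 4 * t\<^sup>2) / (15 - 9 * t\<^sup>2) \<le> artanh t"
proof -
  let ?f = "\<lambda>t::real. artanh t - t * (15 - 4 * t\<^sup>2) / (15 - 9 * t\<^sup>2)"
  have "?f 0 \<le> ?f t"
  proof (rule DERIV_nonneg_imp_nondecreasing[OF assms(1)])
    fix x :: real assume x: "0 \<le> x" "x \<le> t"
    hence x1: "x\<^sup>2 < 1" using assms by (simp add: abs_square_less_1)
    have "(?f has_real_derivative 36 * x ^ 6 / ((1 - x\<^sup>2) * (15 - 9 * x\<^sup>2)\<^sup>2)) (at x)"
      using x x1 assms
      apply -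
      apply (rule derivative_eq_intros refl | force)+
      apply (simp add: divide_simps) 
      apply algebra
      done
    moreover have "36 * x ^ 6 / ((1 - x\<^sup>2) * (15 - 9 * x\<^sup>2)\<^sup>2) \<ge> 0"
      using x x1 by (intro divide_nonneg_nonneg mult_nonneg_nonneg) auto
    ultimately show "\<exists>y. DERIV ?f x :> y \<and> 0 \<le> y" by blast
  qed
  thus ?thesis by simp
qed

text \<open>The same argument one step further along the Pade table; the accuracy near \<open>t = 0.66\<close> is what
  the case \<open>\<alpha> = 1/2\<close> needs.\<close>

lemma artanh_ge_pade_5_4:
  fixes t :: real
  assumes "0 \<le> t" "t < 1"
  shows "t * (945 - 735 * t\<^sup>2 + 64 * t ^ 4) / (945 - 1050 * t\<^sup>2 + 225 * t ^ 4) \<le> artanh t"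
proof -
  let ?D = "\<lambda>t::real. 945 - 1050 * t\<^sup>2 + 225 * t ^ 4"
  let ?f = "\<lambda>t::real. artanh t - t * (945 - 735 * t\<^sup>2 + 64 * t ^ 4) / ?D t"
  have "?f 0 \<le> ?f t"
  proof (rule DERIV_nonneg_imp_nondecreasing[OF assms(1)])
    fix x :: real assume x: "0 \<le> x" "x \<le> t"
    hence x1: "x\<^sup>2 < 1" using assms by (simp add: abs_square_less_1)
    have "?D x = (1 - x\<^sup>2) * (825 - 225 * x\<^sup>2) + 120" by algebra
    moreover have "(1 - x\<^sup>2) * (825 - 225 * x\<^sup>2) \<ge> 0" using x1 by simp
    ultimately have D: "?D x > 0" by linarith
    have "(?f has_real_derivative 14400 * x ^ 10 / ((1 - x\<^sup>2) * (?D x)\<^sup>2)) (at x)"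
      using x x1 assms D
      apply -
      apply (rule derivative_eq_intros refl | force)+
      apply (simp add: divide_simps) 
      apply algebra
      done
    moreover have "14400 * x ^ 10 / ((1 - x\<^sup>2) * (?D x)\<^sup>2) \<ge> 0"
      using x x1 by (intro divide_nonneg_nonneg mult_nonneg_nonneg) auto
    ultimately show "\<exists>y. DERIV ?f x :> y \<and> 0 \<le> y" by blast
  qed
  thus ?thesis by simp
qed

lemma artanh_le:
  fixes t :: real
  assumes "0 \<le> t" "t < 1"
  shows "artanh t \<le> t / (1 - t\<^sup>2)"
proof -
  let ?f = "\<lambda>t::real. t / (1 - t\<^sup>2) - artanh t"
  have "?f 0 \<le> ?f t"
  proof (rule DERIV_nonneg_imp_nondecreasing[OF assms(1)])
    fix x :: real assume x: "0 \<le> x" "x \<le> t"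
    hence x1: "x\<^sup>2 < 1" using assms by (simp add: abs_square_less_1)
    have "(?f has_real_derivative 2 * x\<^sup>2 / (1 - x\<^sup>2)\<^sup>2) (at x)"
      using x x1 assms
      apply -
      apply (rule derivative_eq_intros refl | force)+
      apply (simp add: divide_simps) 
      apply algebra
      done
    thus "\<exists>y. DERIV ?f x :> y \<and> 0 \<le> y" by (rule_tac exI) auto
  qed
  thus ?thesis by simp
qed

section \<open>The Hessian determinant of the crossing cost\<close>

text \<open>The coefficients of the determinant are quadratic in \<open>l = artanh t / t\<close>. This is the criterion for
  replacing \<open>l\<close> by a smaller rational function \<open>r\<close>.\<close>

lemma quadratic_mono:
  fixes A B C l r :: real
  assumes "r \<le> l" "0 \<le> (l + r) * A + B"
  shows "r\<^sup>2 * A + r * B - C \<le> l\<^sup>2 * A + l * B - C"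
proof -
  have "(l\<^sup>2 * A + l * B) - (r\<^sup>2 * A + r * B) = (l - r) * ((l + r) * A + B)" by algebra
  also have "\<dots> \<ge> 0" using assms by (intro mult_nonneg_nonneg) auto
  finally show ?thesis by simp
qed

text \<open>For small \<open>t\<close> the factor \<open>3 * t - 1\<close> is negative, and an upper bound of \<open>l\<close> is needed to see
  that the quadratics below still increase in \<open>l\<close>.\<close>

lemma middle_factor_bound:
  fixes t l r :: real
  assumes t: "0 < t" "t < 1" and l: "0 < r" "r \<le> l" "l \<le> 1 / (1 - t\<^sup>2)"
  shows "(l + r) * ((1 - t) * (3 * t - 1)) \<ge> - 2"
proof (cases "t < 1/3")
  case True
  have "t\<^sup>2 < 1" using t by (simp add: abs_square_less_1)
  have "(l + r) * ((1 - t) * (1 - 3 * t)) \<le> (2 / (1 - t\<^sup>2)) * ((1 - t) * (1 - 3 * t))"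
    using True assms by (intro mult_right_mono) auto
  also have "\<dots> = 2 * (1 - 3 * t) / (1 + t)"
    using t \<open>t\<^sup>2 < 1\<close> by (simp add: divide_simps power2_eq_square) algebra
  also have "\<dots> \<le> 2" using t by (simp add: divide_simps)
  finally show ?thesis by (simp add: algebra_simps)
next
  case False
  hence "0 \<le> (l + r) * ((1 - t) * (3 * t - 1))" using t l by simp
  thus ?thesis by simp
qed

text \<open>The leading and the middle coefficient of the determinant for \<open>\<alpha> = 0.37\<close>. The first inequality
  holds with little room: the minimum of \<open>l * (3 - t)\<close> is about \<open>2.7456\<close>, and it is what limits the exponent.\<close>

lemma det_coefficients_037:
  fixes t :: real
  assumes t: "0 < t" "t < 1"
  defines "l \<equiv> artanh t / t"
  shows "l * (3 - t) \<ge> 2.74"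
    and "l\<^sup>2 * ((1 - t) * (3 * t - 1)) + l * (2 * (2.63 - 1.37 * t)) - 4 \<ge> 0"
proof -
  define N D where "N = 15 - 4 * t\<^sup>2" and "D = 15 - 9 * t\<^sup>2"
  have t2: "t\<^sup>2 < 1" using t by (simp add: abs_square_less_1)
  have ND: "N > 0" "D > 0" using t2 by (auto simp: N_def D_def)
  define r where "r = N / D"
  have r0: "r > 0" using ND by (simp add: r_def)
  have rl: "r \<le> l"
    using artanh_ge_pade_3_2[of t] t ND by (simp add: r_def l_def N_def D_def field_simps)
  have l_le: "l \<le> 1 / (1 - t\<^sup>2)"
    using artanh_le[of t] t by (simp add: l_def field_simps)
  \<comment> \<open>\<open>0.48\<close> is close to the point where the left-hand side is smallest.\<close>
  have "N * (3 - t) - 2.74 * D = (t - 0.48)\<^sup>2 * (4 * t + 16.5) + (0.0984 - 0.0816 * t)"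
    unfolding N_def D_def by algebra
  also have "\<dots> \<ge> 0" using t by (intro add_nonneg_nonneg mult_nonneg_nonneg) auto
  finally have "r * (3 - t) \<ge> 2.74" using ND by (simp add: r_def field_simps)
  also have "r * (3 - t) \<le> l * (3 - t)" using rl t by (intro mult_right_mono) auto
  finally show "l * (3 - t) \<ge> 2.74" .
  define u where "u = 1 - t"
  \<comment> \<open>The coefficients on the right are those in the Bernstein basis, all of them positive.\<close>
  have "N\<^sup>2 * ((1 - t) * (3 * t - 1)) + N * D * (2 * (2.63 - 1.37 * t)) - 4 * D\<^sup>2 =
    117/2 * u ^ 6 + 1269/2 * t * u ^ 5 + 17943/10 * t ^ 2 * u ^ 4 + 4113/2 * t ^ 3 * u ^ 3
    + 27014/25 * t ^ 4 * u ^ 2 + 7817/25 * t ^ 5 * u + 558/25 * t ^ 6"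
    unfolding N_def D_def u_def by algebra
  also have "\<dots> \<ge> 0" using t by (simp add: u_def)
  finally have "(N\<^sup>2 * ((1 - t) * (3 * t - 1)) + N * D * (2 * (2.63 - 1.37 * t)) - 4 * D\<^sup>2) / D\<^sup>2 \<ge> 0"
    by simp
  also have "(N\<^sup>2 * ((1 - t) * (3 * t - 1)) + N * D * (2 * (2.63 - 1.37 * t)) - 4 * D\<^sup>2) / D\<^sup>2
     = r\<^sup>2 * ((1 - t) * (3 * t - 1)) + r * (2 * (2.63 - 1.37 * t)) - 4"
    using ND by (simp add: r_def divide_simps power2_eq_square)
  also have "\<dots> \<le> l\<^sup>2 * ((1 - t) * (3 * t - 1)) + l * (2 * (2.63 - 1.37 * t)) - 4"
    using middle_factor_bound[OF t r0 rl l_le] t by (intro quadratic_mono rl) auto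
  finally show "l\<^sup>2 * ((1 - t) * (3 * t - 1)) + l * (2 * (2.63 - 1.37 * t)) - 4 \<ge> 0" .
qed

text \<open>The middle coefficient of the determinant for \<open>\<alpha> = 1/2\<close>, and the whole determinant at
  \<open>q = 1.36\<close>. The latter nearly vanishes at \<open>t = 0.662\<close>, which explains the bound \<open>2.36\<close> for \<open>p\<close>.\<close>

lemma det_coefficients_half:
  fixes t q :: real
  assumes t: "0 < t" "t < 1"
  defines "l \<equiv> artanh t / t" and "q \<equiv> 34/25"
  shows "l\<^sup>2 * ((1 - t) * (3 * t - 1)) + l * (5 - 3 * t) - 4 \<ge> 0"
    and "2 * q\<^sup>2 * t * (l\<^sup>2 * (3 - t) - 3 * l)
         + q * (l\<^sup>2 * ((1 - t) * (3 * t - 1)) + l * (5 - 3 * t) - 4) + l * (1 - t) \<ge> 0"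
proof -
  define N D where "N = 945 - 735 * t\<^sup>2 + 64 * t ^ 4" and "D = 945 - 1050 * t\<^sup>2 + 225 * t ^ 4"
  have t2: "t\<^sup>2 < 1" "t\<^sup>2 \<ge> 0" using t by (auto simp: abs_square_less_1)
  have "D = (1 - t\<^sup>2) * (825 - 225 * t\<^sup>2) + 120" unfolding D_def by algebra
  moreover have "(1 - t\<^sup>2) * (825 - 225 * t\<^sup>2) \<ge> 0" using t2 by simp
  ultimately have D: "D > 0" by linarith
  have "N - D = t\<^sup>2 * (315 - 161 * t\<^sup>2)" unfolding D_def N_def by algebra
  also have "\<dots> \<ge> 0" using t2 by simp
  finally have N: "N \<ge> D" by simp
  define r where "r = N / D"
  have r1: "r \<ge> 1" using N D by (simp add: r_def)
  have rl: "r \<le> l"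
    using artanh_ge_pade_5_4[of t] t D by (simp add: r_def l_def N_def D_def field_simps)
  have l_le: "l \<le> 1 / (1 - t\<^sup>2)"
    using artanh_le[of t] t by (simp add: l_def field_simps)
  have mid: "(l + r) * ((1 - t) * (3 * t - 1)) \<ge> - 2"
    using middle_factor_bound[OF t _ rl l_le] r1 by simp
  define u where "u = 1 - t"
  have "N\<^sup>2 * ((1 - t) * (3 * t - 1)) + N * D * (5 - 3 * t) - 4 * D\<^sup>2 =
    893025 * t * u ^ 9 + 6251175 * t ^ 2 * u ^ 8 + 17364375 * t ^ 3 * u ^ 7 +
    24151365 * t ^ 4 * u ^ 6 + 17311140 * t ^ 5 * u ^ 5 + 5814900 * t ^ 6 * u ^ 4 +
    795480 * t ^ 7 * u ^ 3 + 253484 * t ^ 8 * u ^ 2 + 127352 * t ^ 9 * u + 8160 * t ^ 10"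
    unfolding N_def D_def u_def by algebra
  also have "\<dots> \<ge> 0" using t by (simp add: u_def)
  finally have "(N\<^sup>2 * ((1 - t) * (3 * t - 1)) + N * D * (5 - 3 * t) - 4 * D\<^sup>2) / D\<^sup>2 \<ge> 0"
    by simp
  also have "(N\<^sup>2 * ((1 - t) * (3 * t - 1)) + N * D * (5 - 3 * t) - 4 * D\<^sup>2) / D\<^sup>2
     = r\<^sup>2 * ((1 - t) * (3 * t - 1)) + r * (5 - 3 * t) - 4"
    using D by (simp add: r_def divide_simps power2_eq_square)
  also have "\<dots> \<le> l\<^sup>2 * ((1 - t) * (3 * t - 1)) + l * (5 - 3 * t) - 4"
  proof (rule quadratic_mono[OF rl])
    show "0 \<le> (l + r) * ((1 - t) * (3 * t - 1)) + (5 - 3 * t)" using mid t by linarith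
  qed
  finally show "l\<^sup>2 * ((1 - t) * (3 * t - 1)) + l * (5 - 3 * t) - 4 \<ge> 0" .

  let ?A = "2 * q\<^sup>2 * t * (3 - t) + q * ((1 - t) * (3 * t - 1))"
  let ?B = "q * (5 - 3 * t) + (1 - t) - 6 * q\<^sup>2 * t"
  \<comment> \<open>Near \<open>t = 65/98\<close> the polynomial almost has a double zero. Division by \<open>(t - 65/98)\<^sup>2\<close> leaves a quotient
    with positive Bernstein coefficients and a linear remainder that is positive on the unit interval.\<close>
  have "2 * q\<^sup>2 * t * (N\<^sup>2 * (3 - t) - 3 * N * D) 
    + q * (N\<^sup>2 * ((1 - t) * (3 * t - 1)) + N * D * (5 - 3 * t) - 4 * D\<^sup>2) + N * D * (1 - t)
    = (t - 65/98)\<^sup>2 * ((13492078863680075800769 / 6646586113920200) * u ^ 8 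
     + (306955514228859245505521 / 13293172227840400) * t * u ^ 7 
     + (197464315570736929630221 / 1899024603977200) * t ^ 2 * u ^ 6 
     + (2320783631897573049799803 / 9495123019886000) * t ^ 3 * u ^ 5 
     + (3111060670972824844516413 / 9495123019886000) * t ^ 4 * u ^ 4 
     + (2413939271775734755546929 / 9495123019886000) * t ^ 5 * u ^ 3 
     + (1040983484464732749930651 / 9495123019886000) * t ^ 6 * u ^ 2 
     + (7764772466234129501685171 / 332329305696010000) * t ^ 7 * u
     + (590968133015472383021219 / 332329305696010000) * t ^ 8) 
     + (46307571665819846839 / 2553352521523584032 - 2487942792168906389 / 521092351331343680 * t)"
    unfolding N_def D_def u_def q_def by algebra
  also have "\<dots> \<ge> 0" using t by (intro add_nonneg_nonneg mult_nonneg_nonneg) (auto simp: u_def)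
  finally have "0 \<le> (2 * q\<^sup>2 * t * (N\<^sup>2 * (3 - t) - 3 * N * D) 
    + q * (N\<^sup>2 * ((1 - t) * (3 * t - 1)) + N * D * (5 - 3 * t) - 4 * D\<^sup>2) + N * D * (1 - t)) / D\<^sup>2"
    by simp
  also have "\<dots> = r\<^sup>2 * ?A + r * ?B - 4 * q"
    using D by (simp add: r_def divide_simps power2_eq_square) algebra
  also have "\<dots> \<le> l\<^sup>2 * ?A + l * ?B - 4 * q"
  proof (rule quadratic_mono[OF rl])
    have "(l + r) * (2 * q\<^sup>2 * t * (3 - t)) \<ge> 2 * (2 * q\<^sup>2 * t * (3 - t))"
      using r1 rl t by (intro mult_right_mono) auto
    moreover have "q * ((l + r) * ((1 - t) * (3 * t - 1))) \<ge> q * (- 2)"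
      using mid by (intro mult_left_mono) (auto simp: q_def)
    moreover have "2 * (2 * q\<^sup>2 * t * (3 - t)) + q * (- 2) + ?B
        = q\<^sup>2 * t * (2 * (3 - 2 * t)) + q * (3 - 3 * t) + (1 - t)" by algebra
    moreover have "q\<^sup>2 * t * (2 * (3 - 2 * t)) + q * (3 - 3 * t) + (1 - t) \<ge> 0"
      using t by (intro add_nonneg_nonneg mult_nonneg_nonneg) (auto simp: q_def)
    ultimately show "0 \<le> (l + r) * ?A + ?B" by (simp add: algebra_simps)
  qed
  also have "\<dots> = 2 * q\<^sup>2 * t * (l\<^sup>2 * (3 - t) - 3 * l)
         + q * (l\<^sup>2 * ((1 - t) * (3 * t - 1)) + l * (5 - 3 * t) - 4) + l * (1 - t)" by algebra
  finally show "2 * q\<^sup>2 * t * (l\<^sup>2 * (3 - t) - 3 * l)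
         + q * (l\<^sup>2 * ((1 - t) * (3 * t - 1)) + l * (5 - 3 * t) - 4) + l * (1 - t) \<ge> 0" .
qed

text \<open>Since \<open>z = (1 - t) / (2 * t)\<close> and \<open>L = artanh t = t * l\<close>, the substitution clears all denominators
  and displays the determinant condition as a quadratic polynomial in \<open>q\<close>.\<close>

lemma det_expansion:
  fixes z q k :: real
  assumes z: "z > 0" and q: "q > 0"
  defines "t \<equiv> 1 / (2 * z + 1)" and "L \<equiv> ln (1 + 1 / z) / 2"
  defines "l \<equiv> artanh t / t"
  shows "4 * q * ((1 + q) * (z + q) * (k * L / q + L\<^sup>2) - (1 - L * (z - q))\<^sup>2) =
    q\<^sup>2 * (2 * t * (l\<^sup>2 * (3 - t) - 2 * (2 - k) * l))
    + q * (l\<^sup>2 * ((1 - t) * (3 * t - 1)) + 2 * l * (k * (1 + t) + 2 * (1 - t)) - 4)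
    + 2 * k * l * (1 - t)"
proof -
  have t: "0 < t" "t < 1" using z by (auto simp: t_def)
  have "(1 + t) / (1 - t) = 1 + 1 / z" using z by (simp add: t_def divide_simps)
  hence "L = artanh t" by (simp add: L_def artanh_def)
  hence L: "L = t * l" using t by (simp add: l_def)
  have zt: "z = (1 - t) / (2 * t)" using z by (simp add: t_def divide_simps)
  have "q * (k * L / q + L\<^sup>2) = k * L + q * L\<^sup>2" using q by (simp add: field_simps)
  hence "4 * q * ((1 + q) * (z + q) * (k * L / q + L\<^sup>2) - (1 - L * (z - q))\<^sup>2)
    = 4 * ((1 + q) * (z + q) * (k * L + q * L\<^sup>2)) - 4 * q * (1 - L * (z - q))\<^sup>2" by algebra
  also have "\<dots> = 4 * ((1 + q) * (t * z + t * q) * (k * l + q * t * l\<^sup>2)) - 4 * q * (1 - l * (t * z - t * q))\<^sup>2"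
    unfolding L by algebra
  also have "t * z = (1 - t) / 2" using t by (simp add: zt)
  also have "4 * ((1 + q) * ((1 - t) / 2 + t * q) * (k * l + q * t * l\<^sup>2)) - 4 * q * (1 - l * ((1 - t) / 2 - t * q))\<^sup>2
    = q\<^sup>2 * (2 * t * (l\<^sup>2 * (3 - t) - 2 * (2 - k) * l))
    + q * (l\<^sup>2 * ((1 - t) * (3 * t - 1)) + 2 * l * (k * (1 + t) + 2 * (1 - t)) - 4)
    + 2 * k * l * (1 - t)" by algebra
  finally show ?thesis .
qed

text \<open>This is the condition on the Hessian determinant of the crossing cost for \<open>\<alpha> = 0.37\<close>: each of the three
  coefficients in \<open>q\<close> is nonnegative.\<close>

lemma hessian_det_037:
  fixes z q :: real
  assumes z: "z > 0" and q: "q > 0"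
  defines "L \<equiv> ln (1 + 1 / z) / 2"
  shows "(1 - L * (z - q))\<^sup>2 \<le> (1 + q) * (z + q) * ((1 - 0.37) * L / q + L\<^sup>2)" (is "?l \<le> ?r")
proof -
  define t l where "t = 1 / (2 * z + 1)" and "l = artanh t / t"
  have t: "0 < t" "t < 1" using z by (auto simp: t_def)
  note c = det_coefficients_037[OF t, folded l_def]
  have "l * (3 - t) > 0" by (rule order.strict_trans2[OF _ c(1)]) simp
  hence l: "l > 0" using t by (simp add: zero_less_mult_iff)
  have "l * (l * (3 - t) - 2.74) \<ge> 0" using c l by (intro mult_nonneg_nonneg) auto
  hence "l\<^sup>2 * (3 - t) - 2 * (2 - 0.63) * l \<ge> 0" by (simp add: algebra_simps power2_eq_square)
  hence 1: "q\<^sup>2 * (2 * t * (l\<^sup>2 * (3 - t) - 2 * (2 - 0.63) * l)) \<ge> 0" using t by simp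
  have "l\<^sup>2 * ((1 - t) * (3 * t - 1)) + 2 * l * (0.63 * (1 + t) + 2 * (1 - t)) - 4 \<ge> 0"
    using c(2) by (simp add: field_simps)
  hence "q * (l\<^sup>2 * ((1 - t) * (3 * t - 1)) + 2 * l * (0.63 * (1 + t) + 2 * (1 - t)) - 4) \<ge> 0" 
    using q by simp
  moreover have "2 * 0.63 * l * (1 - t) \<ge> 0" using t l by simp
  ultimately have "4 * q * (?r - ?l) \<ge> 0" using 1 
    using det_expansion[OF z q, of "0.63"] unfolding L_def l_def t_def by simp
  thus ?thesis using q by (simp add: zero_le_mult_iff)
qed

text \<open>Where the leading coefficient is negative, the quadratic polynomial in \<open>q\<close> is concave, so it lies
  above the chord between its values at \<open>q = 0\<close> and \<open>q = 1.36\<close>.\<close>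

lemma hessian_det_half:
  fixes z q :: real
  assumes z: "z > 0" and q: "q > 0" "q \<le> 1.36"
  defines "L \<equiv> ln (1 + 1 / z) / 2"
  shows "(1 - L * (z - q))\<^sup>2 \<le> (1 + q) * (z + q) * ((1 - 1/2) * L / q + L\<^sup>2)" (is "?l \<le> ?r")
proof -
  define t l where "t = 1 / (2 * z + 1)" and "l = artanh t / t"
  have t: "0 < t" "t < 1" using z by (auto simp: t_def)
  define a b c where "a = 2 * t * (l\<^sup>2 * (3 - t) - 3 * l)"
    and "b = l\<^sup>2 * ((1 - t) * (3 * t - 1)) + l * (5 - 3 * t) - 4" and "c = l * (1 - t)"
  have b: "b \<ge> 0" and e: "(34/25)\<^sup>2 * a + 34/25 * b + c \<ge> 0"
    using det_coefficients_half[OF t] by (auto simp: a_def b_def c_def l_def algebra_simps)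
  have "artanh t \<ge> 0" using t by (simp add: artanh_def)
  hence "l \<ge> 0" using t by (simp add: l_def)
  hence c: "c \<ge> 0" using t by (simp add: c_def)
  have "q\<^sup>2 * a + q * b + c \<ge> 0"
  proof (cases "a \<ge> 0")
    case True
    thus ?thesis using b c q by simp
  next
    case False
    define \<theta> where "\<theta> = q / (34/25)"
    have \<theta>: "0 \<le> \<theta>" "\<theta> \<le> 1" "q = \<theta> * (34/25)" using q by (auto simp: \<theta>_def)
    have "\<theta> * (1 - \<theta>) * (34/25)\<^sup>2 * (-a) \<ge> 0"
      using False \<theta> by (intro mult_nonneg_nonneg) auto
    moreover have "\<theta> * ((34/25)\<^sup>2 * a + 34/25 * b + c) \<ge> 0" "(1 - \<theta>) * c \<ge> 0" using e c \<theta> by auto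
    moreover have "q\<^sup>2 * a + q * b + c = \<theta> * ((34/25)\<^sup>2 * a + 34/25 * b + c) + (1 - \<theta>) * c
      + \<theta> * (1 - \<theta>) * (34/25)\<^sup>2 * (-a)" unfolding \<theta>(3) by algebra
    ultimately show ?thesis by linarith
  qed
  also have "q\<^sup>2 * a + q * b + c = q\<^sup>2 * (2 * t * (l\<^sup>2 * (3 - t) - 2 * (2 - 1/2) * l))
    + q * (l\<^sup>2 * ((1 - t) * (3 * t - 1)) + 2 * l * (1/2 * (1 + t) + 2 * (1 - t)) - 4)
    + 2 * (1/2) * l * (1 - t)" unfolding a_def b_def c_def by algebra
  also have "\<dots> = 4 * q * (?r - ?l)"
    using det_expansion[OF z q(1), of "1/2"] unfolding L_def l_def t_def by simp
  finally show ?thesis using q by (simp add: zero_le_mult_iff)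
qed

section \<open>Joint convexity of the crossing cost\<close>

lemma quadratic_form_nonneg:
  fixes A B C X Y :: real
  assumes "A > 0" "B\<^sup>2 \<le> A * C"
  shows "A * X\<^sup>2 + 2 * B * X * Y + C * Y\<^sup>2 \<ge> 0"
proof -
  have "A * (A * X\<^sup>2 + 2 * B * X * Y + C * Y\<^sup>2) = (A * X + B * Y)\<^sup>2 + (A * C - B\<^sup>2) * Y\<^sup>2"
    by algebra
  also have "\<dots> \<ge> 0" using assms by simp
  finally show ?thesis using assms by (simp add: zero_le_mult_iff)
qed

text \<open>The energy per unit of height on a branch with inverse slope \<open>s\<close>, that is, the perspective
  \<open>s * F p (1 / s)\<close> of the energy density.\<close>

definition crossing_cost :: "real \<Rightarrow> real \<Rightarrow> real" where
  "crossing_cost p s = s * (1 + 1 / s\<^sup>2) powr (p / 2)"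

text \<open>Along a segment the cost is \<open>exp g\<close>, whose second derivative \<open>exp g * (g'' + g'\<^sup>2)\<close> is a quadratic
  form in \<open>X = s' / (s * (s\<^sup>2 + 1))\<close> and \<open>Y = \<beta> * (w' / w) * q\<close>, where \<open>q = w powr \<beta>\<close>. The hypothesis \<open>det\<close> is the
  discriminant condition of that form, with \<open>z = s\<^sup>2\<close>.\<close>

lemma crossing_cost_midpoint_pos:
  fixes \<beta> Q :: real
  assumes \<beta>: "\<beta> > 0"
    and det: "\<And>z q. z > 0 \<Longrightarrow> 0 < q \<Longrightarrow> q \<le> Q \<Longrightarrow>
        (1 - ln (1 + 1 / z) / 2 * (z - q))\<^sup>2
          \<le> (1 + q) * (z + q) * ((1 - 1 / \<beta>) * (ln (1 + 1 / z) / 2) / q + (ln (1 + 1 / z) / 2)\<^sup>2)"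
    and s: "s1 > 0" "s2 > 0" and w: "w1 > 0" "w2 > 0" "w1 powr \<beta> \<le> Q" "w2 powr \<beta> \<le> Q"
  shows "2 * crossing_cost (1 + ((w1 + w2) / 2) powr \<beta>) ((s1 + s2) / 2)
      \<le> crossing_cost (1 + w1 powr \<beta>) s1 + crossing_cost (1 + w2 powr \<beta>) s2"
proof -
  define ds dw where "ds = s2 - s1" and "dw = w2 - w1"
  define s w where "s = (\<lambda>\<tau>. s1 + \<tau> * ds)" and "w = (\<lambda>\<tau>. w1 + \<tau> * dw)"
  define \<sigma> \<omega> where "\<sigma> = (\<lambda>\<tau>. ds / s \<tau>)" and "\<omega> = (\<lambda>\<tau>. dw / w \<tau>)"
  define q L R where "q = (\<lambda>\<tau>. w \<tau> powr \<beta>)" and "L = (\<lambda>\<tau>. ln (1 + 1 / (s \<tau>)\<^sup>2) / 2)"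
    and "R = (\<lambda>\<tau>. 1 / ((s \<tau>)\<^sup>2 + 1))"
  define g where "g = (\<lambda>\<tau>. ln (s \<tau>) + (1 + q \<tau>) * L \<tau>)"
  define g1 where "g1 = (\<lambda>\<tau>. \<sigma> \<tau> + \<beta> * \<omega> \<tau> * q \<tau> * L \<tau> - (1 + q \<tau>) * \<sigma> \<tau> * R \<tau>)"
  define g2 where "g2 = (\<lambda>\<tau>. - (\<sigma> \<tau>)\<^sup>2 - \<beta> * (\<omega> \<tau>)\<^sup>2 * q \<tau> * L \<tau> + \<beta>\<^sup>2 * (\<omega> \<tau>)\<^sup>2 * q \<tau> * L \<tau>
      - 2 * \<beta> * \<omega> \<tau> * q \<tau> * \<sigma> \<tau> * R \<tau> + (1 + q \<tau>) * (\<sigma> \<tau>)\<^sup>2 * R \<tau>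
      + 2 * (1 + q \<tau>) * (\<sigma> \<tau>)\<^sup>2 * (s \<tau>)\<^sup>2 * (R \<tau>)\<^sup>2)"
  have pos: "s \<tau> > 0" "w \<tau> > 0" "w \<tau> \<le> max w1 w2" if "\<tau> \<in> {0..1}" for \<tau>
  proof -
    have "s \<tau> = (1 - \<tau>) * s1 + \<tau> * s2" "w \<tau> = (1 - \<tau>) * w1 + \<tau> * w2"
      by (auto simp: s_def w_def ds_def dw_def algebra_simps)
    moreover have "(1 - \<tau>) * s1 + \<tau> * s2 > 0" "(1 - \<tau>) * w1 + \<tau> * w2 > 0"
      using that s w by (auto intro!: add_nonneg_pos add_pos_nonneg simp: less_le)
        (auto simp: add_nonneg_eq_0_iff)
    moreover have "(1 - \<tau>) * w1 + \<tau> * w2 \<le> (1 - \<tau>) * max w1 w2 + \<tau> * max w1 w2"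
      using that by (intro add_mono mult_left_mono) auto
    ultimately show "s \<tau> > 0" "w \<tau> > 0" "w \<tau> \<le> max w1 w2" by (auto simp: algebra_simps)
  qed
  have Ds: "(s has_real_derivative ds) (at \<tau>)" and Dw: "(w has_real_derivative dw) (at \<tau>)" for \<tau>
    by (auto simp: s_def w_def intro!: derivative_eq_intros)
  have D1: "(\<sigma> has_real_derivative - (\<sigma> \<tau>)\<^sup>2) (at \<tau>)"
    and D2: "(\<omega> has_real_derivative - (\<omega> \<tau>)\<^sup>2) (at \<tau>)"
    and D3: "(q has_real_derivative \<beta> * \<omega> \<tau> * q \<tau>) (at \<tau>)"
    and D4: "(L has_real_derivative - \<sigma> \<tau> * R \<tau>) (at \<tau>)"
    and D5: "(R has_real_derivative - 2 * (s \<tau>)\<^sup>2 * \<sigma> \<tau> * (R \<tau>)\<^sup>2) (at \<tau>)" 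
    and D6: "((\<lambda>\<tau>. ln (s \<tau>)) has_real_derivative \<sigma> \<tau>) (at \<tau>)"
    if "\<tau> \<in> {0..1}" for \<tau>
  proof -
    note p = pos[OF that]
    show "(\<sigma> has_real_derivative - (\<sigma> \<tau>)\<^sup>2) (at \<tau>)"
      unfolding \<sigma>_def using p 
      by (auto intro!: derivative_eq_intros Ds simp: power2_eq_square divide_simps)
    show "(\<omega> has_real_derivative - (\<omega> \<tau>)\<^sup>2) (at \<tau>)"
      unfolding \<omega>_def using p 
      by (auto intro!: derivative_eq_intros Dw simp: power2_eq_square divide_simps)
    show "(q has_real_derivative \<beta> * \<omega> \<tau> * q \<tau>) (at \<tau>)"
      unfolding q_def \<omega>_def using p
      by (auto intro!: derivative_eq_intros Dw simp: powr_diff divide_simps)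
    have n: "1 + 1 / (s \<tau>)\<^sup>2 > 0" by (auto intro: add_pos_nonneg)
    show "(L has_real_derivative - \<sigma> \<tau> * R \<tau>) (at \<tau>)"
      unfolding L_def \<sigma>_def R_def
      apply (rule derivative_eq_intros Ds refl n | use p in force)+
      using p by (simp add: divide_simps add_nonneg_eq_0_iff) algebra
    have n: "(s \<tau>)\<^sup>2 + 1 > 0" by (auto intro: add_nonneg_pos)
    show "(R has_real_derivative - 2 * (s \<tau>)\<^sup>2 * \<sigma> \<tau> * (R \<tau>)\<^sup>2) (at \<tau>)"
      unfolding R_def \<sigma>_def
      apply (rule derivative_eq_intros Ds refl | use n in force)+
      using p n by (simp add: divide_simps add_nonneg_eq_0_iff) algebra
    show "((\<lambda>\<tau>. ln (s \<tau>)) has_real_derivative \<sigma> \<tau>) (at \<tau>)"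
      unfolding \<sigma>_def using p by (auto intro!: derivative_eq_intros Ds)
  qed
  have Dg: "(g has_real_derivative g1 \<tau>) (at \<tau>)" if "\<tau> \<in> {0..1}" for \<tau>
    unfolding g_def
    apply (rule D3 D4 D6 that refl derivative_eq_intros)+
    by (simp add: g1_def algebra_simps)
  have Dg1: "(g1 has_real_derivative g2 \<tau>) (at \<tau>)" if "\<tau> \<in> {0..1}" for \<tau>
    unfolding g1_def
    apply (rule D1 D2 D3 D4 D5 that refl derivative_eq_intros)+
    by (simp add: g2_def algebra_simps power2_eq_square)
  have nonneg: "g2 \<tau> + (g1 \<tau>)\<^sup>2 \<ge> 0" if t: "\<tau> \<in> {0..1}" for \<tau>
  proof -
    note p = pos[OF t]
    define z where "z = (s \<tau>)\<^sup>2"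
    have z: "z > 0" using p by (simp add: z_def)
    have q: "q \<tau> > 0" using p by (simp add: q_def)
    have "q \<tau> \<le> max w1 w2 powr \<beta>" unfolding q_def using p \<beta> by (intro powr_mono2) auto
    also have "\<dots> \<le> Q" using w by (auto simp: max_def)
    finally have qQ: "q \<tau> \<le> Q" .
    have L: "L \<tau> = ln (1 + 1 / z) / 2" by (simp add: L_def z_def)
    let ?A = "(1 + q \<tau>) * (z + q \<tau>)" and ?B = "L \<tau> * (z - q \<tau>) - 1"
    let ?C = "(1 - 1 / \<beta>) * L \<tau> / q \<tau> + (L \<tau>)\<^sup>2"
    let ?X = "\<sigma> \<tau> * R \<tau>" and ?Y = "\<beta> * \<omega> \<tau> * q \<tau>"
    have "?B\<^sup>2 \<le> ?A * ?C"
      using det[OF z q qQ] unfolding L by (simp add: power2_commute)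
    hence "0 \<le> ?A * ?X\<^sup>2 + 2 * ?B * ?X * ?Y + ?C * ?Y\<^sup>2"
      using z q by (intro quadratic_form_nonneg) auto
    also have "?C * ?Y\<^sup>2 = (\<beta>\<^sup>2 - \<beta>) * (\<omega> \<tau>)\<^sup>2 * q \<tau> * L \<tau> + (L \<tau> * ?Y)\<^sup>2"
      using q \<beta> by (simp add: field_simps power2_eq_square)
    also have "?A * ?X\<^sup>2 + 2 * ?B * ?X * ?Y + ((\<beta>\<^sup>2 - \<beta>) * (\<omega> \<tau>)\<^sup>2 * q \<tau> * L \<tau> + (L \<tau> * ?Y)\<^sup>2)
       = g2 \<tau> + (g1 \<tau>)\<^sup>2"
    proof -
      have R: "z * R \<tau> = 1 - R \<tau>" using z unfolding R_def z_def[symmetric] by (simp add: field_simps)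
      show ?thesis unfolding g1_def g2_def z_def[symmetric] using R by algebra
    qed
    finally show ?thesis .
  qed
  have "convex_on {0..1} (\<lambda>\<tau>. exp (g \<tau>))"
  proof (rule f''_ge0_imp_convex)
    show "((\<lambda>\<tau>. exp (g \<tau>)) has_real_derivative exp (g \<tau>) * g1 \<tau>) (at \<tau>)" if "\<tau> \<in> {0..1}" for \<tau>
      using that by (auto intro!: derivative_eq_intros Dg)
    show "((\<lambda>\<tau>. exp (g \<tau>) * g1 \<tau>) has_real_derivative exp (g \<tau>) * (g2 \<tau> + (g1 \<tau>)\<^sup>2)) (at \<tau>)"
      if "\<tau> \<in> {0..1}" for \<tau>
      apply (rule derivative_eq_intros Dg Dg1 that refl)+
      by (simp add: algebra_simps power2_eq_square)
  qed (use nonneg in auto)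
  from convex_onD[OF this, of "1/2" 0 1]
  have "2 * exp (g (1/2)) \<le> exp (g 0) + exp (g 1)" by simp
  moreover have "exp (g \<tau>) = crossing_cost (1 + w \<tau> powr \<beta>) (s \<tau>)" if "\<tau> \<in> {0..1}" for \<tau>
  proof -
    have "1 + 1 / (s \<tau>)\<^sup>2 > 0" by (auto intro: add_pos_nonneg)
    thus ?thesis using pos[OF that]
      by (simp add: g_def crossing_cost_def exp_add powr_def q_def L_def)
  qed
  moreover have "s (1/2) = (s1 + s2) / 2" "w (1/2) = (w1 + w2) / 2" "s 0 = s1" "s 1 = s2" "w 0 = w1" "w 1 = w2"
    by (auto simp: s_def w_def ds_def dw_def field_simps)
  ultimately show ?thesis by simp
qed


lemma crossing_cost_mono:
  assumes "p \<le> p'" "s > 0"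
  shows "crossing_cost p s \<le> crossing_cost p' s"
  unfolding crossing_cost_def using assms by (intro mult_left_mono powr_mono) auto

text \<open>Extension to the boundary \<open>w = 0\<close>, where powers are not differentiable. Truncation from below
  by \<open>e n\<close>, rather than a shift by \<open>e n\<close>, respects the upper bound \<open>Q\<close>.\<close>

lemma crossing_cost_midpoint:
  fixes \<beta> Q :: real
  assumes \<beta>: "\<beta> > 0" and Q: "Q > 0"
    and det: "\<And>z q. z > 0 \<Longrightarrow> 0 < q \<Longrightarrow> q \<le> Q \<Longrightarrow>
        (1 - ln (1 + 1 / z) / 2 * (z - q))\<^sup>2
          \<le> (1 + q) * (z + q) * ((1 - 1 / \<beta>) * (ln (1 + 1 / z) / 2) / q + (ln (1 + 1 / z) / 2)\<^sup>2)"
    and s: "s1 > 0" "s2 > 0" and w: "w1 \<ge> 0" "w2 \<ge> 0" "w1 powr \<beta> \<le> Q" "w2 powr \<beta> \<le> Q"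
  shows "2 * crossing_cost (1 + ((w1 + w2) / 2) powr \<beta>) ((s1 + s2) / 2)
      \<le> crossing_cost (1 + w1 powr \<beta>) s1 + crossing_cost (1 + w2 powr \<beta>) s2"
proof -
  define e where "e = (\<lambda>n::nat. Q powr (1 / \<beta>) / real (Suc n))"
  have e0: "e n > 0" for n using Q by (simp add: e_def)
  have eQ: "e n powr \<beta> \<le> Q" for n
  proof -
    have "e n \<le> Q powr (1 / \<beta>)" using Q by (simp add: e_def divide_simps mult_le_cancel_left1)
    hence "e n powr \<beta> \<le> (Q powr (1 / \<beta>)) powr \<beta>" using e0[of n] \<beta> by (intro powr_mono2) auto
    thus ?thesis using \<beta> Q by (simp add: powr_powr)
  qed
  have "e \<longlonglongrightarrow> 0" unfolding e_def
    using tendsto_mult[OF tendsto_const[of "Q powr (1 / \<beta>)"] LIMSEQ_inverse_real_of_nat]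
    by (simp add: divide_inverse)
  hence lim: "(\<lambda>n. max w (e n)) \<longlonglongrightarrow> w" if "w \<ge> 0" for w
    using tendsto_max[OF tendsto_const[of w], of e 0] that by (simp add: max_def)
  have cost: "(\<lambda>n. crossing_cost (1 + f n powr \<beta>) s) \<longlonglongrightarrow> crossing_cost (1 + w powr \<beta>) s"
    if "f \<longlonglongrightarrow> w" "\<And>n. f n > 0" "s > 0" for f :: "nat \<Rightarrow> real" and w s
  proof -
    have "(1::real) + 1 / s\<^sup>2 > 0" by (auto intro: add_pos_nonneg)
    moreover have "(\<lambda>n. f n powr \<beta>) \<longlonglongrightarrow> w powr \<beta>"
      using that \<beta> by (intro tendsto_powr') (auto intro!: always_eventually less_imp_le)
    ultimately show ?thesis unfolding crossing_cost_def by (auto intro!: tendsto_intros)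
  qed
  have max_pos: "max w (e n) > 0" for w n using e0[of n] by (simp add: less_max_iff_disj)
  have max_Q: "max w (e n) powr \<beta> \<le> Q" if "w powr \<beta> \<le> Q" for w n
    using that eQ[of n] by (simp add: max_def)
  show ?thesis
  proof (rule LIMSEQ_le)
    show "(\<lambda>n. 2 * crossing_cost (1 + ((max w1 (e n) + max w2 (e n)) / 2) powr \<beta>) ((s1 + s2) / 2))
       \<longlonglongrightarrow> 2 * crossing_cost (1 + ((w1 + w2) / 2) powr \<beta>) ((s1 + s2) / 2)"
      using s e0 by (intro tendsto_intros cost lim w) (auto intro!: add_pos_pos simp: less_max_iff_disj)
    show "(\<lambda>n. crossing_cost (1 + max w1 (e n) powr \<beta>) s1 + crossing_cost (1 + max w2 (e n) powr \<beta>) s2)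
       \<longlonglongrightarrow> crossing_cost (1 + w1 powr \<beta>) s1 + crossing_cost (1 + w2 powr \<beta>) s2"
      using s e0 by (intro tendsto_intros cost lim w) (auto simp: less_max_iff_disj)
    show "\<exists>N. \<forall>n\<ge>N. 2 * crossing_cost (1 + ((max w1 (e n) + max w2 (e n)) / 2) powr \<beta>) ((s1 + s2) / 2)
      \<le> crossing_cost (1 + max w1 (e n) powr \<beta>) s1 + crossing_cost (1 + max w2 (e n) powr \<beta>) s2"
    proof (intro exI allI impI crossing_cost_midpoint_pos[OF \<beta> det s] max_pos)
      show "max w1 (e n) powr \<beta> \<le> Q" "max w2 (e n) powr \<beta> \<le> Q" for n
        by (rule max_Q[OF w(3)], rule max_Q[OF w(4)])
    qed
  qed
qed

text \<open>The point \<open>x\<close> is a convex combination of \<open>y\<close> and \<open>- y\<close>.\<close>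

lemma even_convex_mono:
  fixes f :: "real \<Rightarrow> real"
  assumes "convex_on {-1..1} f" "\<And>x. x \<in> {-1..1} \<Longrightarrow> f (- x) = f x"
    and xy: "\<bar>x\<bar> \<le> \<bar>y\<bar>" "y \<in> {-1..1}"
  shows "f x \<le> f y"
proof (cases "y = 0")
  case True thus ?thesis using xy by simp
next
  case False
  define \<theta> where "\<theta> = (1 + x / y) / 2"
  have "\<bar>x / y\<bar> \<le> 1" using False xy unfolding abs_divide by simp
  hence "- 1 \<le> x / y" "x / y \<le> 1" by (simp_all only: abs_le_iff) linarith
  hence \<theta>: "0 \<le> \<theta>" "\<theta> \<le> 1" by (auto simp: \<theta>_def)
  have "f ((1 - \<theta>) *\<^sub>R (-y) + \<theta> *\<^sub>R y) \<le> (1 - \<theta>) * f (-y) + \<theta> * f y"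
    using \<theta> xy by (intro convex_onD[OF assms(1)]) auto
  also have "(1 - \<theta>) *\<^sub>R (-y) + \<theta> *\<^sub>R y = x" using False by (simp add: \<theta>_def field_simps)
  finally show ?thesis using assms(2) xy by (simp add: algebra_simps)
qed

lemma exponent_mono:
  fixes p :: "real \<Rightarrow> real" 
  assumes conv: "convex_on {-1..1} (\<lambda>x. (p x - 1) powr \<alpha>)" and \<alpha>: "\<alpha> > 0"
    and even: "\<And>x. x \<in> {-1..1} \<Longrightarrow> p (- x) = p x" and p1: "\<And>x. x \<in> {-1..1} \<Longrightarrow> p x \<ge> 1"
    and xy: "\<bar>x\<bar> \<le> \<bar>y\<bar>" "y \<in> {-1..1}"
  shows "p x \<le> p y"
proof -
  have x: "x \<in> {-1..1}" using xy by auto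
  have "(p x - 1) powr \<alpha> \<le> (p y - 1) powr \<alpha>"
    by (rule even_convex_mono[OF conv _ xy]) (simp add: even)
  hence "((p x - 1) powr \<alpha>) powr (1/\<alpha>) \<le> ((p y - 1) powr \<alpha>) powr (1/\<alpha>)"
    using \<alpha> by (rule_tac powr_mono2) auto
  thus ?thesis using \<alpha> p1[OF x] p1[OF xy(2)] by (simp add: powr_powr)
qed

text \<open>A function that is jointly convex in \<open>(w, s)\<close> and increasing in \<open>w\<close> stays convex when a convex
  function of \<open>x\<close> is inserted for \<open>w\<close>.\<close>

lemma crossing_cost_exponent_midpoint:
  fixes p :: "real \<Rightarrow> real" 
  assumes conv: "convex_on {-1..1} (\<lambda>x. (p x - 1) powr \<alpha>)" and \<alpha>: "\<alpha> > 0" and Q: "Q > 0"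
    and p1: "\<And>x. x \<in> {-1..1} \<Longrightarrow> p x \<ge> 1" and pQ: "\<And>x. x \<in> {-1..1} \<Longrightarrow> p x - 1 \<le> Q" 
    and det: "\<And>z q. z > 0 \<Longrightarrow> 0 < q \<Longrightarrow> q \<le> Q \<Longrightarrow>
        (1 - ln (1 + 1 / z) / 2 * (z - q))\<^sup>2
          \<le> (1 + q) * (z + q) * ((1 - \<alpha>) * (ln (1 + 1 / z) / 2) / q + (ln (1 + 1 / z) / 2)\<^sup>2)"
    and s: "s1 > 0" "s2 > 0" and x: "x1 \<in> {-1..1}" "x2 \<in> {-1..1}"
  shows "2 * crossing_cost (p ((x1 + x2) / 2)) ((s1 + s2) / 2)
      \<le> crossing_cost (p x1) s1 + crossing_cost (p x2) s2"
proof -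
  define w where "w = (\<lambda>x. (p x - 1) powr \<alpha>)"
  have pw: "p x = 1 + w x powr (1 / \<alpha>)" if "x \<in> {-1..1}" for x
    using p1[OF that] \<alpha> by (simp add: w_def powr_powr)
  have m: "(x1 + x2) / 2 \<in> {-1..1}" using x by auto
  have "w ((1 - 1/2) *\<^sub>R x1 + (1/2) *\<^sub>R x2) \<le> (1 - 1/2) * w x1 + (1/2) * w x2"
    using conv x unfolding w_def by (intro convex_onD[of "{-1..1}"]) auto
  hence "w ((x1 + x2) / 2) \<le> (w x1 + w x2) / 2" by (simp add: field_simps)
  hence "w ((x1 + x2) / 2) powr (1/\<alpha>) \<le> ((w x1 + w x2) / 2) powr (1/\<alpha>)"
    using \<alpha> by (intro powr_mono2) (auto simp: w_def)
  hence "crossing_cost (p ((x1 + x2) / 2)) ((s1 + s2) / 2)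
      \<le> crossing_cost (1 + ((w x1 + w x2) / 2) powr (1/\<alpha>)) ((s1 + s2) / 2)"
    using s pw[OF m] by (intro crossing_cost_mono) auto
  hence "2 * crossing_cost (p ((x1 + x2) / 2)) ((s1 + s2) / 2)
      \<le> 2 * crossing_cost (1 + ((w x1 + w x2) / 2) powr (1/\<alpha>)) ((s1 + s2) / 2)" by simp
  also have "\<dots> \<le> crossing_cost (1 + w x1 powr (1/\<alpha>)) s1 + crossing_cost (1 + w x2 powr (1/\<alpha>)) s2"
    using s \<alpha> Q det pw[OF x(1)] pw[OF x(2)] pQ[OF x(1)] pQ[OF x(2)]
    by (intro crossing_cost_midpoint[where Q = Q]) (auto simp: w_def)
  also have "\<dots> = crossing_cost (p x1) s1 + crossing_cost (p x2) s2"
    using pw[OF x(1)] pw[OF x(2)] by simp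
  finally show ?thesis .
qed

section \<open>Differentiability of monotone functions\<close>

text \<open>Vitali's theorem for intervals that contain their point anywhere, in particular at an end: the slopes over
  such intervals determine the derivative.\<close>

lemma vitali_interval_cover:
  fixes S U :: "real set" and R :: "real \<Rightarrow> real \<Rightarrow> bool"
  assumes U: "open U" "S \<subseteq> U"
    and fine: "\<And>x d. x \<in> S \<Longrightarrow> d > 0 \<Longrightarrow> \<exists>s t. s \<le> x \<and> x \<le> t \<and> s < t \<and> t - s < d \<and> R s t"
  obtains C where "countable C" "\<And>s t. (s, t) \<in> C \<Longrightarrow> s < t \<and> {s..t} \<subseteq> U \<and> R s t"
    "disjoint_family_on (\<lambda>(s, t). {s..t}) C" "negligible (S - (\<Union>(s, t)\<in>C. {s..t}))"
proof -
  define K where "K = {(s, t). s < t \<and> {s..t} \<subseteq> U \<and> R s t}"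
  define c r where "c = (\<lambda>(s::real, t). (s + t) / 2)" and "r = (\<lambda>(s::real, t). (t - s) / 2)"
  have cb: "cball (c i) (r i) = (\<lambda>(s, t). {s..t}) i" for i
    by (cases i) (auto simp: c_def r_def cball_eq_atLeastAtMost field_simps)
  have 1: "0 < r i" if "i \<in> K" for i using that by (auto simp: K_def r_def)
  have 2: "\<exists>i. i \<in> K \<and> x \<in> cball (c i) (r i) \<and> r i < d" if "x \<in> S" "d > 0" for x d
  proof -
    from U that obtain e where e: "e > 0" "cball x e \<subseteq> U" by (meson open_contains_cball subsetD)
    have "min d e > 0" using that e by simp
    from fine[OF that(1) this]
    obtain s t where st: "s \<le> x" "x \<le> t" "s < t" "t - s < min d e" "R s t" by blast
    have "{s..t} \<subseteq> cball x e" unfolding cball_eq_atLeastAtMost using st by auto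
    hence "{s..t} \<subseteq> U" using e by blast
    hence "(s, t) \<in> K" using st by (simp add: K_def)
    moreover have "x \<in> cball (c (s, t)) (r (s, t))" unfolding cb using st by simp
    moreover have "r (s, t) < d" using st by (simp add: r_def)
    ultimately show ?thesis by blast
  qed
  show ?thesis
  proof (rule Vitali_covering_theorem_cballs[of K r S c, OF 1 2])
    fix C assume C: "countable C" "C \<subseteq> K" 
     "pairwise (\<lambda>i j. disjnt (cball (c i) (r i)) (cball (c j) (r j))) C"
     "negligible (S - (\<Union>i\<in>C. cball (c i) (r i)))"
    show ?thesis
    proof (rule that[OF C(1)])
    show "s < t \<and> {s..t} \<subseteq> U \<and> R s t" if "(s, t) \<in> C" for s t
      using that C(2) by (auto simp: K_def)
    show "disjoint_family_on (\<lambda>(s, t). {s..t}) C"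
      using C(3) unfolding cb pairwise_def disjnt_def disjoint_family_on_def by blast
    show "negligible (S - (\<Union>(s, t)\<in>C. {s..t}))" using C(4) unfolding cb .
    qed
  qed
qed

text \<open>The image intervals are half-open because closed ones may share an endpoint.\<close>

lemma mono_image_intervals_disjoint:
  fixes f :: "real \<Rightarrow> real"
  assumes f: "mono_on A f" 
    and C: "\<And>s t. (s, t) \<in> C \<Longrightarrow> s < t \<and> {s..t} \<subseteq> A" "disjoint_family_on (\<lambda>(s, t). {s..t}) C"
  shows "disjoint_family_on (\<lambda>(s, t). {f s..<f t}) C"
  unfolding disjoint_family_on_def
proof (intro ballI impI)
  fix i j assume ij: "i \<in> C" "j \<in> C" "i \<noteq> j"
  obtain s t s' t' where st: "i = (s, t)" "j = (s', t')" by (cases i, cases j)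
  have disj: "{s..t} \<inter> {s'..t'} = {}"
    using C(2) ij unfolding disjoint_family_on_def st by (metis (no_types, lifting) case_prod_conv)
  have c: "s < t" "{s..t} \<subseteq> A" "s' < t'" "{s'..t'} \<subseteq> A" using C(1) ij st by auto
  have "t < s' \<or> t' < s"
  proof (rule ccontr)
    assume "\<not> (t < s' \<or> t' < s)"
    hence "max s s' \<in> {s..t} \<inter> {s'..t'}" using c by auto
    thus False using disj by blast
  qed
  moreover have "s \<in> A" "t \<in> A" "s' \<in> A" "t' \<in> A" using c by auto
  ultimately have "f t \<le> f s' \<or> f t' \<le> f s" using mono_onD[OF f] less_imp_le by metis
  thus "(case i of (s, t) \<Rightarrow> {f s..<f t}) \<inter> (case j of (s, t) \<Rightarrow> {f s..<f t}) = {}"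
    unfolding st by auto
qed

lemma emeasure_disjoint_intervals:
  fixes g h :: "real \<times> real \<Rightarrow> real"
  assumes "countable C" "disjoint_family_on I C"
    and "\<And>i. i \<in> C \<Longrightarrow> I i \<in> sets lborel \<and> emeasure lborel (I i) = ennreal (h i)" 
  shows "emeasure lborel (\<Union>i\<in>C. I i) = (\<integral>\<^sup>+i. ennreal (h i) \<partial>count_space C)"
  using assms by (subst emeasure_UN_countable) (auto intro!: nn_integral_cong)

text \<open>The total increment over a family of intervals is recorded as the measure of a set. Families
  that refine each other are then compared by inclusion, without any rearrangement of sums.\<close>

lemma emeasure_mono_image_intervals:
  fixes f :: "real \<Rightarrow> real"
  assumes f: "mono_on A f" 
    and C: "countable C" "\<And>s t. (s, t) \<in> C \<Longrightarrow> s < t \<and> {s..t} \<subseteq> A" "disjoint_family_on (\<lambda>(s, t). {s..t}) C"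
  shows "(\<And>s t. (s, t) \<in> C \<Longrightarrow> f t - f s \<le> p * (t - s)) \<Longrightarrow> p \<ge> 0 \<Longrightarrow> 
          emeasure lborel (\<Union>(s, t)\<in>C. {f s..<f t}) \<le> ennreal p * emeasure lborel (\<Union>(s, t)\<in>C. {s..t})"
    and "(\<And>s t. (s, t) \<in> C \<Longrightarrow> f t - f s \<ge> p * (t - s)) \<Longrightarrow> p \<ge> 0 \<Longrightarrow> 
          ennreal p * emeasure lborel (\<Union>(s, t)\<in>C. {s..t}) \<le> emeasure lborel (\<Union>(s, t)\<in>C. {f s..<f t})"
proof -
  have le: "f s \<le> f t" if "(s, t) \<in> C" for s t
  proof -
    have "s \<in> A" "t \<in> A" "s \<le> t" using C(2)[OF that] by auto
    thus ?thesis by (rule mono_onD[OF f])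
  qed
  have 1: "emeasure lborel (\<Union>(s, t)\<in>C. {f s..<f t}) = (\<integral>\<^sup>+i. ennreal (f (snd i) - f (fst i)) \<partial>count_space C)"
    by (rule emeasure_disjoint_intervals[OF C(1) mono_image_intervals_disjoint[OF f C(2,3)]])
       (auto dest: le)
  have 2: "emeasure lborel (\<Union>(s, t)\<in>C. {s..t}) = (\<integral>\<^sup>+i. ennreal (snd i - fst i) \<partial>count_space C)"
    by (rule emeasure_disjoint_intervals[OF C(1) C(3)]) (auto dest: C(2))
  have 3: "ennreal p * emeasure lborel (\<Union>(s, t)\<in>C. {s..t}) = (\<integral>\<^sup>+i. ennreal (p * (snd i - fst i)) \<partial>count_space C)"
    if "p \<ge> 0" unfolding 2 using that by (subst nn_integral_cmult[symmetric]) (auto simp: ennreal_mult' intro!: nn_integral_cong)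
  show "emeasure lborel (\<Union>(s, t)\<in>C. {f s..<f t}) \<le> ennreal p * emeasure lborel (\<Union>(s, t)\<in>C. {s..t})"
    if "\<And>s t. (s, t) \<in> C \<Longrightarrow> f t - f s \<le> p * (t - s)" "p \<ge> 0"
    unfolding 1 3[OF that(2)] using that(1) by (auto intro!: nn_integral_mono ennreal_leI)
  show "ennreal p * emeasure lborel (\<Union>(s, t)\<in>C. {s..t}) \<le> emeasure lborel (\<Union>(s, t)\<in>C. {f s..<f t})"
    if "\<And>s t. (s, t) \<in> C \<Longrightarrow> f t - f s \<ge> p * (t - s)" "p \<ge> 0"
    unfolding 1 3[OF that(2)] using that(1) by (auto intro!: nn_integral_mono ennreal_leI)
qed

text \<open>Arbitrarily short intervals inside \<open>{a<..<b}\<close> that contain \<open>x\<close>, possibly as an endpoint, satisfy \<open>R\<close>.\<close>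

definition fine_at :: "real \<Rightarrow> real \<Rightarrow> real \<Rightarrow> (real \<Rightarrow> real \<Rightarrow> bool) \<Rightarrow> bool" where
  "fine_at a b x R \<longleftrightarrow> (\<forall>d>0. \<exists>s t. a < s \<and> s \<le> x \<and> x \<le> t \<and> t < b \<and> s < t \<and> t - s < d \<and> R s t)"

lemma ennreal_measure_le:
  fixes A B :: "real set"
  assumes "emeasure lborel A \<le> ennreal p * emeasure lborel B" "A \<in> sets borel" "B \<in> sets borel"
    "B \<subseteq> {a..b}" "p \<ge> 0"
  shows "measure lebesgue A \<le> p * measure lebesgue B"
proof -
  have "emeasure lborel B \<le> emeasure lborel {a..b}" using assms by (intro emeasure_mono) auto
  hence fin: "emeasure lborel B < \<infinity>" by (auto simp: emeasure_lborel_Icc_eq less_top[symmetric] top_unique split: if_splits)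
  have "measure lborel A = enn2real (emeasure lborel A)" by (simp add: measure_def)
  also have "\<dots> \<le> enn2real (ennreal p * emeasure lborel B)"
    using assms fin by (intro enn2real_mono) (auto simp: ennreal_mult_less_top)
  also have "\<dots> = p * measure lborel B" using assms by (simp add: enn2real_mult measure_def)
  finally show ?thesis using assms by simp
qed

lemma ennreal_measure_ge:
  fixes A B :: "real set"
  assumes "ennreal p * emeasure lborel B \<le> emeasure lborel A" "A \<in> sets borel" "B \<in> sets borel"
    "A \<subseteq> {a..b}" "p \<ge> 0"
  shows "p * measure lebesgue B \<le> measure lebesgue A"
proof -
  have "emeasure lborel A \<le> emeasure lborel {a..b}" using assms by (intro emeasure_mono) auto
  hence fin: "emeasure lborel A < \<infinity>" by (auto simp: emeasure_lborel_Icc_eq less_top[symmetric] top_unique split: if_splits)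
  have "p * measure lborel B = enn2real (ennreal p * emeasure lborel B)" 
    using assms by (simp add: enn2real_mult measure_def)
  also have "\<dots> \<le> enn2real (emeasure lborel A)"
    using assms fin by (intro enn2real_mono) (auto)
  finally show ?thesis using assms by (simp add: measure_def)
qed

lemma borel_UN_intervals:
  "countable C \<Longrightarrow> (\<Union>(s::real, t)\<in>C. {s..t}) \<in> sets borel"
  "countable C \<Longrightarrow> (\<Union>(s, t)\<in>C. {f s..<f t :: real}) \<in> sets borel"
  by (auto intro!: sets.countable_UN' simp: case_prod_beta)

lemma lmeasurable_Un_negligible:
  assumes "A \<in> lmeasurable" "negligible N"
  shows "A \<union> N \<in> lmeasurable" "measure lebesgue (A \<union> N) = measure lebesgue A"
proof -
  have N: "N \<in> null_sets lebesgue" using assms(2) by (simp add: negligible_iff_null_sets)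
  have "N \<in> lmeasurable" using assms(2) negligible_iff_measure by metis
  thus "A \<union> N \<in> lmeasurable" by (rule fmeasurable.Un[OF assms(1)])
  show "measure lebesgue (A \<union> N) = measure lebesgue A"
    by (rule measure_Un_null_set[OF fmeasurableD[OF assms(1)] N])
qed

text \<open>Disjoint intervals of slope above \<open>q\<close> have total length at most \<open>(f b - f a) / q\<close>.\<close>

lemma steep_points_negligible:
  fixes f :: "real \<Rightarrow> real"
  assumes f: "mono_on {a..b} f"
  shows "negligible {x \<in> {a<..<b}. \<forall>q. fine_at a b x (\<lambda>s t. f t - f s > q * (t - s))}" (is "negligible ?E")
proof (cases "a < b")
  case False thus ?thesis by auto
next
  case ab: True
  show ?thesis
  proof (rule negligible_outer_le[THEN iffD2], intro allI impI)
    fix e :: real assume e: "e > 0"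
    have fab: "f a \<le> f b" using ab by (intro mono_onD[OF f]) auto
    define q where "q = (f b - f a + 1) / e"
    have q: "q > 0" using e fab by (simp add: q_def)
    obtain C where C: "countable C" "\<And>s t. (s, t) \<in> C \<Longrightarrow> s < t \<and> {s..t} \<subseteq> {a<..<b} \<and> f t - f s > q * (t - s)"
      "disjoint_family_on (\<lambda>(s, t). {s..t}) C" "negligible (?E - (\<Union>(s, t)\<in>C. {s..t}))"
    proof (rule vitali_interval_cover[of "{a<..<b}" ?E "\<lambda>s t. f t - f s > q * (t - s)"])
      fix x d :: real assume "x \<in> ?E" "d > 0"
      thus "\<exists>s t. s \<le> x \<and> x \<le> t \<and> s < t \<and> t - s < d \<and> q * (t - s) < f t - f s"
        unfolding fine_at_def by blast
    next
      show "open {a<..<b}" by simp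
      show "?E \<subseteq> {a<..<b}" by blast
    qed (rule that, assumption, blast, assumption, assumption)
    let ?U = "\<Union>(s, t)\<in>C. {s..t}"
    let ?fU = "\<Union>(s, t)\<in>C. {f s..<f t}"
    have bor: "?U \<in> sets borel" "?fU \<in> sets borel"
      by (intro borel_UN_intervals C(1))+
    have Uab: "?U \<subseteq> {a..b}" using C(2) by force
    have st: "s < t \<and> {s..t} \<subseteq> {a..b}" if "(s, t) \<in> C" for s t
      using C(2)[OF that] greaterThanLessThan_subseteq_atLeastAtMost_iff[of a b a b] by fast
    have sub: "?fU \<subseteq> {f a..f b}"
    proof safe
      fix s t x assume "(s, t) \<in> C" "x \<in> {f s..<f t}"
      moreover have "f a \<le> f s" "f t \<le> f b" using st[OF \<open>(s, t) \<in> C\<close>] by (auto intro!: mono_onD[OF f])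
      ultimately show "x \<in> {f a..f b}" by auto
    qed
    have "q * measure lebesgue ?U \<le> measure lebesgue ?fU"
    proof (rule ennreal_measure_ge[OF emeasure_mono_image_intervals(2)[OF f C(1) st C(3)] _ _ sub])
      show "f t - f s \<ge> q * (t - s)" if "(s, t) \<in> C" for s t using C(2)[OF that] by auto
    qed (use q bor in simp_all)
    also have "\<dots> \<le> measure lebesgue {f a..f b}"
      using bor by (intro measure_mono_fmeasurable[OF sub]) simp_all
    also have "\<dots> = f b - f a" using fab by simp
    finally have "measure lebesgue ?U \<le> (f b - f a) / q" using q by (simp add: field_simps)
    also have "\<dots> \<le> e" using e fab by (simp add: q_def field_simps)
    finally have m: "measure lebesgue ?U \<le> e" .
    have U: "?U \<in> lmeasurable" 
      using bor(1) by (intro fmeasurableI2[OF _ Uab]) simp_all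
    show "\<exists>T. ?E \<subseteq> T \<and> T \<in> lmeasurable \<and> measure lebesgue T \<le> e"
    proof (intro exI conjI)
      show "?E \<subseteq> ?U \<union> (?E - ?U)" by blast
      show "?U \<union> (?E - ?U) \<in> lmeasurable" by (rule lmeasurable_Un_negligible(1)[OF U C(4)])
      show "measure lebesgue (?U \<union> (?E - ?U)) \<le> e" 
        using m unfolding lmeasurable_Un_negligible(2)[OF U C(4)] .
    qed
  qed
qed

lemma lmeasurable_outer_open:
  fixes S :: "real set"
  assumes S: "S \<in> lmeasurable" and e: "e > 0"
  obtains U where "open U" "S \<subseteq> U" "U \<in> lmeasurable" "measure lebesgue U < measure lebesgue S + e"
proof -
  obtain U where U: "open U" "S \<subseteq> U" "U - S \<in> lmeasurable" "emeasure lebesgue (U - S) < ennreal e"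
    using sets_lebesgue_outer_open[of S e] S e by (auto simp: fmeasurableD)
  have eq: "U = S \<union> (U - S)" using U by blast
  have "measure lebesgue (U - S) < e" using U e
    by (simp add: emeasure_eq_measure2 ennreal_less_iff)
  moreover have "measure lebesgue (S \<union> (U - S)) = measure lebesgue S + measure lebesgue (U - S)"
    using S U(3) by (intro measure_Un3 [THEN trans]) auto
  moreover have "S \<union> (U - S) \<in> lmeasurable" using S U(3) by (rule fmeasurable.Un)
  ultimately show ?thesis using that[OF U(1,2)] eq by simp
qed

text \<open>Let \<open>c\<close> be the outer measure of the set. Intervals of slope below \<open>p\<close> inside a tight open
  neighbourhood cover it, with total increment at most about \<open>p * c\<close>. Intervals of slope above \<open>q\<close>
  inside the former cover it again, with total increment at least \<open>q * c\<close>. Hence \<open>q * c \<le> p * c\<close>.\<close>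

lemma oscillating_slopes_negligible:
  fixes f :: "real \<Rightarrow> real"
  assumes f: "mono_on {a..b} f" and pq: "0 < p" "p < q"
  shows "negligible {x \<in> {a<..<b}. fine_at a b x (\<lambda>s t. f t - f s < p * (t - s))
                                 \<and> fine_at a b x (\<lambda>s t. f t - f s > q * (t - s))}" (is "negligible ?E")
proof -
  define M where "M = {measure lebesgue T | T. T \<in> lmeasurable \<and> ?E \<subseteq> T}"
  define c where "c = Inf M"
  have "measure lebesgue {a<..<b} \<in> M" unfolding M_def by blast
  hence M0: "M \<noteq> {}" by blast
  have bdd: "bdd_below M" by (rule bdd_belowI[of _ 0]) (auto simp: M_def)
  have c0: "c \<ge> 0" unfolding c_def using M0 by (intro cInf_greatest) (auto simp: M_def)
  have key: "q * c \<le> p * (c + e)" if e: "e > 0" for e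
  proof -
    have "Inf M < c + e / 2" using e by (simp add: c_def)
    then obtain T where T: "T \<in> lmeasurable" "?E \<subseteq> T" "measure lebesgue T < c + e / 2"
      using cInf_less_iff[OF M0 bdd] by (auto simp: M_def)
    obtain U where U: "open U" "T \<subseteq> U" "U \<in> lmeasurable" "measure lebesgue U < measure lebesgue T + e / 2"
      using lmeasurable_outer_open[OF T(1), of "e / 2"] e by auto
    obtain C where C: "countable C" "\<And>s t. (s, t) \<in> C \<Longrightarrow> s < t \<and> {s..t} \<subseteq> U \<inter> {a<..<b} \<and> f t - f s < p * (t - s)"
      "disjoint_family_on (\<lambda>(s, t). {s..t}) C" "negligible (?E - (\<Union>(s, t)\<in>C. {s..t}))"
    proof (rule vitali_interval_cover[of "U \<inter> {a<..<b}" ?E "\<lambda>s t. f t - f s < p * (t - s)"])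
      show "?E \<subseteq> U \<inter> {a<..<b}" using T U by blast
    next
      fix x d :: real assume "x \<in> ?E" "d > 0"
      thus "\<exists>s t. s \<le> x \<and> x \<le> t \<and> s < t \<and> t - s < d \<and> p * (t - s) > f t - f s"
        unfolding fine_at_def by blast
    next
      show "open (U \<inter> {a<..<b})" using U by auto
    qed (rule that, assumption, blast, assumption, assumption)
    define V where "V = (\<Union>(s, t)\<in>C. {s<..<t})"
    have "open V" unfolding V_def by auto
    obtain D where D: "countable D" "\<And>s t. (s, t) \<in> D \<Longrightarrow> s < t \<and> {s..t} \<subseteq> V \<and> f t - f s > q * (t - s)"
      "disjoint_family_on (\<lambda>(s, t). {s..t}) D" "negligible (?E \<inter> V - (\<Union>(s, t)\<in>D. {s..t}))"
    proof (rule vitali_interval_cover[of V "?E \<inter> V" "\<lambda>s t. f t - f s > q * (t - s)"])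
      fix x d :: real assume "x \<in> ?E \<inter> V" "d > 0"
      thus "\<exists>s t. s \<le> x \<and> x \<le> t \<and> s < t \<and> t - s < d \<and> q * (t - s) < f t - f s"
        unfolding fine_at_def by blast
    next
      show "open V" by fact
      show "?E \<inter> V \<subseteq> V" by blast
    qed (rule that, assumption, blast, assumption, assumption)
    let ?C = "\<Union>(s, t)\<in>C. {s..t}" and ?D = "\<Union>(s, t)\<in>D. {s..t}"
    let ?fC = "\<Union>(s, t)\<in>C. {f s..<f t}" and ?fD = "\<Union>(s, t)\<in>D. {f s..<f t}"
    have VC: "V \<subseteq> ?C" unfolding V_def by (intro UN_mono) auto
    have CU: "?C \<subseteq> U \<inter> {a<..<b}" using C(2) by blast
    have Cab: "?C \<subseteq> {a..b}" by (rule order_trans[OF CU]) auto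
    have stC: "s < t \<and> {s..t} \<subseteq> {a..b}" if "(s, t) \<in> C" for s t
      using C(2)[OF that] greaterThanLessThan_subseteq_atLeastAtMost_iff[of a b a b] by fast
    have stD: "s < t \<and> {s..t} \<subseteq> {a..b}" if "(s, t) \<in> D" for s t
    proof -
      have "{s..t} \<subseteq> V" using D(2)[OF that] by simp
      also have "V \<subseteq> {a..b}" using VC CU by force
      finally show ?thesis using D(2)[OF that] by simp
    qed
    have subC: "?fC \<subseteq> {f a..f b}"
    proof safe
      fix s t x assume "(s, t) \<in> C" "x \<in> {f s..<f t}"
      moreover have "f a \<le> f s" "f t \<le> f b" using stC[OF \<open>(s, t) \<in> C\<close>] by (auto intro!: mono_onD[OF f])
      ultimately show "x \<in> {f a..f b}" by auto
    qed
    have fDC: "?fD \<subseteq> ?fC"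
    proof safe
      fix s t x assume st: "(s, t) \<in> D" "x \<in> {f s..<f t}"
      \<comment> \<open>the connected set \<open>{s..t}\<close> lies in a single component of \<open>V\<close>\<close>
      have "s \<in> V" using D(2)[OF st(1)] by auto
      then obtain s' t' where c: "(s', t') \<in> C" "s' < s" "s < t'" unfolding V_def by auto
      have "t < t'"
      proof (rule ccontr)
        assume "\<not> t < t'"
        hence "t' \<in> {s..t}" using c by auto
        hence "t' \<in> V" using D(2)[OF st(1)] by auto
        then obtain s'' t'' where d: "(s'', t'') \<in> C" "s'' < t'" "t' < t''" unfolding V_def by auto
        have "(s'', t'') \<noteq> (s', t')" using d by auto
        hence "{s'..t'} \<inter> {s''..t''} = {}"
          using C(3) c(1) d(1) unfolding disjoint_family_on_def by (metis (no_types, lifting) case_prod_conv)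
        moreover have "t' \<in> {s'..t'} \<inter> {s''..t''}" using c d by auto
        ultimately show False by blast
      qed
      hence "f s' \<le> f s" "f t \<le> f t'"
        using c stC[OF c(1)] stD[OF st(1)] by (auto intro!: mono_onD[OF f])
      thus "x \<in> ?fC" using c(1) st(2) by (force intro!: bexI[of _ "(s', t')"])
    qed
    have bor: "?C \<in> sets borel" "?fC \<in> sets borel" "?D \<in> sets borel" "?fD \<in> sets borel"
      by (intro borel_UN_intervals C(1) D(1))+
    have Dab: "?D \<subseteq> {a..b}" using stD by blast
    have Dm: "?D \<in> lmeasurable"
      using bor(3) by (intro fmeasurableI2[OF _ Dab]) simp_all
    \<comment> \<open>What both covers miss, together with the endpoints of the first cover.\<close>
    define N where "N = (?E - ?C) \<union> (?C - V) \<union> (?E \<inter> V - ?D)"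
    have "?C - V \<subseteq> fst ` C \<union> snd ` C"
    proof
      fix x assume "x \<in> ?C - V"
      then obtain s t where st: "(s, t) \<in> C" "x \<in> {s..t}" "x \<notin> {s<..<t}" unfolding V_def by auto
      hence "x = fst (s, t) \<or> x = snd (s, t)" by auto
      thus "x \<in> fst ` C \<union> snd ` C" using st(1) by blast
    qed
    moreover have "countable (fst ` C \<union> snd ` C)" using C(1) by simp
    ultimately have "countable (?C - V)" by (rule countable_subset)
    hence "negligible (?C - V)"
      unfolding negligible_iff_null_sets by (intro null_sets_completionI countable_imp_null_set_lborel)
    hence "negligible N" unfolding N_def by (intro negligible_Un C(4) D(4))
    have "?D \<union> N \<in> lmeasurable" by (rule lmeasurable_Un_negligible(1)[OF Dm \<open>negligible N\<close>])
    moreover have "?E \<subseteq> ?D \<union> N" unfolding N_def by blast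
    ultimately have "measure lebesgue (?D \<union> N) \<in> M" unfolding M_def by blast
    hence "c \<le> measure lebesgue (?D \<union> N)" unfolding c_def by (intro cInf_lower bdd)
    also have "\<dots> = measure lebesgue ?D" 
      by (rule lmeasurable_Un_negligible(2)[OF Dm \<open>negligible N\<close>])
    finally have "q * c \<le> q * measure lebesgue ?D" using pq by simp
    also have "\<dots> \<le> measure lebesgue ?fD"
    proof (rule ennreal_measure_ge[OF emeasure_mono_image_intervals(2)[OF f D(1) stD D(3)]])
      show "f t - f s \<ge> q * (t - s)" if "(s, t) \<in> D" for s t using D(2)[OF that] by auto
      show "?fD \<subseteq> {f a..f b}" by (rule order_trans[OF fDC subC])
    qed (use pq bor in simp_all)
    also have "\<dots> \<le> measure lebesgue ?fC"
      using bor by (intro measure_mono_fmeasurable[OF fDC] fmeasurableI2[OF _ subC]) simp_all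
    also have "\<dots> \<le> p * measure lebesgue ?C"
    proof (rule ennreal_measure_le[OF emeasure_mono_image_intervals(1)[OF f C(1) stC C(3)]])
      show "f t - f s \<le> p * (t - s)" if "(s, t) \<in> C" for s t using C(2)[OF that] by auto
      show "?C \<subseteq> {a..b}" by (rule Cab)
    qed (use pq bor in simp_all)
    also have "measure lebesgue ?C \<le> measure lebesgue U"
      using bor U(3) CU by (intro measure_mono_fmeasurable) simp_all
    also have "\<dots> \<le> c + e" using U T by simp
    finally show ?thesis using pq by simp
  qed
  have "c = 0"
  proof (rule ccontr)
    assume "c \<noteq> 0"
    hence c: "c > 0" using c0 by simp
    have "(q - p) * c > 0" using pq c by simp
    define e where "e = (q - p) * c / (2 * p)"
    have e: "e > 0" using pq c by (simp add: e_def)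
    have "p * e = (q - p) * c / 2" using pq by (simp add: e_def)
    with key[OF e] \<open>(q - p) * c > 0\<close> show False by (simp add: algebra_simps)
  qed
  show ?thesis
  proof (rule negligible_outer_le[THEN iffD2], intro allI impI)
    fix e :: real assume "e > 0"
    hence "Inf M < e" using \<open>c = 0\<close> by (simp add: c_def)
    thus "\<exists>T. ?E \<subseteq> T \<and> T \<in> lmeasurable \<and> measure lebesgue T \<le> e"
      using cInf_less_iff[OF M0 bdd] unfolding M_def by (smt (verit, best) mem_Collect_eq)
  qed
qed

text \<open>Lebesgue's theorem. Off the two exceptional kinds of points, the slopes over small intervals around \<open>x\<close>
  are eventually below every number above \<open>D\<close> and above every number below \<open>D\<close>, where \<open>D\<close> is the infimum of
  the eventual upper bounds.\<close>

lemma mono_on_differentiable_ae: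
  fixes f :: "real \<Rightarrow> real"
  assumes f: "mono_on {a..b} f"
  shows "negligible {x \<in> {a<..<b}. \<not> (\<exists>D. (f has_real_derivative D) (at x))}" (is "negligible ?N")
proof -
  define E where "E = (\<lambda>p q. {x \<in> {a<..<b}. fine_at a b x (\<lambda>s t. f t - f s < p * (t - s))
                                 \<and> fine_at a b x (\<lambda>s t. f t - f s > q * (t - s))})"
  define E0 where "E0 = {x \<in> {a<..<b}. \<forall>q. fine_at a b x (\<lambda>s t. f t - f s > q * (t - s))}"
  define PQ where "PQ = {(p, q). p \<in> \<rat> \<and> q \<in> \<rat> \<and> 0 < p \<and> p < (q::real)}"
  have "PQ \<subseteq> \<rat> \<times> \<rat>" by (auto simp: PQ_def)
  hence "countable PQ" by (meson countable_SIGMA countable_rat countable_subset)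
  have "?N \<subseteq> E0 \<union> (\<Union>(p, q)\<in>PQ. E p q)"
  proof safe
    fix x assume x: "x \<in> {a<..<b}" and nd: "\<nexists>D. (f has_real_derivative D) (at x)"
      and nE: "x \<notin> (\<Union>(p, q)\<in>PQ. E p q)"
    show "x \<in> E0"
    proof (rule ccontr)
      assume "x \<notin> E0"
      define J where "J = (\<lambda>d s t. a < s \<and> s \<le> x \<and> x \<le> t \<and> t < b \<and> s < t \<and> t - s < (d::real))"
      have fJ: "fine_at a b x R \<longleftrightarrow> (\<forall>d>0. \<exists>s t. J d s t \<and> R s t)" for R
        unfolding fine_at_def J_def by blast
      define A where "A = {q. \<exists>d>0. \<forall>s t. J d s t \<longrightarrow> f t - f s \<le> q * (t - s)}"
      have A0: "A \<noteq> {}"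
      proof -
        obtain q where "\<not> fine_at a b x (\<lambda>s t. f t - f s > q * (t - s))"
          using \<open>x \<notin> E0\<close> x unfolding E0_def by blast
        hence "q \<in> A" unfolding fJ A_def by (auto simp: not_less)
        thus ?thesis by blast
      qed
      have pos: "f s \<le> f t" if "J d s t" for d s t
        using that by (intro mono_onD[OF f]) (auto simp: J_def)
      have A_ge: "q \<ge> 0" if "q \<in> A" for q
      proof -
        obtain d where d: "d > 0" "\<forall>s t. J d s t \<longrightarrow> f t - f s \<le> q * (t - s)" using \<open>q \<in> A\<close> by (auto simp: A_def)
        define t where "t = x + min (d / 2) ((b - x) / 2)"
        have "x < t" "t < b" "t - x < d" using d x by (auto simp: t_def min_def field_simps)
        hence J: "J d x t" using x by (auto simp: J_def)
        hence "0 \<le> q * (t - x)" using d(2) pos[OF J] by force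
        thus ?thesis using \<open>x < t\<close> by (simp add: zero_le_mult_iff)
      qed
      hence bdd: "bdd_below A" by (rule bdd_belowI)
      define D where "D = Inf A"
      have upper: "\<exists>d>0. \<forall>s t. J d s t \<longrightarrow> f t - f s \<le> (D + e) * (t - s)" if "e > 0" for e
      proof -
        have "Inf A < D + e" using that by (simp add: D_def)
        then obtain q where q: "q \<in> A" "q < D + e" using cInf_less_iff[OF A0 bdd] by auto
        then obtain d where d: "d > 0" "\<forall>s t. J d s t \<longrightarrow> f t - f s \<le> q * (t - s)" by (auto simp: A_def)
        moreover have "q * (t - s) \<le> (D + e) * (t - s)" if "J d s t" for s t
          using q that by (intro mult_right_mono) (auto simp: J_def)
        ultimately show ?thesis by (meson order_trans)
      qed
      have lower: "\<exists>d>0. \<forall>s t. J d s t \<longrightarrow> f t - f s \<ge> (D - e) * (t - s)" if e: "e > 0" for e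
      proof (rule ccontr)
        assume "\<not> ?thesis"
        hence n: "\<forall>d>0. \<exists>s t. J d s t \<and> f t - f s < (D - e) * (t - s)" by (auto simp: not_le)
        then obtain s t where "J 1 s t" "f t - f s < (D - e) * (t - s)" by (meson zero_less_one)
        hence "0 < (D - e) * (t - s)" "t - s > 0" using pos[of 1 s t] by (auto simp: J_def)
        hence De: "0 < D - e" by (simp add: zero_less_mult_iff)
        obtain p where p: "p \<in> \<rat>" "D - e < p" "p < D" using Rats_dense_in_real[of "D - e" D] e by auto
        obtain q where q: "q \<in> \<rat>" "p < q" "q < D" using Rats_dense_in_real[of p D] p by auto
        have "(p, q) \<in> PQ" using p q De by (auto simp: PQ_def)
        moreover have "fine_at a b x (\<lambda>s t. f t - f s < p * (t - s))" unfolding fJ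
        proof (intro allI impI)
          fix d :: real assume "d > 0"
          with n obtain s t where st: "J d s t" "f t - f s < (D - e) * (t - s)" by blast
          moreover have "(D - e) * (t - s) \<le> p * (t - s)"
            using p st by (intro mult_right_mono) (auto simp: J_def)
          ultimately show "\<exists>s t. J d s t \<and> f t - f s < p * (t - s)" by force
        qed
        moreover have "q \<notin> A" using q cInf_lower[OF _ bdd, of q] by (auto simp: D_def)
        hence "fine_at a b x (\<lambda>s t. f t - f s > q * (t - s))"
          unfolding fJ A_def by (auto simp: not_le)
        ultimately have "x \<in> E p q" using x by (auto simp: E_def)
        with nE \<open>(p, q) \<in> PQ\<close> show False by auto
      qed
      have "((\<lambda>y. (f y - f x) / (y - x)) \<longlongrightarrow> D) (at x)"
      proof (rule LIM_I)
        fix e :: real assume e: "e > 0"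
        obtain d1 where d1: "d1 > 0" "\<forall>s t. J d1 s t \<longrightarrow> f t - f s \<le> (D + e/2) * (t - s)" using upper[of "e/2"] e by auto
        obtain d2 where d2: "d2 > 0" "\<forall>s t. J d2 s t \<longrightarrow> f t - f s \<ge> (D - e/2) * (t - s)" using lower[of "e/2"] e by auto
        define d where "d = min (min d1 d2) (min (x - a) (b - x))"
        have "norm ((f y - f x) / (y - x) - D) < e" if y: "y \<noteq> x" "norm (y - x) < d" for y
        proof -
          define s t where "s = min x y" and "t = max x y"
          have J: "J d1 s t" "J d2 s t" using y x by (auto simp: J_def s_def t_def d_def abs_if split: if_splits)
          have st: "t - s > 0" using J by (auto simp: J_def)
          have eq: "(f y - f x) / (y - x) = (f t - f s) / (t - s)"
          proof (cases "x \<le> y")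
            case False
            have "(f y - f x) / (y - x) = (- (f y - f x)) / (- (y - x))" by (rule minus_divide_divide[symmetric])
            thus ?thesis using False by (simp add: s_def t_def)
          qed (simp add: s_def t_def)
          have "(f t - f s) / (t - s) \<le> D + e/2" "(f t - f s) / (t - s) \<ge> D - e/2"
            using d1(2) J(1) d2(2) J(2) st by (simp_all add: pos_divide_le_eq pos_le_divide_eq)
          thus ?thesis unfolding eq real_norm_def abs_less_iff using e by linarith
        qed
        moreover have "d > 0" using d1 d2 x by (auto simp: d_def)
        ultimately show "\<exists>d>0. \<forall>y. y \<noteq> x \<and> norm (y - x) < d \<longrightarrow> norm ((f y - f x) / (y - x) - D) < e"
          by blast
      qed
      hence "(f has_real_derivative D) (at x)" by (simp add: has_field_derivative_iff)
      with nd show False by blast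
    qed
  qed
  moreover have "negligible (E0 \<union> (\<Union>(p, q)\<in>PQ. E p q))"
  proof (rule negligible_Un)
    show "negligible E0" unfolding E0_def by (rule steep_points_negligible[OF f])
    show "negligible (\<Union>(p, q)\<in>PQ. E p q)"
    proof (rule negligible_countable_Union)
      show "countable ((\<lambda>(p, q). E p q) ` PQ)" using \<open>countable PQ\<close> by blast
      fix T assume "T \<in> (\<lambda>(p, q). E p q) ` PQ"
      thus "negligible T" unfolding E_def PQ_def using oscillating_slopes_negligible[OF f] by auto
    qed
  qed
  ultimately show ?thesis by (rule negligible_subset[rotated])
qed

section \<open>Absolutely continuous functions\<close>

lemma sum_disjoint_intervals_le:
  fixes J :: "(real \<times> real) set"
  assumes "finite J" "\<And>s t. (s, t) \<in> J \<Longrightarrow> s < t \<and> {s<..<t} \<subseteq> S" "disjoint_family_on (\<lambda>(s, t). {s<..<t}) J"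
    and "S \<in> lmeasurable"
  shows "(\<Sum>(s, t)\<in>J. t - s) \<le> measure lebesgue S"
proof -
  have len: "measure lebesgue {s<..<t} = t - s" if "(s, t) \<in> J" for s t
    using assms(2)[OF that] by simp
  have "(\<Sum>(s, t)\<in>J. t - s) = (\<Sum>i\<in>J. measure lebesgue ((\<lambda>(s, t). {s<..<t}) i))"
    by (rule sum.cong) (use len in auto)
  also have "\<dots> = measure lebesgue (\<Union>i\<in>J. (\<lambda>(s, t). {s<..<t}) i)"
  proof (rule measure_finite_Union[symmetric, OF assms(1) _ assms(3)])
    show "emeasure lebesgue ((\<lambda>(s, t). {s<..<t}) i) \<noteq> \<infinity>" if "i \<in> J" for i
      using assms(2)[of "fst i" "snd i"] that by (cases i) auto
  qed auto
  also have "\<dots> \<le> measure lebesgue S"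
    using assms(1,2,4) by (intro measure_mono_fmeasurable) (auto intro!: sets.finite_UN)
  finally show ?thesis .
qed

lemma abs_continuous_imp_continuous_on:
  assumes u: "abs_continuous_on_interval a b u"
  shows "continuous_on {a..b} u"
  unfolding continuous_on_iff
proof (intro ballI allI impI)
  fix x e :: real assume x: "x \<in> {a..b}" and e: "e > 0"
  obtain d where d: "d > 0" and I: "\<And>I. finite I \<Longrightarrow> \<forall>(x, y)\<in>I. a \<le> x \<and> x < y \<and> y \<le> b \<Longrightarrow>
     disjoint_family_on (\<lambda>(x, y). {x<..<y}) I \<Longrightarrow> (\<Sum>(x, y)\<in>I. y - x) < d \<Longrightarrow> (\<Sum>(x, y)\<in>I. \<bar>u y - u x\<bar>) < e"
    using u e unfolding abs_continuous_on_interval_def by meson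
  have "dist (u y) (u x) < e" if y: "y \<in> {a..b}" "dist y x < d" for y
  proof (cases "y = x")
    case False
    let ?I = "{(min x y, max x y)}"
    have "(\<Sum>(x, y)\<in>?I. \<bar>u y - u x\<bar>) < e"
    proof (rule I)
      show "disjoint_family_on (\<lambda>(x, y). {x<..<y}) ?I" by (simp add: disjoint_family_on_def)
    qed (use x y False in \<open>auto simp: dist_real_def min_def max_def\<close>)
    thus ?thesis by (auto simp: dist_real_def min_def max_def split: if_splits)
  qed (use e in simp)
  thus "\<exists>d>0. \<forall>y\<in>{a..b}. dist y x < d \<longrightarrow> dist (u y) (u x) < e" using d by blast
qed

text \<open>Jordan's decomposition: the upward variation \<open>P\<close> and \<open>P - u\<close> are both monotone.\<close>

lemma differentiable_ae_of_bounded_upward_variation: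
  fixes u :: "real \<Rightarrow> real"
  assumes B: "\<And>J. finite J \<Longrightarrow> \<forall>(s, t)\<in>J. c \<le> s \<and> s < t \<and> t \<le> d \<Longrightarrow>
     disjoint_family_on (\<lambda>(s, t). {s<..<t}) J \<Longrightarrow> (\<Sum>(s, t)\<in>J. u t - u s) \<le> B"
  shows "negligible {x \<in> {c<..<d}. \<not> (\<exists>D. (u has_real_derivative D) (at x))}"
proof -
  define F where "F = (\<lambda>x. {J. finite J \<and> (\<forall>(s, t)\<in>J. c \<le> s \<and> s < t \<and> t \<le> x) \<and>
     disjoint_family_on (\<lambda>(s, t). {s<..<t}) J})"
  define V where "V = (\<lambda>J. \<Sum>(s, t)\<in>J. u t - u s)"
  define P where "P = (\<lambda>x. Sup (V ` F x))"
  have P_eq: "P x = Sup (V ` F x)" for x by (simp add: P_def)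
  have F0: "F x \<noteq> {}" for x
  proof -
    have "{} \<in> F x" by (simp add: F_def disjoint_family_on_def)
    thus ?thesis by blast
  qed
  have VB: "V J \<le> B" if "J \<in> F x" "x \<le> d" for J x
  proof -
    have J: "finite J" "disjoint_family_on (\<lambda>(s, t). {s<..<t}) J" "\<forall>(s, t)\<in>J. c \<le> s \<and> s < t \<and> t \<le> x"
      using that unfolding F_def by blast+
    hence "\<forall>(s, t)\<in>J. c \<le> s \<and> s < t \<and> t \<le> d" using that(2) by force
    thus ?thesis unfolding V_def by (rule B[OF J(1) _ J(2)])
  qed
  have bdd: "bdd_above (V ` F x)" if "x \<le> d" for x using VB that by (intro bdd_aboveI[where M = B]) auto
  have step: "P x + (u y - u x) \<le> P y" "P x \<le> P y" if xy: "c \<le> x" "x < y" "y \<le> d" for x y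
  proof -
    have FF: "J \<in> F y" if "J \<in> F x" for J using that xy by (fastforce simp: F_def)
    have "V J \<le> P y" if J: "J \<in> F x" for J
      unfolding P_eq using FF[OF J] bdd[OF xy(3)] by (intro cSup_upper) auto
    thus "P x \<le> P y" unfolding P_eq[of x] using F0 by (intro cSup_least) auto
    have "V J + (u y - u x) \<le> P y" if J: "J \<in> F x" for J
    proof -
      have J': "finite J" "disjoint_family_on (\<lambda>(s, t). {s<..<t}) J" "\<And>s t. (s, t) \<in> J \<Longrightarrow> c \<le> s \<and> s < t \<and> t \<le> x"
        using J unfolding F_def by blast+
      have new: "(x, y) \<notin> J" using J'(3)[of x y] xy by auto
      have "{s<..<t} \<inter> {x<..<y} = {}" if "(s, t) \<in> J" for s t using J'(3)[OF that] by auto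
      hence "disjoint_family_on (\<lambda>(s, t). {s<..<t}) (insert (x, y) J)"
        using J'(2) new by (subst disjoint_family_on_insert) (simp, force)
      hence "insert (x, y) J \<in> F y" using J'(1) FF[OF J] xy by (auto simp: F_def)
      hence "V (insert (x, y) J) \<le> P y" unfolding P_eq using bdd[OF xy(3)] by (intro cSup_upper) auto
      thus ?thesis using new J'(1) by (simp add: V_def)
    qed
    hence "v \<le> P y - (u y - u x)" if "v \<in> V ` F x" for v using that by (auto simp: algebra_simps)
    hence "P x \<le> P y - (u y - u x)" unfolding P_eq[of x] using F0 by (intro cSup_least) auto
    thus "P x + (u y - u x) \<le> P y" by simp
  qed
  have step': "P x \<le> P y" "P x - u x \<le> P y - u y" if "x \<in> {c..d}" "y \<in> {c..d}" "x \<le> y" for x y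
    using step[of x y] that by (cases "x = y"; simp)+
  have P: "mono_on {c..d} P" and Q: "mono_on {c..d} (\<lambda>x. P x - u x)"
    using step' by (auto intro!: mono_onI)
  have "{x \<in> {c<..<d}. \<not> (\<exists>D. (u has_real_derivative D) (at x))} \<subseteq>
      {x \<in> {c<..<d}. \<not> (\<exists>D. (P has_real_derivative D) (at x))} \<union>
      {x \<in> {c<..<d}. \<not> (\<exists>D. ((\<lambda>x. P x - u x) has_real_derivative D) (at x))}"
  proof -
    have "(u has_real_derivative D - E) (at x)"
      if "(P has_real_derivative D) (at x)" "((\<lambda>x. P x - u x) has_real_derivative E) (at x)" for x D E
      using DERIV_diff[OF that] by simp
    thus ?thesis by blast
  qed
  thus ?thesis
    using mono_on_differentiable_ae[OF P] mono_on_differentiable_ae[OF Q]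
    by (meson negligible_Un negligible_subset)
qed

text \<open>Differentiability is local, so intervals shorter than the \<open>\<delta>\<close> that belongs to \<open>\<epsilon> = 1\<close> suffice; on
  them the upward variation is at most \<open>1\<close>.\<close>

lemma abs_continuous_differentiable_ae:
  assumes u: "abs_continuous_on_interval a b u"
  shows "negligible {x \<in> {a<..<b}. \<not> (\<exists>D. (u has_real_derivative D) (at x))}" (is "negligible ?N")
proof -
  obtain \<delta> where \<delta>: "\<delta> > 0" and I: "\<And>I. finite I \<Longrightarrow> \<forall>(x, y)\<in>I. a \<le> x \<and> x < y \<and> y \<le> b \<Longrightarrow>
     disjoint_family_on (\<lambda>(x, y). {x<..<y}) I \<Longrightarrow> (\<Sum>(x, y)\<in>I. y - x) < \<delta> \<Longrightarrow> (\<Sum>(x, y)\<in>I. \<bar>u y - u x\<bar>) < 1"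
    using u zero_less_one unfolding abs_continuous_on_interval_def by meson
  define R where "R = {(c, d). c \<in> \<rat> \<and> d \<in> \<rat> \<and> a \<le> c \<and> c < d \<and> d \<le> b \<and> d - c < \<delta>}"
  define G where "G = (\<lambda>(c, d). {x \<in> {c<..<d}. \<not> (\<exists>D. (u has_real_derivative D) (at x))})"
  have "R \<subseteq> \<rat> \<times> \<rat>" by (auto simp: R_def)
  hence "countable R" by (meson countable_SIGMA countable_rat countable_subset)
  have "negligible (G i)" if "i \<in> R" for i
  proof -
    obtain c d where i: "i = (c, d)" by (cases i)
    hence cd: "a \<le> c" "c < d" "d \<le> b" "d - c < \<delta>" using that by (auto simp: R_def)
    show ?thesis unfolding G_def i prod.case
    proof (rule differentiable_ae_of_bounded_upward_variation)
      fix J assume J: "finite J" "\<forall>(s, t)\<in>J. c \<le> s \<and> s < t \<and> t \<le> d" "disjoint_family_on (\<lambda>(s, t). {s<..<t}) J"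
      have st: "c \<le> s \<and> s < t \<and> t \<le> d" if "(s, t) \<in> J" for s t using J(2) that by blast
      have "(\<Sum>(s, t)\<in>J. t - s) \<le> measure lebesgue {c..d}"
      proof (rule sum_disjoint_intervals_le[OF J(1) _ J(3)])
        show "s < t \<and> {s<..<t} \<subseteq> {c..d}" if "(s, t) \<in> J" for s t using st[OF that] by auto
      qed simp
      also have "\<dots> < \<delta>" using cd by simp
      finally have "(\<Sum>(s, t)\<in>J. t - s) < \<delta>" .
      moreover have "\<forall>(x, y)\<in>J. a \<le> x \<and> x < y \<and> y \<le> b" using st cd by fastforce
      ultimately have "(\<Sum>(x, y)\<in>J. \<bar>u y - u x\<bar>) < 1" by (intro I J)
      moreover have "(\<Sum>(s, t)\<in>J. u t - u s) \<le> (\<Sum>(x, y)\<in>J. \<bar>u y - u x\<bar>)"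
        by (intro sum_mono) auto
      ultimately show "(\<Sum>(s, t)\<in>J. u t - u s) \<le> 1" by simp
    qed
  qed
  hence "negligible (\<Union>(G ` R))" using \<open>countable R\<close> by (intro negligible_countable_Union) auto
  moreover have "?N \<subseteq> \<Union>(G ` R)"
  proof
    fix x assume x: "x \<in> ?N"
    obtain c where c: "c \<in> \<rat>" "max a (x - \<delta>/2) < c" "c < x"
      using Rats_dense_in_real[of "max a (x - \<delta>/2)" x] x \<delta> by auto
    obtain d where d: "d \<in> \<rat>" "x < d" "d < min b (x + \<delta>/2)"
      using Rats_dense_in_real[of x "min b (x + \<delta>/2)"] x \<delta> by auto
    have "(c, d) \<in> R" using c d by (auto simp: R_def)
    moreover have "x \<in> G (c, d)" using x c d by (auto simp: G_def)
    ultimately show "x \<in> \<Union>(G ` R)" by blast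
  qed
  ultimately show ?thesis by (rule negligible_subset)
qed

text \<open>Lusin's condition. The image of each interval of a fine cover is spanned by its values at a
  minimum and at a maximum point, and absolute continuity applies to the intervals between these points.\<close>

lemma abs_continuous_negligible_image:
  assumes u: "abs_continuous_on_interval a b u" and N: "negligible N" "N \<subseteq> {a..b}"
  shows "negligible (u ` N)"
proof (rule negligible_outer_le[THEN iffD2], intro allI impI)
  fix e :: real assume e: "e > 0"
  obtain \<delta> where \<delta>: "\<delta> > 0" and I: "\<And>I. finite I \<Longrightarrow> \<forall>(x, y)\<in>I. a \<le> x \<and> x < y \<and> y \<le> b \<Longrightarrow>
     disjoint_family_on (\<lambda>(x, y). {x<..<y}) I \<Longrightarrow> (\<Sum>(x, y)\<in>I. y - x) < \<delta> \<Longrightarrow> (\<Sum>(x, y)\<in>I. \<bar>u y - u x\<bar>) < e"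
    using u e unfolding abs_continuous_on_interval_def by meson
  have Nm: "N \<in> lmeasurable" "measure lebesgue N = 0" using N(1) negligible_iff_measure by metis+
  have "N \<subseteq> cbox a b" "\<delta> / 2 > 0" using N(2) \<delta> by auto
  obtain \<D> where cD: "countable \<D>"
    and K: "\<And>K. K \<in> \<D> \<Longrightarrow> K \<subseteq> cbox a b \<and> K \<noteq> {} \<and> (\<exists>c d. K = cbox c d)"
    and disj: "pairwise (\<lambda>A B. interior A \<inter> interior B = {}) \<D>"
    and ND: "N \<subseteq> \<Union>\<D>" and mD: "\<Union>\<D> \<in> lmeasurable" "measure lebesgue (\<Union>\<D>) \<le> measure lebesgue N + \<delta> / 2"
    by (rule measurable_outer_intervals_bounded[OF Nm(1) \<open>N \<subseteq> cbox a b\<close> \<open>\<delta> / 2 > 0\<close>]) metis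
  have cont: "continuous_on {a..b} u" by (rule abs_continuous_imp_continuous_on[OF u])
  have "\<exists>m M. m \<in> K \<and> M \<in> K \<and> u ` K \<subseteq> {u m..u M}" if "K \<in> \<D>" for K
  proof -
    have c: "compact K" "K \<noteq> {}" "continuous_on K u"
      using K[OF that] cont by (auto intro: continuous_on_subset)
    obtain M where "M \<in> K" "\<forall>y\<in>K. u y \<le> u M" using continuous_attains_sup[OF c] by blast
    moreover obtain m where "m \<in> K" "\<forall>y\<in>K. u m \<le> u y" using continuous_attains_inf[OF c] by blast
    ultimately show ?thesis by (intro exI[of _ m] exI[of _ M]) auto
  qed
  then obtain m M where mM: "\<And>K. K \<in> \<D> \<Longrightarrow> m K \<in> K \<and> M K \<in> K \<and> u ` K \<subseteq> {u (m K)..u (M K)}" by metis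
  define A where "A = (\<lambda>K. {u (m K)..u (M K)})"
  have fin: "measure lebesgue (\<Union>K\<in>F. A K) \<le> e" if F: "F \<subseteq> \<D>" "finite F" for F
  proof -
    define h where "h = (\<lambda>K. (min (m K) (M K), max (m K) (M K)))"
    define F' where "F' = {K \<in> F. m K \<noteq> M K}"
    have F': "finite F'" "F' \<subseteq> \<D>" using F by (auto simp: F'_def)
    have hint: "{fst (h K)<..<snd (h K)} \<subseteq> interior K" if KD: "K \<in> \<D>" for K
    proof -
      obtain c d where cd: "K = {c..d}" using K[OF KD] by auto
      have "c \<le> m K" "m K \<le> d" "c \<le> M K" "M K \<le> d" using mM[OF KD] cd by auto
      thus ?thesis unfolding cd by (auto simp: h_def)
    qed
    have hne: "fst (h K) < snd (h K)" if "K \<in> F'" for K using that by (auto simp: h_def F'_def)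
    have dis: "{fst (h K)<..<snd (h K)} \<inter> {fst (h K')<..<snd (h K')} = {}" if "K \<in> F'" "K' \<in> F'" "K \<noteq> K'" for K K'
    proof -
      have "K \<in> \<D>" "K' \<in> \<D>" using that F' by auto
      moreover have "interior K \<inter> interior K' = {}" using disj calculation that(3) by (auto simp: pairwise_def)
      ultimately show ?thesis using hint by blast
    qed
    have inj: "inj_on h F'"
    proof (rule inj_onI, rule ccontr)
      fix K K' assume a: "K \<in> F'" "K' \<in> F'" "h K = h K'" "K \<noteq> K'"
      from dis[OF a(1,2,4)] have "{fst (h K)<..<snd (h K)} = {}" using a(3) by simp
      thus False using hne[OF a(1)] by simp
    qed
    have disJ: "disjoint_family_on (\<lambda>(x, y). {x<..<y}) (h ` F')"
      unfolding disjoint_family_on_def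
    proof (intro ballI impI)
      fix i j assume "i \<in> h ` F'" "j \<in> h ` F'" "i \<noteq> j"
      then obtain K K' where "K \<in> F'" "K' \<in> F'" "K \<noteq> K'" "i = h K" "j = h K'" by blast
      thus "(case i of (x, y) \<Rightarrow> {x<..<y}) \<inter> (case j of (x, y) \<Rightarrow> {x<..<y}) = {}"
        using dis[of K K'] by (simp add: case_prod_beta)
    qed
    have sub: "s < t \<and> {s<..<t} \<subseteq> \<Union>\<D>" if "(s, t) \<in> h ` F'" for s t
    proof -
      from that have "\<exists>K\<in>F'. h K = (s, t)" by (auto simp: image_iff eq_commute)
      then obtain K where k: "K \<in> F'" "h K = (s, t)" by blast
      have "{s<..<t} \<subseteq> interior K" using hint[of K] k F' by auto
      also have "interior K \<subseteq> K" by (rule interior_subset)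
      also have "K \<subseteq> \<Union>\<D>" using k F' by auto
      finally show ?thesis using hne[OF k(1)] k(2) by simp
    qed
    have "(\<Sum>(s, t)\<in>h ` F'. t - s) \<le> measure lebesgue (\<Union>\<D>)"
      using F' by (intro sum_disjoint_intervals_le sub disJ mD) auto
    also have "\<dots> < \<delta>" using mD Nm \<delta> by simp
    finally have len: "(\<Sum>(s, t)\<in>h ` F'. t - s) < \<delta>" .
    have "a \<le> m K \<and> m K \<le> b \<and> a \<le> M K \<and> M K \<le> b" if "K \<in> F'" for K
    proof -
      have "K \<in> \<D>" using that F' by blast
      hence "m K \<in> {a..b}" "M K \<in> {a..b}" using mM[of K] K[of K] by auto
      thus ?thesis by simp
    qed
    hence "\<forall>(x, y)\<in>h ` F'. a \<le> x \<and> x < y \<and> y \<le> b"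
      by (auto simp: h_def F'_def min_def max_def)
    hence "(\<Sum>(x, y)\<in>h ` F'. \<bar>u y - u x\<bar>) < e" using F' len disJ by (intro I) auto
    also have "(\<Sum>(x, y)\<in>h ` F'. \<bar>u y - u x\<bar>) = (\<Sum>K\<in>F'. \<bar>u (M K) - u (m K)\<bar>)"
      by (subst sum.reindex[OF inj], intro sum.cong) (auto simp: h_def min_def max_def)
    also have "\<dots> = (\<Sum>K\<in>F. \<bar>u (M K) - u (m K)\<bar>)"
      using F by (intro sum.mono_neutral_left) (auto simp: F'_def)
    finally have s: "(\<Sum>K\<in>F. \<bar>u (M K) - u (m K)\<bar>) < e" .
    have "measure lebesgue (\<Union>K\<in>F. A K) \<le> (\<Sum>K\<in>F. measure lebesgue (A K))"
      using F(2) by (intro measure_UNION_le) (auto simp: A_def)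
    also have "\<dots> \<le> (\<Sum>K\<in>F. \<bar>u (M K) - u (m K)\<bar>)"
      by (intro sum_mono) (auto simp: A_def)
    finally show ?thesis using s by simp
  qed
  have Am: "A K \<in> lmeasurable" for K by (simp add: A_def)
  show "\<exists>T. u ` N \<subseteq> T \<and> T \<in> lmeasurable \<and> measure lebesgue T \<le> e"
  proof (intro exI conjI)
    show "(\<Union>K\<in>\<D>. A K) \<in> lmeasurable" by (rule fmeasurable_UN_bound[OF cD Am fin])
    show "measure lebesgue (\<Union>K\<in>\<D>. A K) \<le> e" by (rule measure_UN_bound[OF cD Am fin])
    show "u ` N \<subseteq> (\<Union>K\<in>\<D>. A K)"
    proof
      fix y assume "y \<in> u ` N"
      then obtain x where x: "x \<in> N" "y = u x" by blast
      then obtain K where "K \<in> \<D>" "x \<in> K" using ND by blast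
      hence "y \<in> A K" using mM[of K] x(2) unfolding A_def by blast
      thus "y \<in> (\<Union>K\<in>\<D>. A K)" using \<open>K \<in> \<D>\<close> by blast
    qed
  qed
qed

lemma first_passage:
  fixes u :: "real \<Rightarrow> real"
  assumes c: "continuous_on {a..b} u" and ab: "a \<le> b" and v: "u a < v" "v \<le> u b"
  obtains x where "a < x" "x \<le> b" "u x = v" "\<And>y. a \<le> y \<Longrightarrow> y < x \<Longrightarrow> u y < v"
proof -
  define T where "T = {x \<in> {a..b}. v \<le> u x}"
  have "closed T" unfolding T_def
    using continuous_on_closed_Collect_le[OF continuous_on_const c closed_atLeastAtMost] .
  moreover have "bounded T" by (rule bounded_subset[of "{a..b}"]) (auto simp: T_def)
  ultimately have "compact T" by (simp add: compact_eq_bounded_closed)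
  moreover have "b \<in> T" using ab v by (simp add: T_def)
  ultimately obtain x where x: "x \<in> T" "\<forall>y\<in>T. x \<le> y" using compact_attains_inf[of T] by blast
  have lt: "u y < v" if "a \<le> y" "y < x" for y
  proof (rule ccontr)
    assume "\<not> u y < v"
    hence "y \<in> T" using that x(1) by (auto simp: T_def)
    thus False using x(2) that by force
  qed
  have "u x = v"
  proof (rule ccontr)
    assume ne: "u x \<noteq> v"
    hence "v < u x" using x(1) by (auto simp: T_def)
    moreover have "continuous_on {a..x} u" using c x(1) by (rule_tac continuous_on_subset[OF c]) (auto simp: T_def)
    ultimately obtain y where "a \<le> y" "y \<le> x" "u y = v"
      using IVT'[of u a v x] v x(1) by (auto simp: T_def)
    thus False using lt[of y] ne by (cases "y = x") auto
  qed
  moreover have "a < x" using calculation v x(1) by (cases "x = a") (auto simp: T_def)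
  ultimately show ?thesis using that[of x] lt x(1) by (auto simp: T_def)
qed

text \<open>The complement is a countable union: if an earlier value is at least \<open>u x\<close>, then some rational \<open>q < x\<close>
  separates the place of that value from \<open>x\<close>.\<close>

lemma record_set_borel:
  fixes u :: "real \<Rightarrow> real"
  assumes c: "continuous_on {a..b} u"
  shows "{x \<in> {a<..<b}. \<forall>y. a \<le> y \<and> y < x \<longrightarrow> u y < u x} \<in> sets borel"
proof -
  define T where "T = (\<lambda>q. {x \<in> {a<..<b}. q < x \<and> (\<exists>y\<in>{a..q}. u x \<le> u y)})"
  have "T q \<in> sets borel" if q: "q \<ge> a" for q
  proof (cases "q < b")
    case True
    have "continuous_on {a..q} u" using True by (intro continuous_on_subset[OF c]) auto
    then obtain m where m: "m \<in> {a..q}" "\<forall>y\<in>{a..q}. u y \<le> u m"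
      using continuous_attains_sup[of "{a..q}" u] q by auto
    have "T q = {q<..<b} \<inter> {x \<in> {a..b}. u x \<le> u m}"
      using q m by (fastforce simp: T_def)
    moreover have "closed {x \<in> {a..b}. u x \<le> u m}"
      by (rule continuous_on_closed_Collect_le[OF c continuous_on_const closed_atLeastAtMost])
    ultimately show ?thesis by simp
  next
    case False
    hence "T q = {}" by (auto simp: T_def)
    thus ?thesis by simp
  qed
  hence "(\<Union>q\<in>\<rat> \<inter> {a..}. T q) \<in> sets borel"
    by (intro sets.countable_UN' countable_Int1 countable_rat) auto
  moreover have "{x \<in> {a<..<b}. \<forall>y. a \<le> y \<and> y < x \<longrightarrow> u y < u x} = {a<..<b} - (\<Union>q\<in>\<rat> \<inter> {a..}. T q)"
  proof (intro set_eqI iffI)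
    fix x assume x: "x \<in> {x \<in> {a<..<b}. \<forall>y. a \<le> y \<and> y < x \<longrightarrow> u y < u x}"
    have "x \<notin> T q" for q
    proof
      assume "x \<in> T q"
      then obtain y where "y \<in> {a..q}" "u x \<le> u y" "q < x" by (auto simp: T_def)
      moreover have "u y < u x" using x calculation by auto
      ultimately show False by simp
    qed
    thus "x \<in> {a<..<b} - (\<Union>q\<in>\<rat> \<inter> {a..}. T q)" using x by blast
  next
    fix x assume x: "x \<in> {a<..<b} - (\<Union>q\<in>\<rat> \<inter> {a..}. T q)"
    have "u y < u x" if y: "a \<le> y" "y < x" for y
    proof (rule ccontr)
      assume "\<not> u y < u x"
      obtain q where q: "q \<in> \<rat>" "y < q" "q < x" using Rats_dense_in_real[OF y(2)] by blast
      have "x \<in> T q" using x q y \<open>\<not> u y < u x\<close> by (auto simp: T_def intro!: bexI[of _ y])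
      moreover have "q \<in> \<rat> \<inter> {a..}" using q y by auto
      ultimately show False using x by blast
    qed
    thus "x \<in> {x \<in> {a<..<b}. \<forall>y. a \<le> y \<and> y < x \<longrightarrow> u y < u x}" using x by blast
  qed
  ultimately show ?thesis by simp
qed

text \<open>On the set of points where \<open>u\<close> exceeds all earlier values, \<open>u\<close> is injective, and it takes every
  value between \<open>u a\<close> and \<open>u b\<close> there, at the first passage. The change of variables formula on this
  set gives the inequality.\<close>

lemma increment_le_integral_derivative:
  fixes u h :: "real \<Rightarrow> real"
  assumes c: "continuous_on {a..b} u" and ab: "a \<le> b"
    and neg: "negligible N" "negligible (u ` N)" 
    and der: "\<And>x. x \<in> {a<..<b} - N \<Longrightarrow> (u has_real_derivative h x) (at x)"
    and int: "h absolutely_integrable_on {a..b}"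
  shows "u b - u a \<le> integral {a..b} (\<lambda>x. \<bar>h x\<bar>)"
proof (cases "u a < u b")
  case False
  have "0 \<le> integral {a..b} (\<lambda>x. \<bar>h x\<bar>)" 
    using int by (intro integral_nonneg) (auto simp: absolutely_integrable_on_def)
  thus ?thesis using False by simp
next
  case True
  define S where "S = {x \<in> {a<..<b}. \<forall>y. a \<le> y \<and> y < x \<longrightarrow> u y < u x}"
  have S: "S \<in> sets lebesgue" using record_set_borel[OF c] unfolding S_def by simp
  have Nl: "N \<in> sets lebesgue" using neg(1) by (rule negligible_imp_sets)
  define E where "E = S - N"
  have E: "E \<in> sets lebesgue" unfolding E_def using S Nl by (rule sets.Diff)
  have sub: "E \<subseteq> {a..b}" by (auto simp: E_def S_def)
  have inj: "inj_on u E"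
  proof (rule inj_onI)
    fix x y assume a: "x \<in> E" "y \<in> E" "u x = u y"
    show "x = y"
    proof (rule ccontr)
      assume "x \<noteq> y"
      hence "x < y \<or> y < x" by auto
      moreover have "a < x" "a < y" using a by (auto simp: E_def S_def)
      ultimately have "u x < u y \<or> u y < u x" using a(1,2) by (auto simp: E_def S_def)
      thus False using a(3) by simp
    qed
  qed
  have dE: "(u has_real_derivative h x) (at x within E)" if "x \<in> E" for x
    by (rule has_field_derivative_at_within[OF der]) (use that in \<open>auto simp: E_def S_def\<close>)
  have hE: "h absolutely_integrable_on E" by (rule set_integrable_subset[OF int E sub])
  hence hE': "(\<lambda>x. \<bar>h x\<bar> *\<^sub>R (1::real)) absolutely_integrable_on E"
    using set_integrable_abs by auto
  have "(\<lambda>_. 1::real) absolutely_integrable_on (u ` E) \<and> integral (u ` E) (\<lambda>_. 1::real) = integral E (\<lambda>x. \<bar>h x\<bar> *\<^sub>R (1::real))"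
    using has_absolute_integral_change_of_variables_real[OF E dE inj, of "\<lambda>_. 1::real" "integral E (\<lambda>x. \<bar>h x\<bar> *\<^sub>R (1::real))"] hE' by blast
  hence uE: "u ` E \<in> lmeasurable" "measure lebesgue (u ` E) = integral E (\<lambda>x. \<bar>h x\<bar>)"
    by (auto simp: lmeasurable_iff_integrable_on lmeasure_integral absolutely_integrable_on_def)
  have "{u a<..<u b} \<subseteq> u ` E \<union> u ` N"
  proof
    fix v assume v: "v \<in> {u a<..<u b}"
    obtain x where x: "a < x" "x \<le> b" "u x = v" "\<And>y. a \<le> y \<Longrightarrow> y < x \<Longrightarrow> u y < v"
      using first_passage[OF c ab, of v] v by auto
    have "x \<in> S" using x v by (auto simp: S_def le_less)
    thus "v \<in> u ` E \<union> u ` N" using x(3) unfolding E_def by blast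
  qed
  moreover have un: "u ` E \<union> u ` N \<in> lmeasurable" "measure lebesgue (u ` E \<union> u ` N) = measure lebesgue (u ` E)"
    by (rule lmeasurable_Un_negligible[OF uE(1) neg(2)])+
  ultimately have "measure lebesgue {u a<..<u b} \<le> measure lebesgue (u ` E)"
    using measure_mono_fmeasurable[of "{u a<..<u b}" "u ` E \<union> u ` N" lebesgue] by auto
  also have "\<dots> \<le> integral {a..b} (\<lambda>x. \<bar>h x\<bar>)"
    unfolding uE(2) using sub hE int 
    by (intro integral_subset_le) (auto simp: absolutely_integrable_on_def)
  finally show ?thesis using True by simp
qed

lemma abs_continuous_increment_le:
  fixes u :: "real \<Rightarrow> real"
  assumes u: "abs_continuous_on_interval a b u" and int: "deriv u absolutely_integrable_on {a..b}"
    and cd: "a \<le> c" "c \<le> d" "d \<le> b"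
  shows "\<bar>u d - u c\<bar> \<le> integral {c..d} (\<lambda>x. \<bar>deriv u x\<bar>)"
proof -
  define N where "N = {x \<in> {a<..<b}. \<not> (\<exists>D. (u has_real_derivative D) (at x))}"
  have N: "negligible N" unfolding N_def by (rule abs_continuous_differentiable_ae[OF u])
  have uN: "negligible (u ` N)" 
    by (rule abs_continuous_negligible_image[OF u N]) (auto simp: N_def)
  have "(\<Sum>(x, y)\<in>I. \<bar>- u y - - u x\<bar>) = (\<Sum>(x, y)\<in>I. \<bar>u y - u x\<bar>)" for I
    by (intro sum.cong) auto
  hence "abs_continuous_on_interval a b (\<lambda>x. - u x)"
    using u unfolding abs_continuous_on_interval_def by simp
  hence muN: "negligible ((\<lambda>x. - u x) ` N)" 
    by (rule abs_continuous_negligible_image[OF _ N]) (auto simp: N_def)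
  have cont: "continuous_on {c..d} u" 
    using abs_continuous_imp_continuous_on[OF u] by (rule continuous_on_subset) (use cd in auto)
  have der: "(u has_real_derivative deriv u x) (at x)" if "x \<in> {c<..<d} - N" for x
  proof -
    have "\<exists>D. (u has_real_derivative D) (at x)" using that cd by (auto simp: N_def)
    thus ?thesis using DERIV_imp_deriv by blast
  qed
  have i: "deriv u absolutely_integrable_on {c..d}"
    by (rule set_integrable_subset[OF int]) (use cd in auto)
  have "u d - u c \<le> integral {c..d} (\<lambda>x. \<bar>deriv u x\<bar>)"
    by (rule increment_le_integral_derivative[OF cont cd(2) N uN der i])
  moreover have "- u d - (- u c) \<le> integral {c..d} (\<lambda>x. \<bar>- deriv u x\<bar>)"
  proof (rule increment_le_integral_derivative[OF _ cd(2) N muN])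
    show "continuous_on {c..d} (\<lambda>x. - u x)" by (intro continuous_intros cont)
    show "((\<lambda>x. - u x) has_real_derivative - deriv u x) (at x)" if "x \<in> {c<..<d} - N" for x
      by (rule DERIV_minus[OF der[OF that]])
    show "(\<lambda>x. - deriv u x) absolutely_integrable_on {c..d}"
      using i by (simp add: absolutely_integrable_on_def integrable_neg_iff)
  qed
  ultimately show ?thesis by simp
qed

section \<open>Energy of the outermost branches\<close>

definition slope_energy :: "real \<Rightarrow> real \<Rightarrow> real" where
  "slope_energy p s = (1 + s\<^sup>2) powr (p / 2)"

lemma slope_energy_0 [simp]: "slope_energy p 0 = 1"
  by (simp add: slope_energy_def)

lemma slope_energy_ge_1: "p \<ge> 0 \<Longrightarrow> slope_energy p s \<ge> 1"
  unfolding slope_energy_def by (rule ge_one_powr_ge_zero) auto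

lemma slope_energy_mono: "p \<le> q \<Longrightarrow> slope_energy p s \<le> slope_energy q s"
  unfolding slope_energy_def by (intro powr_mono) auto

lemma bernoulli_powr:
  fixes x p :: real
  assumes "x > 0" "p \<ge> 1"
  shows "1 + p * (x - 1) \<le> x powr p"
proof -
  have "(x powr p) powr (1 / p) * 1 powr (1 - 1 / p) \<le> 1 / p * x powr p + (1 - 1 / p) * 1"
    using assms by (intro Youngs_inequality_0) auto
  hence "x \<le> 1 / p * x powr p + (1 - 1 / p)" using assms by (simp add: powr_powr)
  hence "p * x \<le> p * (1 / p * x powr p + (1 - 1 / p))" using assms by simp
  also have "\<dots> = x powr p + (p - 1)" using assms by (simp add: algebra_simps)
  finally show ?thesis by (simp add: algebra_simps)
qed

text \<open>The density is the convex function \<open>y powr p\<close> of \<open>y = sqrt (1 + s\<^sup>2)\<close>, which is itself convex; its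
  tangent inequality combines Bernoulli's and the Cauchy-Schwarz inequality.\<close>

lemma slope_energy_tangent:
  assumes p: "p \<ge> 1" and s0: "s0 \<ge> 0"
  obtains c where "c \<ge> 0" "\<And>s. slope_energy p s \<ge> slope_energy p s0 + c * (s - s0)"
proof -
  define y where "y = (\<lambda>s::real. sqrt (1 + s\<^sup>2))"
  have pos: "1 + s\<^sup>2 > 0" for s :: real by (auto intro: add_pos_nonneg)
  have y: "y s > 0" "(y s)\<^sup>2 = 1 + s\<^sup>2" for s using pos[of s] by (auto simp: y_def)
  have e: "slope_energy p s = y s powr p" for s
    unfolding slope_energy_def y_def using pos[of s] by (simp add: powr_half_sqrt[symmetric] powr_powr)
  define c where "c = p * (y s0 powr p) * s0 / (y s0)\<^sup>2"
  have "slope_energy p s \<ge> slope_energy p s0 + c * (s - s0)" for s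
  proof -
    have "(1 + s * s0)\<^sup>2 + (s - s0)\<^sup>2 = (1 + s\<^sup>2) * (1 + s0\<^sup>2)" by algebra
    moreover have "(s - s0)\<^sup>2 \<ge> 0" by simp
    ultimately have "(1 + s * s0)\<^sup>2 \<le> (1 + s\<^sup>2) * (1 + s0\<^sup>2)" by linarith
    hence "(1 + s * s0)\<^sup>2 \<le> (y s * y s0)\<^sup>2" using y by (simp add: power_mult_distrib)
    hence "1 + s * s0 \<le> y s * y s0" by (rule power2_le_imp_le) (use y in \<open>auto intro: less_imp_le\<close>)
    hence "(1 + s * s0) / (y s0)\<^sup>2 \<le> (y s * y s0) / (y s0)\<^sup>2" by (rule divide_right_mono) simp
    hence "(1 + s * s0) / (y s0)\<^sup>2 \<le> y s / y s0" using y(1)[of s0] by (simp add: power2_eq_square)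
    moreover have "(1 + s * s0) / (y s0)\<^sup>2 - 1 = s0 * (s - s0) / (y s0)\<^sup>2"
      using pos[of s0] unfolding y(2) by (simp add: field_simps power2_eq_square)
    ultimately have "p * (s0 * (s - s0) / (y s0)\<^sup>2) \<le> p * (y s / y s0 - 1)"
      using p by (intro mult_left_mono) auto
    also have "1 + \<dots> \<le> (y s / y s0) powr p" using y p by (intro bernoulli_powr) auto
    finally have "y s0 powr p * (1 + p * (s0 * (s - s0) / (y s0)\<^sup>2)) \<le> y s0 powr p * (y s / y s0) powr p"
      by (intro mult_left_mono) auto
    also have "\<dots> = y s powr p" using y(1)[of s] y(1)[of s0] by (simp add: powr_divide)
    finally show ?thesis unfolding e c_def by (simp add: algebra_simps)
  qed
  moreover have "c \<ge> 0" using p s0 by (simp add: c_def)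
  ultimately show ?thesis using that by blast
qed

text \<open>Lengthening the interval over which the height \<open>\<Delta>\<close> is climbed lowers the energy in excess of the length. This is
  Jensen's inequality for slope \<open>\<Delta> / l\<close> on a part of the longer interval and slope \<open>0\<close> on the rest.\<close>

lemma slope_energy_excess_antimono:
  assumes p: "p \<ge> 1" and "\<Delta> \<ge> 0" and l: "0 < l" "l \<le> l'"
  shows "l' * (slope_energy p (\<Delta> / l') - 1) \<le> l * (slope_energy p (\<Delta> / l) - 1)"
proof -
  obtain c where c: "\<And>s. slope_energy p s \<ge> slope_energy p (\<Delta> / l') + c * (s - \<Delta> / l')"
    using slope_energy_tangent[OF p, of "\<Delta> / l'"] assms by auto
  have "l * slope_energy p (\<Delta> / l) \<ge> l * (slope_energy p (\<Delta> / l') + c * (\<Delta> / l - \<Delta> / l'))"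
    using c l by (intro mult_left_mono) auto
  moreover have "(l' - l) * 1 \<ge> (l' - l) * (slope_energy p (\<Delta> / l') + c * (0 - \<Delta> / l'))"
    using c[of 0] l by (intro mult_left_mono) auto
  moreover have "l * (slope_energy p (\<Delta> / l') + c * (\<Delta> / l - \<Delta> / l')) +
     (l' - l) * (slope_energy p (\<Delta> / l') + c * (0 - \<Delta> / l')) = l' * slope_energy p (\<Delta> / l')"
    using l by (simp add: field_simps)
  ultimately show ?thesis by (simp add: algebra_simps)
qed

lemma slope_energy_crossing_cost:
  assumes "\<Delta> > 0" "l > 0"
  shows "l * slope_energy p (\<Delta> / l) = \<Delta> * crossing_cost p (l / \<Delta>)"
  using assms by (simp add: slope_energy_def crossing_cost_def power_divide)

lemma integral_le_nn_integral:
  fixes g :: "'a \<Rightarrow> real"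
  assumes "integrable M g"
  shows "ennreal (\<integral>x. g x \<partial>M) \<le> (\<integral>\<^sup>+x. ennreal (g x) \<partial>M)"
proof -
  have "ennreal (\<integral>x. g x \<partial>M) \<le> ennreal (\<integral>x. max 0 (g x) \<partial>M)"
    using assms by (intro ennreal_leI integral_mono) auto
  also have "\<dots> = (\<integral>\<^sup>+x. ennreal (max 0 (g x)) \<partial>M)"
    using assms by (intro nn_integral_eq_integral[symmetric]) auto
  also have "\<dots> = (\<integral>\<^sup>+x. ennreal (g x) \<partial>M)" by (simp add: ennreal_max_0)
  finally show ?thesis .
qed

text \<open>Freezing the exponent at a lower bound \<open>p0\<close> makes Jensen's inequality applicable, without any
  modulus of continuity for \<open>p\<close>.\<close>

lemma jensen_slope_energy:
  fixes u p :: "real \<Rightarrow> real"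
  assumes u: "abs_continuous_on_interval a b u" and int: "deriv u absolutely_integrable_on {a..b}"
    and cd: "a \<le> c" "c < d" "d \<le> b"
    and p: "p0 \<ge> 1" "\<And>x. x \<in> {c..d} \<Longrightarrow> p0 \<le> p x"
  shows "ennreal ((d - c) * (slope_energy p0 (\<bar>u d - u c\<bar> / (d - c)) - 1)) \<le>
      (\<integral>\<^sup>+x\<in>{c<..<d}. ennreal (slope_energy (p x) \<bar>deriv u x\<bar> - 1) \<partial>lebesgue)"
proof -
  define s0 where "s0 = \<bar>u d - u c\<bar> / (d - c)"
  obtain k where k: "k \<ge> 0" "\<And>s. slope_energy p0 s \<ge> slope_energy p0 s0 + k * (s - s0)"
    using slope_energy_tangent[OF p(1), of s0] cd by (auto simp: s0_def)
  define h where "h = (\<lambda>x. k * \<bar>deriv u x\<bar> + (slope_energy p0 s0 - 1 - k * s0))"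
  have i: "deriv u absolutely_integrable_on {c<..<d}"
    by (rule set_integrable_subset[OF int]) (use cd in auto)
  have ia: "(\<lambda>x. \<bar>deriv u x\<bar>) absolutely_integrable_on {c<..<d}" using set_integrable_abs[OF i] .
  have ic: "(\<lambda>x. slope_energy p0 s0 - 1 - k * s0) absolutely_integrable_on {c<..<d}"
    by (rule absolutely_integrable_on_const) auto
  have ik: "(\<lambda>x. k * \<bar>deriv u x\<bar>) absolutely_integrable_on {c<..<d}"
    using ia by (rule set_integrable_mult_right)
  have ih: "set_integrable lebesgue {c<..<d} h" unfolding h_def by (rule set_integral_add(1)[OF ik ic])
  have "(d - c) * (slope_energy p0 s0 - 1) = k * \<bar>u d - u c\<bar> + (d - c) * (slope_energy p0 s0 - 1 - k * s0)"
    using cd by (simp add: s0_def field_simps)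
  also have "\<dots> \<le> k * integral {c..d} (\<lambda>x. \<bar>deriv u x\<bar>) + (d - c) * (slope_energy p0 s0 - 1 - k * s0)"
    using abs_continuous_increment_le[OF u int, of c d] cd k by (intro add_right_mono mult_left_mono) auto
  also have "integral {c..d} (\<lambda>x. \<bar>deriv u x\<bar>) = (LINT x:{c<..<d}|lebesgue. \<bar>deriv u x\<bar>)"
    unfolding integral_open_interval_real by (rule set_lebesgue_integral_eq_integral(2)[OF ia, symmetric])
  also have "k * \<dots> = (LINT x:{c<..<d}|lebesgue. k * \<bar>deriv u x\<bar>)" by (rule set_integral_mult_right[symmetric])
  also have "(d - c) * (slope_energy p0 s0 - 1 - k * s0) = (LINT x:{c<..<d}|lebesgue. (slope_energy p0 s0 - 1 - k * s0))"
    using cd by (simp add: set_lebesgue_integral_def mult.commute)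
  also have "(LINT x:{c<..<d}|lebesgue. k * \<bar>deriv u x\<bar>) + \<dots> = (LINT x:{c<..<d}|lebesgue. h x)"
    unfolding h_def by (rule set_integral_add(2)[OF ik ic, symmetric])
  finally have "ennreal ((d - c) * (slope_energy p0 s0 - 1)) \<le> ennreal (LINT x:{c<..<d}|lebesgue. h x)"
    by (rule ennreal_leI)
  also have "\<dots> \<le> (\<integral>\<^sup>+x. ennreal (indicat_real {c<..<d} x * h x) \<partial>lebesgue)"
    unfolding set_lebesgue_integral_def using ih unfolding set_integrable_def
    using integral_le_nn_integral[of lebesgue "\<lambda>x. indicat_real {c<..<d} x * h x"] by simp
  also have "\<dots> \<le> (\<integral>\<^sup>+x\<in>{c<..<d}. ennreal (slope_energy (p x) \<bar>deriv u x\<bar> - 1) \<partial>lebesgue)"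
  proof (intro nn_integral_mono)
    fix x :: real
    show "ennreal (indicat_real {c<..<d} x * h x) \<le> ennreal (slope_energy (p x) \<bar>deriv u x\<bar> - 1) * indicator {c<..<d} x"
    proof (cases "x \<in> {c<..<d}")
      case True
      have "h x \<le> slope_energy p0 \<bar>deriv u x\<bar> - 1"
        using k(2)[of "\<bar>deriv u x\<bar>"] by (simp add: h_def algebra_simps)
      also have "\<dots> \<le> slope_energy (p x) \<bar>deriv u x\<bar> - 1"
        using slope_energy_mono[OF p(2)[of x]] True by auto
      finally show ?thesis using True by (simp add: ennreal_leI)
    qed simp
  qed
  finally show ?thesis unfolding s0_def .
qed

text \<open>From the last passage through \<open>t\<close> to the first passage through \<open>t'\<close>.\<close>

lemma crossing_interval:
  fixes u :: "real \<Rightarrow> real"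
  assumes c: "continuous_on {a..b} u" and ab: "a \<le> b" and v: "u a \<le> t" "t < t'" "t' \<le> u b"
  obtains x x' where "a \<le> x" "x < x'" "x' \<le> b" "u x = t" "u x' = t'"
    "\<And>y. x < y \<Longrightarrow> y < x' \<Longrightarrow> t < u y \<and> u y < t'" "\<And>y. a \<le> y \<Longrightarrow> y < x' \<Longrightarrow> u y < t'"
proof -
  obtain x' where x': "a < x'" "x' \<le> b" "u x' = t'" "\<And>y. a \<le> y \<Longrightarrow> y < x' \<Longrightarrow> u y < t'"
    using first_passage[OF c ab, of t'] v by auto
  \<comment> \<open>The last passage through \<open>t\<close> before \<open>x'\<close> is a first passage of the reversed function.\<close>
  have c': "continuous_on {-x'..-a} (\<lambda>y. - u (- y))"
    by (intro continuous_on_minus continuous_on_compose2[OF c]) (use x' in \<open>auto intro!: continuous_intros\<close>)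
  obtain z where z: "- x' < z" "z \<le> - a" "- u (- z) = - t" "\<And>y. - x' \<le> y \<Longrightarrow> y < z \<Longrightarrow> - u (- y) < - t"
    using first_passage[OF c', of "- t"] x' v by auto
  show ?thesis
  proof (rule that[of "- z" x'])
    show "t < u y \<and> u y < t'" if "- z < y" "y < x'" for y
      using z(4)[of "- y"] x'(4)[of y] that z(2) by auto
  qed (use x' z in auto)
qed

lemma nn_integral_subset_disjoint_Un:
  assumes "(\<lambda>x. f x * indicator S x) \<in> borel_measurable M" "A \<in> sets M" "B \<in> sets M" 
    "A \<inter> B = {}" "A \<union> B \<subseteq> E" "E \<subseteq> S"
  shows "(\<integral>\<^sup>+x\<in>A. f x \<partial>M) + (\<integral>\<^sup>+x\<in>B. f x \<partial>M) \<le> (\<integral>\<^sup>+x\<in>E. f x \<partial>M)"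
proof -
  have *: "(\<lambda>x. f x * indicator C x) \<in> borel_measurable M" if "C \<in> sets M" "C \<subseteq> S" for C
  proof -
    have "(\<lambda>x. f x * indicator S x * indicator C x) \<in> borel_measurable M" using assms(1) that(1) by simp
    moreover have "f x * indicator S x * indicator C x = f x * indicator C x" for x
      using that(2) by (auto split: split_indicator)
    ultimately show ?thesis by simp
  qed
  have "(\<integral>\<^sup>+x\<in>A. f x \<partial>M) + (\<integral>\<^sup>+x\<in>B. f x \<partial>M) = (\<integral>\<^sup>+x. f x * indicator A x + f x * indicator B x \<partial>M)"
    using assms by (intro nn_integral_add[symmetric] *) auto
  also have "\<dots> \<le> (\<integral>\<^sup>+x\<in>E. f x \<partial>M)"
    using assms by (intro nn_integral_mono) (auto split: split_indicator)
  finally show ?thesis .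
qed

text \<open>The heart of the comparison, for the band of levels between \<open>t\<close> and \<open>t'\<close>. The outermost branches
  occupy \<open>{a<..<a'}\<close> and \<open>{b'<..<b}\<close>. All points of height at least \<open>t'\<close> lie in \<open>{a'..b'}\<close>, so that
  half the distance of the branches is at least \<open>x\<close>. The left branch is stretched so that both
  lengths together equal \<open>2 * \<delta>\<close> before convexity is applied. On each branch the exponent is frozen at
  its minimum, and any position within the branch still has the required distance.\<close>

lemma two_branch_estimate:
  fixes u p :: "real \<Rightarrow> real"
  assumes u: "abs_continuous_on_interval (-1) 1 u" and int: "deriv u absolutely_integrable_on {-1..1}"
    and u0: "u (-1) = 0" "u 1 = 0"
    and p: "continuous_on {-1..1} p" "\<And>x. x \<in> {-1..1} \<Longrightarrow> p x \<ge> 1"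
    and p_mono: "\<And>x y. \<bar>x\<bar> \<le> \<bar>y\<bar> \<Longrightarrow> y \<in> {-1..1} \<Longrightarrow> p x \<le> p y"
    and cost: "\<And>s1 s2 x1 x2. s1 > 0 \<Longrightarrow> s2 > 0 \<Longrightarrow> x1 \<in> {-1..1} \<Longrightarrow> x2 \<in> {-1..1} \<Longrightarrow>
        2 * crossing_cost (p ((x1 + x2) / 2)) ((s1 + s2) / 2) \<le> crossing_cost (p x1) s1 + crossing_cost (p x2) s2"
    and meas: "(\<lambda>x. ennreal (slope_energy (p x) \<bar>deriv u x\<bar> - 1) * indicator {-1..1} x) \<in> borel_measurable lebesgue"
    and t: "0 \<le> t" "t < t'" and attained: "\<exists>y\<in>{-1..1}. t' \<le> u y"
    and x: "0 \<le> x" "2 * x \<le> measure lebesgue {y \<in> {-1..1}. t' \<le> u y}"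
    and \<delta>: "\<delta> > 0" "measure lebesgue {y \<in> {-1..1}. t < u y \<and> u y < t'} \<le> 2 * \<delta>"
  shows "ennreal (2 * \<delta> * (slope_energy (p x) ((t' - t) / \<delta>) - 1)) \<le>
      (\<integral>\<^sup>+y\<in>{y \<in> {-1..1}. t < u y \<and> u y < t'}. ennreal (slope_energy (p y) \<bar>deriv u y\<bar> - 1) \<partial>lebesgue)"
proof -
  let ?f = "\<lambda>y. ennreal (slope_energy (p y) \<bar>deriv u y\<bar> - 1)"
  define E where "E = {y \<in> {-1..1}. t < u y \<and> u y < t'}"
  define \<Delta> where "\<Delta> = t' - t"
  have \<Delta>: "\<Delta> > 0" using t by (simp add: \<Delta>_def)
  obtain y where y: "-1 \<le> y" "y \<le> 1" "t' \<le> u y" using attained by auto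
  have cont: "continuous_on {-1..1} u" by (rule abs_continuous_imp_continuous_on[OF u])
  obtain a a' where a: "-1 \<le> a" "a < a'" "a' \<le> y" "u a = t" "u a' = t'"
    "\<And>z. a < z \<Longrightarrow> z < a' \<Longrightarrow> t < u z \<and> u z < t'" "\<And>z. -1 \<le> z \<Longrightarrow> z < a' \<Longrightarrow> u z < t'"
  proof (rule crossing_interval[of "-1" y u t t'])
    show "continuous_on {-1..y} u" using y by (intro continuous_on_subset[OF cont]) auto
  qed (use u0 t y in auto)
  \<comment> \<open>The right branch is the left branch of the reflected function.\<close>
  obtain c c' where c: "-1 \<le> c" "c < c'" "c' \<le> - y" "u (- c) = t" "u (- c') = t'"
    "\<And>z. c < z \<Longrightarrow> z < c' \<Longrightarrow> t < u (- z) \<and> u (- z) < t'" "\<And>z. -1 \<le> z \<Longrightarrow> z < c' \<Longrightarrow> u (- z) < t'"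
  proof (rule crossing_interval[of "-1" "- y" "\<lambda>z. u (- z)" t t'])
    show "continuous_on {-1..- y} (\<lambda>z. u (- z))"
      using y by (intro continuous_on_compose2[OF cont]) (auto intro!: continuous_intros)
  qed (use u0 t y in auto)
  define b b' where "b = - c" and "b' = - c'"
  have b: "b' < b" "b \<le> 1" "y \<le> b'" "u b = t" "u b' = t'" using c by (auto simp: b_def b'_def)
  have b_in: "t < u z \<and> u z < t'" if "b' < z" "z < b" for z
    using c(6)[of "- z"] that by (auto simp: b_def b'_def)
  have b_out: "u z < t'" if "b' < z" "z \<le> 1" for z
    using c(7)[of "- z"] that by (auto simp: b'_def)
  define l \<rho> where "l = a' - a" and "\<rho> = b - b'"
  have l: "l > 0" and \<rho>: "\<rho> > 0" using a b by (auto simp: l_def \<rho>_def)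

  have E_sets: "E \<in> sets lebesgue" and E_fm: "E \<in> lmeasurable"
  proof -
    have 1: "closed {y \<in> {-1..1}. t' \<le> u y}" "closed {y \<in> {-1..1}. u y \<le> t}"
      by (rule continuous_on_closed_Collect_le continuous_on_const cont closed_atLeastAtMost)+
    have "E = {-1..1} - {y \<in> {-1..1}. t' \<le> u y} - {y \<in> {-1..1}. u y \<le> t}" by (auto simp: E_def)
    also have "\<dots> \<in> sets borel" by (intro sets.Diff borel_closed 1 closed_atLeastAtMost)
    finally have "E \<in> sets borel" .
    thus E: "E \<in> sets lebesgue" by simp
    have "E \<subseteq> {-1..1}" unfolding E_def by blast
    thus "E \<in> lmeasurable" by (rule fmeasurableI2[rotated]) (use E in simp_all)
  qed
  have sub: "{a<..<a'} \<union> {b'<..<b} \<subseteq> E" using a b b_in y by (auto simp: E_def)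
  have disj: "{a<..<a'} \<inter> {b'<..<b} = {}" using a b by auto
  have "l + \<rho> = measure lebesgue ({a<..<a'} \<union> {b'<..<b})"
    using a b disj by (subst measure_Un3) (auto simp: l_def \<rho>_def)
  also have "\<dots> \<le> measure lebesgue E" using sub E_fm by (intro measure_mono_fmeasurable) auto
  also have "\<dots> \<le> 2 * \<delta>" using \<delta> by (simp add: E_def)
  finally have len: "l + \<rho> \<le> 2 * \<delta>" .
  have "2 * x \<le> measure lebesgue {y \<in> {-1..1}. t' \<le> u y}" by (rule x)
  also have "\<dots> \<le> measure lebesgue {a'..b'}"
  proof (rule measure_mono_fmeasurable)
    show "{y \<in> {-1..1}. t' \<le> u y} \<subseteq> {a'..b'}"
      using a(7) b_out by (force simp: not_less[symmetric])
    have "closed {y \<in> {-1..1}. t' \<le> u y}"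
      by (rule continuous_on_closed_Collect_le continuous_on_const cont closed_atLeastAtMost)+
    thus "{y \<in> {-1..1}. t' \<le> u y} \<in> sets lebesgue" by simp
  qed simp
  also have "\<dots> = b' - a'" using a b by simp
  finally have x_le: "2 * x \<le> b' - a'" .

  obtain \<xi> where \<xi>: "\<xi> \<in> {a..a'}" "\<And>z. z \<in> {a..a'} \<Longrightarrow> p \<xi> \<le> p z"
    using continuous_attains_inf[of "{a..a'}" p] continuous_on_subset[OF p(1), of "{a..a'}"] a y by auto
  obtain \<eta> where \<eta>: "\<eta> \<in> {b'..b}" "\<And>z. z \<in> {b'..b} \<Longrightarrow> p \<eta> \<le> p z"
    using continuous_attains_inf[of "{b'..b}" p] continuous_on_subset[OF p(1), of "{b'..b}"] b y by auto
  have in1: "\<xi> \<in> {-1..1}" "\<eta> \<in> {-1..1}" "- \<xi> \<in> {-1..1}" using \<xi> \<eta> a b y by auto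
  note p1 = p(2)[OF in1(1)] p(2)[OF in1(2)]

  let ?L = "l * (slope_energy (p \<xi>) (\<Delta> / l) - 1)" and ?R = "\<rho> * (slope_energy (p \<eta>) (\<Delta> / \<rho>) - 1)"
  have L: "ennreal ?L \<le> (\<integral>\<^sup>+z\<in>{a<..<a'}. ?f z \<partial>lebesgue)"
    using jensen_slope_energy[OF u int, of a a' "p \<xi>" p] a y \<xi> p1 \<Delta> by (simp add: l_def \<Delta>_def)
  have "\<bar>u b - u b'\<bar> = \<Delta>" using b t by (simp add: \<Delta>_def)
  hence R: "ennreal ?R \<le> (\<integral>\<^sup>+z\<in>{b'<..<b}. ?f z \<partial>lebesgue)"
    using jensen_slope_energy[OF u int, of b' b "p \<eta>" p] b y \<eta> p1 by (simp add: \<rho>_def)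
  have L0: "?L \<ge> 0" "?R \<ge> 0" using l \<rho> p1 by (auto intro!: mult_nonneg_nonneg slope_energy_ge_1 simp: algebra_simps)

  define l' where "l' = 2 * \<delta> - \<rho>"
  have l': "l' > 0" "l \<le> l'" using l len by (auto simp: l'_def)
  have px: "p x \<le> p ((- \<xi> + \<eta>) / 2)"
    using x x_le \<xi> \<eta> in1 by (intro p_mono) auto
  have p\<xi>: "p (- \<xi>) = p \<xi>" using p_mono[of "- \<xi>" \<xi>] p_mono[of \<xi> "- \<xi>"] in1 by auto
  have "2 * \<delta> * slope_energy (p x) (\<Delta> / \<delta>) = 2 * \<Delta> * crossing_cost (p x) (\<delta> / \<Delta>)"
    using slope_energy_crossing_cost[OF \<Delta> \<delta>(1)] by simp
  also have "\<dots> \<le> 2 * \<Delta> * crossing_cost (p ((- \<xi> + \<eta>) / 2)) (\<delta> / \<Delta>)"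
    using \<Delta> \<delta> px by (intro mult_left_mono crossing_cost_mono) auto
  also have "\<delta> / \<Delta> = (l' / \<Delta> + \<rho> / \<Delta>) / 2" by (simp add: l'_def add_divide_distrib[symmetric])
  also have "2 * \<Delta> * crossing_cost (p ((- \<xi> + \<eta>) / 2)) ((l' / \<Delta> + \<rho> / \<Delta>) / 2)
     = \<Delta> * (2 * crossing_cost (p ((- \<xi> + \<eta>) / 2)) ((l' / \<Delta> + \<rho> / \<Delta>) / 2))" by simp
  also have "\<dots> \<le> \<Delta> * (crossing_cost (p (- \<xi>)) (l' / \<Delta>) + crossing_cost (p \<eta>) (\<rho> / \<Delta>))"
    using \<Delta> l' \<rho> in1 by (intro mult_left_mono cost) auto
  also have "\<dots> = l' * slope_energy (p \<xi>) (\<Delta> / l') + \<rho> * slope_energy (p \<eta>) (\<Delta> / \<rho>)"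
    using slope_energy_crossing_cost[OF \<Delta> l'(1)] slope_energy_crossing_cost[OF \<Delta> \<rho>] p\<xi> by (simp add: algebra_simps)
  finally have "2 * \<delta> * (slope_energy (p x) (\<Delta> / \<delta>) - 1) \<le> l' * (slope_energy (p \<xi>) (\<Delta> / l') - 1) + ?R"
    by (simp add: l'_def algebra_simps)
  also have "l' * (slope_energy (p \<xi>) (\<Delta> / l') - 1) \<le> ?L"
    using \<Delta> l l' p1 by (intro slope_energy_excess_antimono) auto
  finally have "ennreal (2 * \<delta> * (slope_energy (p x) (\<Delta> / \<delta>) - 1)) \<le> ennreal (?L + ?R)"
    by (simp add: ennreal_leI)
  also have "\<dots> = ennreal ?L + ennreal ?R" using L0 by (rule ennreal_plus)
  also have "\<dots> \<le> (\<integral>\<^sup>+z\<in>{a<..<a'}. ?f z \<partial>lebesgue) + (\<integral>\<^sup>+z\<in>{b'<..<b}. ?f z \<partial>lebesgue)"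
    by (intro add_mono L R)
  also have "\<dots> \<le> (\<integral>\<^sup>+z\<in>E. ?f z \<partial>lebesgue)"
    by (rule nn_integral_subset_disjoint_Un[OF meas _ _ disj sub]) (auto simp: E_def)
  finally show ?thesis unfolding E_def \<Delta>_def .
qed

section \<open>Level sets of the symmetrization\<close>

lemma closed_superlevel:
  fixes u :: "real \<Rightarrow> real"
  assumes "continuous_on {-1..1} u"
  shows "closed {x \<in> {-1..1}. s \<le> u x}" "closed {x \<in> {-1..1}. u x \<le> s}"
  by (rule continuous_on_closed_Collect_le continuous_on_const assms closed_atLeastAtMost)+

lemma superlevel_set_lmeasurable:
  assumes "continuous_on {-1..1} u"
  shows "superlevel_set u s \<in> lmeasurable"
proof -
  have eq: "superlevel_set u s = {-1..1} - {x \<in> {-1..1}. u x \<le> s}" by (auto simp: superlevel_set_def)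
  have "superlevel_set u s \<in> sets borel" unfolding eq
    by (intro sets.Diff borel_closed closed_superlevel assms closed_atLeastAtMost)
  moreover have "superlevel_set u s \<subseteq> {-1..1}" by (auto simp: superlevel_set_def)
  ultimately show ?thesis by (rule_tac fmeasurableI2[of "{-1..1}"]) simp_all
qed

lemma symmetrization_even: "symmetrization u (- x) = symmetrization u x"
proof -
  have "(- x \<in> symmetrized_set E) = (x \<in> symmetrized_set E)" for E
    by (auto simp: symmetrized_set_def)
  thus ?thesis unfolding symmetrization_def indicator_def by simp
qed

text \<open>The levels that count towards \<open>symmetrization u x\<close> form an initial segment of the half-line, and
  its length is the threshold between the levels with large and with small superlevel sets.\<close>

lemma symmetrization_threshold:
  fixes u :: "real \<Rightarrow> real"
  assumes c: "continuous_on {-1..1} u"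
  defines "T \<equiv> \<lambda>x t. superlevel_set u t \<noteq> {} \<and> 2 * \<bar>x\<bar> \<le> measure lebesgue (superlevel_set u t)"
  shows "0 \<le> symmetrization u x" 
    and "0 \<le> t \<Longrightarrow> t < symmetrization u x \<Longrightarrow> T x t"
    and "symmetrization u x < t \<Longrightarrow> \<not> T x t"
proof -
  let ?T = "{t. 0 \<le> t \<and> T x t}"
  have "\<exists>m\<in>{-1..1}. \<forall>y\<in>{-1..1}. u y \<le> u m"
    using c by (intro continuous_attains_sup) auto
  then obtain M where M: "\<And>y. y \<in> {-1..1} \<Longrightarrow> u y \<le> M" by blast
  have bnd: "t < M" if "T x t" for t using that M by (force simp: T_def superlevel_set_def)
  have down: "T x s" if "T x t" "s \<le> t" for s t
  proof -
    have "superlevel_set u t \<subseteq> superlevel_set u s" using that by (auto simp: superlevel_set_def)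
    thus ?thesis using that(1) measure_mono_fmeasurable[of "superlevel_set u t" "superlevel_set u s" lebesgue]
      superlevel_set_lmeasurable[OF c] unfolding T_def by fastforce
  qed
  have "symmetrization u x = (\<integral>t. indicat_real ?T t \<partial>lborel)"
    unfolding symmetrization_def set_lebesgue_integral_def
    by (intro Bochner_Integration.integral_cong)
       (auto simp: symmetrized_set_def T_def indicator_def abs_le_iff)
  hence eq: "symmetrization u x = measure lborel ?T" by simp
  have *: "0 \<le> symmetrization u x \<and> (\<forall>t\<ge>0. (t < symmetrization u x \<longrightarrow> T x t) \<and> (symmetrization u x < t \<longrightarrow> \<not> T x t))"
  proof (cases "?T = {}")
    case True
    hence "symmetrization u x = 0" unfolding eq True by simp
    thus ?thesis using True by auto
  next
    case False
    define \<tau> where "\<tau> = Sup ?T"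
    have bdd: "bdd_above ?T" using bnd by (auto intro!: bdd_aboveI[where M = M] less_imp_le)
    have above: "t \<le> \<tau>" if "t \<in> ?T" for t unfolding \<tau>_def using that bdd by (rule cSup_upper)
    have below: "T x t" if t: "t < \<tau>" for t
    proof -
      obtain s where "s \<in> ?T" "t < s" using t less_cSup_iff[OF False bdd] unfolding \<tau>_def by blast
      thus ?thesis using down[of s t] by auto
    qed
    have \<tau>0: "\<tau> \<ge> 0" using False above by force
    have "?T = {0..<\<tau>} \<or> ?T = {0..\<tau>}"
    proof (cases "T x \<tau>")
      case True
      have "t \<in> ?T \<longleftrightarrow> t \<in> {0..\<tau>}" for t
        using above[of t] below[of t] True \<tau>0 by (cases "t = \<tau>") auto
      thus ?thesis by blast
    next
      case False
      have "t \<in> ?T \<longleftrightarrow> t \<in> {0..<\<tau>}" for t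
        using above[of t] below[of t] False \<tau>0 by (cases "t = \<tau>") auto
      thus ?thesis by blast
    qed
    hence "measure lborel ?T = \<tau>" using \<tau>0 by (elim disjE) simp_all
    hence v: "symmetrization u x = \<tau>" unfolding eq .
    have "\<not> T x t" if "0 \<le> t" "\<tau> < t" for t using above[of t] that by auto
    thus ?thesis unfolding v using \<tau>0 below by blast
  qed
  show "0 \<le> symmetrization u x" using * by blast
  show "0 \<le> t \<Longrightarrow> t < symmetrization u x \<Longrightarrow> T x t" using * by blast
  assume t: "symmetrization u x < t"
  hence "0 \<le> t" using * by linarith
  thus "\<not> T x t" using * t by blast
qed

lemma symmetrization_antimono:
  assumes c: "continuous_on {-1..1} u" and "0 \<le> x" "x \<le> y"
  shows "symmetrization u y \<le> symmetrization u x"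
proof (rule ccontr)
  assume "\<not> ?thesis"
  then obtain t where t: "symmetrization u x < t" "t < symmetrization u y" using dense by (metis not_le)
  hence "0 \<le> t" using symmetrization_threshold(1)[OF c, of x] by linarith
  from symmetrization_threshold(2)[OF c this t(2)] symmetrization_threshold(3)[OF c t(1)]
  show False using assms by auto
qed

lemma symmetrization_le_attained:
  assumes c: "continuous_on {-1..1} u" and nonneg: "\<And>y. y \<in> {-1..1} \<Longrightarrow> u y \<ge> 0"
  shows "\<exists>y\<in>{-1..1}. symmetrization u x \<le> u y"
proof (rule ccontr)
  assume n: "\<not> ?thesis"
  obtain m where m: "m \<in> {-1..1}" "\<And>y. y \<in> {-1..1} \<Longrightarrow> u y \<le> u m"
    using continuous_attains_sup[of "{-1..1}" u] c by auto
  hence "u m < symmetrization u x" "0 \<le> u m" using n nonneg by (auto simp: not_le)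
  from symmetrization_threshold(2)[OF c this(2,1)] obtain y where "y \<in> {-1..1}" "u m < u y"
    by (auto simp: superlevel_set_def)
  thus False using m(2)[of y] by simp
qed

lemma measure_superlevel_symmetrization_le:
  assumes c: "continuous_on {-1..1} u" and x: "0 \<le> x"
  shows "measure lebesgue (superlevel_set u (symmetrization u x)) \<le> 2 * x"
proof -
  let ?v = "symmetrization u x"
  define S where "S = (\<lambda>n::nat. superlevel_set u (?v + 1 / real (Suc n)))"
  have "superlevel_set u ?v = (\<Union>n. S n)"
  proof
    show "superlevel_set u ?v \<subseteq> (\<Union>n. S n)"
    proof
      fix y assume y: "y \<in> superlevel_set u ?v"
      hence "0 < u y - ?v" by (simp add: superlevel_set_def)
      then obtain n where "1 / real (Suc n) < u y - ?v" using nat_approx_posE by blast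
      hence "y \<in> S n" using y by (simp add: S_def superlevel_set_def)
      thus "y \<in> (\<Union>n. S n)" by blast
    qed
  next
    show "(\<Union>n. S n) \<subseteq> superlevel_set u ?v"
    proof
      fix y assume "y \<in> (\<Union>n. S n)"
      then obtain n where "y \<in> {-1..1}" "?v + 1 / real (Suc n) < u y" by (auto simp: S_def superlevel_set_def)
      moreover have "1 / real (Suc n) > 0" by simp
      ultimately show "y \<in> superlevel_set u ?v" unfolding superlevel_set_def mem_Collect_eq by linarith
    qed
  qed
  also have "measure lebesgue \<dots> \<le> 2 * x"
  proof (rule measure_countable_Union_le)
    show "S n \<in> lmeasurable" for n unfolding S_def by (rule superlevel_set_lmeasurable[OF c])
    fix n
    have "S i \<subseteq> S n" if "i \<le> n" for i
    proof -
      have "1 / real (Suc n) \<le> 1 / real (Suc i)" using that by (intro divide_left_mono) auto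
      thus ?thesis by (auto simp: S_def superlevel_set_def)
    qed
    hence "(\<Union>i\<le>n. S i) = S n" by blast
    moreover have "?v < ?v + 1 / real (Suc n)" by simp
    from symmetrization_threshold(3)[OF c this] have "measure lebesgue (S n) \<le> 2 * x"
      using x unfolding S_def by auto
    ultimately show "measure lebesgue (\<Union>i\<le>n. S i) \<le> 2 * x" by simp
  qed
  finally show ?thesis .
qed

lemma measure_superlevel_symmetrization_ge:
  assumes c: "continuous_on {-1..1} u" and nonneg: "\<And>y. y \<in> {-1..1} \<Longrightarrow> u y \<ge> 0" and x: "0 \<le> x" "x \<le> 1"
  shows "2 * x \<le> measure lebesgue {y \<in> {-1..1}. symmetrization u x \<le> u y}"
proof (cases "symmetrization u x = 0")
  case True
  hence "{y \<in> {-1..1}. symmetrization u x \<le> u y} = {-1..1}" using nonneg by auto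
  thus ?thesis using x by simp
next
  case False
  let ?v = "symmetrization u x"
  have v: "?v > 0" using False symmetrization_threshold(1)[OF c, of x] by simp
  define S where "S = (\<lambda>n::nat. superlevel_set u (?v - ?v / real (Suc n)))"
  have "{y \<in> {-1..1}. ?v \<le> u y} = (\<Inter>n. S n)"
  proof
    show "{y \<in> {-1..1}. ?v \<le> u y} \<subseteq> (\<Inter>n. S n)"
    proof safe
      fix y n assume "y \<in> {-1..1}" "?v \<le> u y"
      moreover have "?v / real (Suc n) > 0" using v by simp
      ultimately show "y \<in> S n" unfolding S_def superlevel_set_def mem_Collect_eq by linarith
    qed
  next
    show "(\<Inter>n. S n) \<subseteq> {y \<in> {-1..1}. ?v \<le> u y}"
    proof
      fix y assume y: "y \<in> (\<Inter>n. S n)"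
      have "?v \<le> u y"
      proof (rule ccontr)
        assume "\<not> ?v \<le> u y"
        hence "0 < (?v - u y) / ?v" using v by simp
        then obtain n where "1 / real (Suc n) < (?v - u y) / ?v" using nat_approx_posE by blast
        hence "?v / real (Suc n) < ?v - u y" using v by (simp add: field_simps)
        moreover have "y \<in> S n" using y by blast
        ultimately show False by (simp add: S_def superlevel_set_def)
      qed
      moreover have "y \<in> S 0" using y by blast
      ultimately show "y \<in> {y \<in> {-1..1}. ?v \<le> u y}" by (simp add: S_def superlevel_set_def)
    qed
  qed
  moreover have "(\<lambda>n. measure lebesgue (S n)) \<longlonglongrightarrow> measure lebesgue (\<Inter>n. S n)"
  proof (rule Lim_measure_decseq)
    have Sm: "S n \<in> lmeasurable" for n unfolding S_def by (rule superlevel_set_lmeasurable[OF c])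
    show "range S \<subseteq> sets lebesgue" using Sm by (auto dest: fmeasurableD)
    show "emeasure lebesgue (S n) \<noteq> \<infinity>" for n using fmeasurableD2[OF Sm[of n]] by simp
    show "decseq S"
    proof (rule decseq_SucI)
      fix n
      have "?v / real (Suc (Suc n)) \<le> ?v / real (Suc n)" using v by (intro divide_left_mono) auto
      thus "S (Suc n) \<subseteq> S n" by (auto simp: S_def superlevel_set_def)
    qed
  qed
  moreover have "2 * x \<le> measure lebesgue (S n)" for n
  proof -
    have "?v - ?v / real (Suc n) \<ge> 0" "?v - ?v / real (Suc n) < ?v" using v by (auto simp: field_simps)
    from symmetrization_threshold(2)[OF c this] show ?thesis using x by (simp add: S_def)
  qed
  ultimately show ?thesis by (metis LIMSEQ_le_const)
qed

text \<open>With \<open>f z - f y = g z * (z - y)\<close>, the quotient is an average of \<open>g (a n)\<close> and \<open>g (b n)\<close>.\<close>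

lemma straddling_difference_quotient:
  fixes f :: "real \<Rightarrow> real"
  assumes f: "(f has_real_derivative d) (at y)"
    and ab: "a \<longlonglongrightarrow> y" "b \<longlonglongrightarrow> y" "\<And>n. a n \<le> y" "\<And>n. y \<le> b n" "\<And>n. a n < b n"
  shows "(\<lambda>n. (f (b n) - f (a n)) / (b n - a n)) \<longlonglongrightarrow> d"
proof -
  obtain g where g: "\<And>z. f z - f y = g z * (z - y)" "isCont g y" "g y = d"
    using f unfolding CARAT_DERIV by blast
  have "(\<lambda>n. \<bar>g (b n) - d\<bar> + \<bar>g (a n) - d\<bar>) \<longlonglongrightarrow> \<bar>g y - d\<bar> + \<bar>g y - d\<bar>"
    by (intro tendsto_add tendsto_rabs tendsto_diff tendsto_const isCont_tendsto_compose[OF g(2) ab(1)]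
        isCont_tendsto_compose[OF g(2) ab(2)])
  hence lim: "(\<lambda>n. \<bar>g (b n) - d\<bar> + \<bar>g (a n) - d\<bar>) \<longlonglongrightarrow> 0" using g(3) by simp
  have "norm ((f (b n) - f (a n)) / (b n - a n) - d) \<le> \<bar>g (b n) - d\<bar> + \<bar>g (a n) - d\<bar>" for n
  proof -
    have p: "b n - a n > 0" using ab(5)[of n] by simp
    have "f (b n) - f (a n) - d * (b n - a n) = (g (b n) - d) * (b n - y) + (g (a n) - d) * (y - a n)"
    proof -
      have "f (b n) = f y + g (b n) * (b n - y)" "f (a n) = f y + g (a n) * (a n - y)"
        using g(1)[of "b n"] g(1)[of "a n"] by linarith+
      thus ?thesis by (simp add: algebra_simps)
    qed
    hence "\<bar>f (b n) - f (a n) - d * (b n - a n)\<bar> \<le> \<bar>g (b n) - d\<bar> * (b n - y) + \<bar>g (a n) - d\<bar> * (y - a n)"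
      using ab(3,4)[of n] abs_triangle_ineq[of "(g (b n) - d) * (b n - y)" "(g (a n) - d) * (y - a n)"]
      by (simp add: abs_mult)
    also have "\<dots> \<le> \<bar>g (b n) - d\<bar> * (b n - a n) + \<bar>g (a n) - d\<bar> * (b n - a n)"
      using ab(3,4)[of n] by (intro add_mono mult_left_mono) auto
    finally have "\<bar>f (b n) - f (a n) - d * (b n - a n)\<bar> / (b n - a n) \<le> \<bar>g (b n) - d\<bar> + \<bar>g (a n) - d\<bar>"
      using p by (simp add: pos_divide_le_eq algebra_simps)
    moreover have "(f (b n) - f (a n)) / (b n - a n) - d = (f (b n) - f (a n) - d * (b n - a n)) / (b n - a n)"
      using p by (simp add: field_simps)
    ultimately show ?thesis using p by (simp add: abs_divide)
  qed
  hence "(\<lambda>n. (f (b n) - f (a n)) / (b n - a n) - d) \<longlonglongrightarrow> 0"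
    by (intro Lim_null_comparison[OF always_eventually lim] allI)
  thus ?thesis by (simp add: LIM_zero_iff)
qed

section \<open>Discretization and passage to the limit\<close>

lemma var_exp_functional_alt:
  "var_exp_functional p u = (\<integral>\<^sup>+x\<in>{-1..1}. ennreal (slope_energy (p x) \<bar>deriv u x\<bar>) \<partial>lebesgue)"
  unfolding var_exp_functional_def slope_energy_def by (subst nn_integral_restrict_space) auto

text \<open>The points strictly inside a band of levels have measure at most \<open>2 / n\<close>, even if \<open>u\<close> is constant on
  larger sets: such plateaus lie on the levels \<open>v (k / n)\<close> that separate the bands. Only the energy in
  excess of \<open>1\<close> is localized to the bands, so that plateaus need no separate treatment.\<close>

lemma discrete_energy_le:
  fixes u p v :: "real \<Rightarrow> real" and n :: nat
  assumes u: "u \<in> W11_0" and nonneg: "\<And>y. y \<in> {-1..1} \<Longrightarrow> u y \<ge> 0"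
    and p: "continuous_on {-1..1} p" "\<And>x. x \<in> {-1..1} \<Longrightarrow> p x \<ge> 1"
    and p_mono: "\<And>x y. \<bar>x\<bar> \<le> \<bar>y\<bar> \<Longrightarrow> y \<in> {-1..1} \<Longrightarrow> p x \<le> p y"
    and cost: "\<And>s1 s2 x1 x2. s1 > 0 \<Longrightarrow> s2 > 0 \<Longrightarrow> x1 \<in> {-1..1} \<Longrightarrow> x2 \<in> {-1..1} \<Longrightarrow>
        2 * crossing_cost (p ((x1 + x2) / 2)) ((s1 + s2) / 2) \<le> crossing_cost (p x1) s1 + crossing_cost (p x2) s2"
    and n: "n > 0"
  defines "v \<equiv> symmetrization u"
  shows "(\<Sum>k<n. ennreal (2 / n * slope_energy (p (k / n)) (n * (v (k / n) - v (real (Suc k) / n)))))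
      \<le> var_exp_functional p u"
proof -
  let ?f = "\<lambda>y. ennreal (slope_energy (p y) \<bar>deriv u y\<bar> - 1)"
  have ac: "abs_continuous_on_interval (-1) 1 u" and u0: "u (-1) = 0" "u 1 = 0"
    and int: "integrable (lebesgue_on {-1..1}) (deriv u)" using u by (auto simp: W11_0_def)
  have c: "continuous_on {-1..1} u" by (rule abs_continuous_imp_continuous_on[OF ac])
  have abs_int: "deriv u absolutely_integrable_on {-1..1}"
    using int by (simp add: set_integrable_def integrable_restrict_space)
  have [measurable]: "p \<in> borel_measurable (lebesgue_on {-1..1})"
    by (rule continuous_imp_measurable_on_sets_lebesgue[OF p(1)]) simp
  have [measurable]: "deriv u \<in> borel_measurable (lebesgue_on {-1..1})"
    using int by (rule borel_measurable_integrable)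
  have "?f \<in> borel_measurable (lebesgue_on {-1..1})" unfolding slope_energy_def by measurable
  hence meas: "(\<lambda>x. ?f x * indicator {-1..1} x) \<in> borel_measurable lebesgue"
    by (subst (asm) borel_measurable_restrict_space_iff_ennreal) auto
  have v0: "v x \<ge> 0" for x unfolding v_def by (rule symmetrization_threshold(1)[OF c])
  have v_mono: "v y \<le> v x" if "0 \<le> x" "x \<le> y" for x y
    unfolding v_def by (rule symmetrization_antimono[OF c that])
  define t where "t = (\<lambda>k. v (real k / n))"
  define E where "E = (\<lambda>k. {y \<in> {-1..1}. t (Suc k) < u y \<and> u y < t k})"
  define e where "e = (\<lambda>k. slope_energy (p (k / n)) (n * (t k - t (Suc k))))"
  have t_mono: "t j \<le> t k" if "k \<le> j" for j k
    unfolding t_def using that n by (intro v_mono) (auto intro!: divide_right_mono)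
  have pk: "p (k / n) \<ge> 1" if "k < n" for k
  proof -
    have "0 \<le> real k / n" "real k / n \<le> 1" using that by (auto simp: divide_le_eq)
    hence "real k / n \<in> {-1..1}" unfolding atLeastAtMost_iff by linarith
    thus ?thesis by (rule p(2))
  qed
  have e1: "e k \<ge> 1" if "k < n" for k
    unfolding e_def using pk[OF that] by (intro slope_energy_ge_1) auto
  have E_sets: "E k \<in> sets borel" for k
  proof -
    have "E k = {-1..1} - {y \<in> {-1..1}. t k \<le> u y} - {y \<in> {-1..1}. u y \<le> t (Suc k)}" by (auto simp: E_def)
    also have "\<dots> \<in> sets borel" by (intro sets.Diff borel_closed closed_superlevel c closed_atLeastAtMost)
    finally show ?thesis .
  qed
  have branch: "ennreal (2 / n * (e k - 1)) \<le> (\<integral>\<^sup>+y\<in>E k. ?f y \<partial>lebesgue)" if k: "k < n" for k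
  proof (cases "t (Suc k) < t k")
    case False
    hence "t k - t (Suc k) = 0" using t_mono[of k "Suc k"] by simp
    thus ?thesis by (simp add: e_def)
  next
    case True
    have "real (Suc k) / n \<le> 1" using k by (simp add: divide_le_eq)
    have "measure lebesgue (E k) \<le> 2 * (1 / n)"
    proof -
      let ?A = "{y \<in> {-1..1}. t k \<le> u y}" and ?B = "superlevel_set u (t (Suc k))"
      have A: "?A \<in> lmeasurable"
        by (rule fmeasurableI2[of "{-1..1}"]) (use closed_superlevel(1)[OF c] in auto)
      have "2 * (real k / n) \<le> measure lebesgue ?A" unfolding t_def v_def
        using k by (intro measure_superlevel_symmetrization_ge[OF c nonneg]) (auto simp: divide_le_eq)
      moreover have "measure lebesgue ?B \<le> 2 * (real (Suc k) / n)" unfolding t_def v_def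
        by (intro measure_superlevel_symmetrization_le[OF c]) auto
      moreover have "measure lebesgue (E k) + measure lebesgue ?A = measure lebesgue (E k \<union> ?A)"
      proof -
        have Ek: "E k \<in> lmeasurable"
          by (rule fmeasurableI2[of "{-1..1}"]) (use E_sets[of k] in \<open>auto simp: E_def\<close>)
        have "E k \<inter> ?A = {}" by (auto simp: E_def)
        thus ?thesis using measure_Un3[OF Ek A] by simp
      qed
      moreover have "measure lebesgue (E k \<union> ?A) \<le> measure lebesgue ?B"
      proof (rule measure_mono_fmeasurable)
        show "E k \<union> ?A \<subseteq> ?B" using True by (auto simp: E_def superlevel_set_def)
        show "E k \<union> ?A \<in> sets lebesgue" using E_sets[of k] A by (intro sets.Un) auto
        show "?B \<in> lmeasurable" by (rule superlevel_set_lmeasurable[OF c])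
      qed
      moreover have "2 * (real (Suc k) / n) = 2 * (real k / n) + 2 * (1 / n)" by (simp add: add_divide_distrib)
      ultimately show ?thesis by linarith
    qed
    moreover have "2 * (real k / n) \<le> measure lebesgue {y \<in> {-1..1}. t k \<le> u y}" unfolding t_def v_def
      using k by (intro measure_superlevel_symmetrization_ge[OF c nonneg]) (auto simp: divide_le_eq)
    moreover have "\<exists>y\<in>{-1..1}. t k \<le> u y"
      unfolding t_def v_def by (rule symmetrization_le_attained[OF c nonneg])
    moreover have "0 \<le> t (Suc k)" "0 \<le> real k / n" "0 < 1 / real n" using v0 n by (auto simp: t_def)
    ultimately have "ennreal (2 * (1 / n) * (slope_energy (p (k / n)) ((t k - t (Suc k)) / (1 / n)) - 1)) \<le>
      (\<integral>\<^sup>+y\<in>E k. ?f y \<partial>lebesgue)"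
      unfolding E_def using True
      by (intro two_branch_estimate[OF ac abs_int u0 p p_mono cost meas])
    thus ?thesis by (simp add: e_def mult.commute)
  qed
  have "(\<Sum>k<n. ennreal (2 / n * (e k - 1))) \<le> (\<Sum>k<n. \<integral>\<^sup>+y\<in>E k. ?f y \<partial>lebesgue)"
    by (intro sum_mono branch) simp
  also have "\<dots> = (\<integral>\<^sup>+y. (\<Sum>k<n. ?f y * indicator (E k) y) \<partial>lebesgue)"
  proof (rule nn_integral_sum[symmetric])
    fix k
    have "(\<lambda>x. ?f x * indicator {-1..1} x * indicator (E k) x) \<in> borel_measurable lebesgue"
      using E_sets[of k] by (intro borel_measurable_times_ennreal meas borel_measurable_indicator) simp
    moreover have "?f x * indicator {-1..1} x * indicator (E k) x = ?f x * indicator (E k) x" for x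
      by (auto simp: E_def split: split_indicator)
    ultimately show "(\<lambda>y. ?f y * indicator (E k) y) \<in> borel_measurable lebesgue" by simp
  qed
  also have "\<dots> \<le> (\<integral>\<^sup>+y\<in>{-1..1}. ?f y \<partial>lebesgue)"
  proof (rule nn_integral_mono)
    fix y
    show "(\<Sum>k<n. ?f y * indicator (E k) y) \<le> ?f y * indicator {-1..1} y"
    proof (cases "\<exists>k<n. y \<in> E k")
      case True
      then obtain k where k: "k < n" "y \<in> E k" by blast
      have "y \<notin> E j" if "j \<noteq> k" for j
      proof -
        have "t k \<le> t (Suc j) \<or> t j \<le> t (Suc k)"
          using that t_mono[of "Suc j" k] t_mono[of "Suc k" j] by linarith
        thus ?thesis using k(2) by (auto simp: E_def)
      qed
      hence "(\<Sum>k<n. ?f y * indicator (E k) y) = (\<Sum>k\<in>{k}. ?f y * indicator (E k) y)"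
        using k by (intro sum.mono_neutral_right) auto
      also have "\<dots> \<le> ?f y * indicator {-1..1} y" using k(2) by (auto simp: E_def)
      finally show ?thesis .
    next
      case False
      hence "(\<Sum>k<n. ?f y * indicator (E k) y) = 0" by (intro sum.neutral) auto
      thus ?thesis by (simp only: zero_le)
    qed
  qed
  finally have main: "(\<Sum>k<n. ennreal (2 / n * (e k - 1))) \<le> (\<integral>\<^sup>+y\<in>{-1..1}. ?f y \<partial>lebesgue)" .
  have "(\<Sum>k<n. ennreal (2 / n * e k)) = (\<Sum>k<n. ennreal (2 / n * (e k - 1)) + ennreal (2 / n))"
  proof (rule sum.cong)
    fix k assume "k \<in> {..<n}"
    hence "e k \<ge> 1" using e1 by simp
    hence "ennreal (2 / n * (e k - 1)) + ennreal (2 / n) = ennreal (2 / n * (e k - 1) + 2 / n)"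
      by (intro ennreal_plus[symmetric]) auto
    moreover have "2 / n * (e k - 1) + 2 / n = 2 / n * e k" by (simp add: diff_divide_distrib right_diff_distrib)
    ultimately show "ennreal (2 / n * e k) = ennreal (2 / n * (e k - 1)) + ennreal (2 / n)" by simp
  qed simp
  also have "\<dots> = (\<Sum>k<n. ennreal (2 / n * (e k - 1))) + ennreal (\<Sum>k<n. 2 / n)"
    by (simp add: sum.distrib sum_ennreal del: sum_constant)
  also have "(\<Sum>k<n. 2 / real n) = 2" using n by simp
  also have "(\<Sum>k<n. ennreal (2 / n * (e k - 1))) + ennreal 2 \<le> (\<integral>\<^sup>+y\<in>{-1..1}. ?f y \<partial>lebesgue) + ennreal 2"
    by (intro add_right_mono main)
  also have "ennreal 2 = (\<integral>\<^sup>+y. indicator {-1..1::real} y \<partial>lebesgue)" by simp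
  also have "(\<integral>\<^sup>+y\<in>{-1..1}. ?f y \<partial>lebesgue) + \<dots> = (\<integral>\<^sup>+y. ?f y * indicator {-1..1} y + indicator {-1..1} y \<partial>lebesgue)"
    by (intro nn_integral_add[symmetric] meas borel_measurable_indicator) simp
  also have "\<dots> = var_exp_functional p u"
    unfolding var_exp_functional_alt
  proof (rule nn_integral_cong)
    fix y
    show "?f y * indicator {-1..1} y + indicator {-1..1} y = ennreal (slope_energy (p y) \<bar>deriv u y\<bar>) * indicator {-1..1} y"
    proof (cases "y \<in> {-1..1}")
      case True
      hence "slope_energy (p y) \<bar>deriv u y\<bar> \<ge> 1" using p(2)[OF True] by (intro slope_energy_ge_1) auto
      hence "?f y + ennreal 1 = ennreal (slope_energy (p y) \<bar>deriv u y\<bar> - 1 + 1)"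
        by (intro ennreal_plus[symmetric]) auto
      thus ?thesis using True by simp
    qed simp
  qed
  finally show ?thesis unfolding e_def t_def .
qed

text \<open>The symmetrization is monotone on each half of the interval, and evenness carries a derivative at
  a negative \<open>x\<close> over to \<open>\<bar>x\<bar>\<close>.\<close>

lemma symmetrization_differentiable_ae:
  assumes c: "continuous_on {-1..1} u"
  shows "AE x in lebesgue. x \<in> {-1..1} \<longrightarrow> x \<noteq> 0 \<and> \<bar>x\<bar> < 1 \<and>
     (\<exists>d. (symmetrization u has_real_derivative d) (at \<bar>x\<bar>) \<and> \<bar>d\<bar> = \<bar>deriv (symmetrization u) x\<bar>)"
proof -
  let ?v = "symmetrization u"
  have even: "?v (- x) = ?v x" for x by (rule symmetrization_even)
  have "mono_on {0..1} (\<lambda>x. - ?v x)" 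
    using symmetrization_antimono[OF c] by (intro mono_onI) auto
  from mono_on_differentiable_ae[OF this] 
  have "negligible {x \<in> {0<..<1}. \<not> (\<exists>D. ((\<lambda>x. - ?v x) has_real_derivative D) (at x))}" (is "negligible ?P") .
  moreover have "mono_on {-1..0} ?v"
  proof (rule mono_onI)
    fix x y :: real assume "x \<in> {-1..0}" "y \<in> {-1..0}" "x \<le> y"
    thus "?v x \<le> ?v y" using symmetrization_antimono[OF c, of "- y" "- x"] by (simp add: even)
  qed
  from mono_on_differentiable_ae[OF this] 
  have "negligible {x \<in> {-1<..<0}. \<not> (\<exists>D. (?v has_real_derivative D) (at x))}" (is "negligible ?N") .
  ultimately have "negligible (?P \<union> ?N \<union> {-1, 0, 1})" by (intro negligible_Un) auto
  hence null: "?P \<union> ?N \<union> {-1, 0, 1} \<in> null_sets lebesgue" by (simp add: negligible_iff_null_sets)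
  have "\<bar>x\<bar> < 1 \<and> (\<exists>d. (?v has_real_derivative d) (at \<bar>x\<bar>) \<and> \<bar>d\<bar> = \<bar>deriv ?v x\<bar>)"
    if x: "x \<in> {-1..1}" "x \<notin> ?P \<union> ?N \<union> {-1, 0, 1}" for x
  proof (cases "x > 0")
    case True
    hence x1: "x \<in> {0<..<1}" using x by auto
    then obtain D where "((\<lambda>x. - ?v x) has_real_derivative D) (at x)" using x by blast
    from DERIV_minus[OF this] have D: "(?v has_real_derivative - D) (at x)" by simp
    thus ?thesis using x1 DERIV_imp_deriv[OF D] by (intro conjI exI[of _ "- D"]) auto
  next
    case False
    hence x1: "x \<in> {-1<..<0}" using x by auto
    then obtain D where D: "(?v has_real_derivative D) (at x)" using x by blast
    have "(?v has_real_derivative D) (at (- (- x)))" using D by simp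
    hence "((\<lambda>x. ?v (- x)) has_real_derivative - D) (at (- x))" unfolding DERIV_mirror .
    hence "(?v has_real_derivative - D) (at (- x))" unfolding even .
    thus ?thesis using x1 DERIV_imp_deriv[OF D] by (intro conjI exI[of _ "- D"]) auto
  qed
  thus ?thesis by (intro AE_I'[OF null]) auto
qed

lemma emeasure_symmetric_shell_le:
  assumes "0 \<le> a" "a \<le> b"
  shows "emeasure lebesgue {x::real. a \<le> \<bar>x\<bar> \<and> \<bar>x\<bar> < b} \<le> ennreal (2 * (b - a))"
proof -
  have "{x::real. a \<le> \<bar>x\<bar> \<and> \<bar>x\<bar> < b} \<subseteq> {a..b} \<union> {-b..-a}" by auto
  hence "emeasure lebesgue {x::real. a \<le> \<bar>x\<bar> \<and> \<bar>x\<bar> < b} \<le> emeasure lebesgue ({a..b} \<union> {-b..-a})"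
    by (intro emeasure_mono) auto
  also have "\<dots> \<le> emeasure lebesgue {a..b} + emeasure lebesgue {-b..-a}" by (intro emeasure_subadditive) auto
  also have "\<dots> = ennreal (b - a) + ennreal (b - a)" using assms by simp
  also have "\<dots> = ennreal (2 * (b - a))" using assms by (subst ennreal_plus[symmetric]) auto
  finally show ?thesis .
qed

lemma slope_energy_tendsto:
  assumes "(f \<longlongrightarrow> p) F" "(g \<longlongrightarrow> s) F"
  shows "((\<lambda>x. slope_energy (f x) (g x)) \<longlongrightarrow> slope_energy p s) F"
proof -
  have "1 + s\<^sup>2 > 0" by (auto intro: add_pos_nonneg)
  thus ?thesis unfolding slope_energy_def by (intro tendsto_intros assms) auto
qed

text \<open>The exponents at \<open>k / n\<close> and the slopes over \<open>{k / n..(k + 1) / n}\<close> form a step function \<open>\<phi> n\<close> of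
  \<open>\<bar>x\<bar>\<close> that converges almost everywhere to the density of \<open>u\<^sup>*\<close>.\<close>

theorem polya_szego_variable_exponent:
  fixes u p :: "real \<Rightarrow> real"
  assumes u: "u \<in> W11_0" and nonneg: "\<And>y. y \<in> {-1..1} \<Longrightarrow> u y \<ge> 0"
    and p: "continuous_on {-1..1} p" "\<And>x. x \<in> {-1..1} \<Longrightarrow> p x \<ge> 1"
    and p_mono: "\<And>x y. \<bar>x\<bar> \<le> \<bar>y\<bar> \<Longrightarrow> y \<in> {-1..1} \<Longrightarrow> p x \<le> p y"
    and cost: "\<And>s1 s2 x1 x2. s1 > 0 \<Longrightarrow> s2 > 0 \<Longrightarrow> x1 \<in> {-1..1} \<Longrightarrow> x2 \<in> {-1..1} \<Longrightarrow>
        2 * crossing_cost (p ((x1 + x2) / 2)) ((s1 + s2) / 2) \<le> crossing_cost (p x1) s1 + crossing_cost (p x2) s2"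
  shows "var_exp_functional p (symmetrization u) \<le> var_exp_functional p u"
proof -
  define v where "v = symmetrization u"
  have "abs_continuous_on_interval (-1) 1 u" using u by (simp add: W11_0_def)
  hence c: "continuous_on {-1..1} u" by (rule abs_continuous_imp_continuous_on)
  define e where "e = (\<lambda>n k. slope_energy (p (real k / real n)) (real n * (v (real k / n) - v (real (Suc k) / n))))"
  define shell where "shell = (\<lambda>n k. {x::real. real k / real n \<le> \<bar>x\<bar> \<and> \<bar>x\<bar> < real (Suc k) / n})"
  define \<phi> where "\<phi> = (\<lambda>n x. \<Sum>k<n. ennreal (e n k) * indicator (shell n k) x)"
  have shell_sets: "shell n k \<in> sets lebesgue" for n k
  proof -
    have "shell n k \<in> sets borel" unfolding shell_def by measurable
    thus ?thesis by simp
  qed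
  have \<phi>_le: "(\<integral>\<^sup>+x. \<phi> n x \<partial>lebesgue) \<le> var_exp_functional p u" if n: "n > 0" for n
  proof -
    have "(\<integral>\<^sup>+x. \<phi> n x \<partial>lebesgue) = (\<Sum>k<n. \<integral>\<^sup>+x. ennreal (e n k) * indicator (shell n k) x \<partial>lebesgue)"
      unfolding \<phi>_def using shell_sets by (intro nn_integral_sum) auto
    also have "\<dots> = (\<Sum>k<n. ennreal (e n k) * emeasure lebesgue (shell n k))"
      using shell_sets by (intro sum.cong nn_integral_cmult_indicator) auto
    also have "\<dots> \<le> (\<Sum>k<n. ennreal (2 / n * e n k))"
    proof (rule sum_mono)
      fix k assume "k \<in> {..<n}"
      have "emeasure lebesgue (shell n k) \<le> ennreal (2 * (real (Suc k) / n - real k / n))"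
        unfolding shell_def using n by (intro emeasure_symmetric_shell_le) (auto intro!: divide_right_mono)
      also have "real (Suc k) / n - real k / n = 1 / n" using n by (simp add: field_simps)
      finally have "ennreal (e n k) * emeasure lebesgue (shell n k) \<le> ennreal (e n k) * ennreal (2 * (1 / n))"
        by (intro mult_left_mono) auto
      also have "\<dots> = ennreal (2 / n * e n k)"
        by (subst ennreal_mult'[symmetric]) (auto simp: e_def slope_energy_def mult.commute)
      finally show "ennreal (e n k) * emeasure lebesgue (shell n k) \<le> ennreal (2 / n * e n k)" .
    qed
    also have "\<dots> \<le> var_exp_functional p u"
      unfolding e_def v_def by (rule discrete_energy_le[OF u nonneg p p_mono cost n])
    finally show ?thesis .
  qed
  have lim: "(\<lambda>n. \<phi> (Suc n) x) \<longlonglongrightarrow> ennreal (slope_energy (p x) \<bar>deriv v x\<bar>)"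
    if x: "x \<noteq> 0" "\<bar>x\<bar> < 1" and d: "(v has_real_derivative d) (at \<bar>x\<bar>)" "\<bar>d\<bar> = \<bar>deriv v x\<bar>" for x d
  proof -
    define y where "y = \<bar>x\<bar>"
    have y: "0 < y" "y < 1" using x by (auto simp: y_def)
    define k where "k = (\<lambda>n. nat \<lfloor>real (Suc n) * y\<rfloor>)"
    have k: "real (k n) \<le> real (Suc n) * y" "real (Suc n) * y < real (Suc (k n))" for n
    proof -
      have "0 \<le> real (Suc n) * y" using y by simp
      hence "real (k n) = of_int \<lfloor>real (Suc n) * y\<rfloor>" by (simp add: k_def)
      thus "real (k n) \<le> real (Suc n) * y" "real (Suc n) * y < real (Suc (k n))"
        by (simp_all add: floor_correct) linarith
    qed
    have kn: "k n < Suc n" for n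
    proof -
      have "real (Suc n) * y < real (Suc n)" using y by simp
      thus ?thesis using k(1)[of n] by linarith
    qed
    define a b where "a = (\<lambda>n. real (k n) / Suc n)" and "b = (\<lambda>n. real (Suc (k n)) / Suc n)"
    have ab: "a n \<le> y" "y < b n" "b n - a n = 1 / Suc n" for n
      using k[of n] by (auto simp: a_def b_def field_simps)
    have inv: "(\<lambda>n. 1 / real (Suc n)) \<longlonglongrightarrow> 0" using LIMSEQ_inverse_real_of_nat by (simp add: inverse_eq_divide)
    have a_lim: "a \<longlonglongrightarrow> y"
    proof (rule tendsto_sandwich[OF _ _ _ tendsto_const])
      show "(\<lambda>n. y - 1 / real (Suc n)) \<longlonglongrightarrow> y" using tendsto_diff[OF tendsto_const inv, of y] by simp
      show "\<forall>\<^sub>F n in sequentially. y - 1 / real (Suc n) \<le> a n"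
        using ab by (intro always_eventually) (smt (verit))
    qed (use ab in auto)
    have b_lim: "b \<longlonglongrightarrow> y"
    proof (rule tendsto_sandwich[OF _ _ tendsto_const])
      show "(\<lambda>n. y + 1 / real (Suc n)) \<longlonglongrightarrow> y" using tendsto_add[OF tendsto_const inv, of y] by simp
      show "\<forall>\<^sub>F n in sequentially. b n \<le> y + 1 / real (Suc n)"
        using ab by (intro always_eventually) (smt (verit))
    qed (use ab in \<open>auto intro!: always_eventually less_imp_le\<close>)
    have "(\<lambda>n. (v (b n) - v (a n)) / (b n - a n)) \<longlonglongrightarrow> d"
    proof (rule straddling_difference_quotient[OF _ a_lim b_lim])
      show "(v has_real_derivative d) (at y)" using d by (simp add: y_def)
      show "a n < b n" "a n \<le> y" "y \<le> b n" for n using ab[of n] by linarith+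
    qed
    hence "(\<lambda>n. - ((v (b n) - v (a n)) / (b n - a n))) \<longlonglongrightarrow> - d" by (rule tendsto_minus)
    hence s_lim: "(\<lambda>n. real (Suc n) * (v (a n) - v (b n))) \<longlonglongrightarrow> - d"
      unfolding ab by (simp add: algebra_simps)
    have "isCont p y" 
    proof -
      have "y \<in> interior {-1..1}" using y by simp
      thus ?thesis using p(1) by (metis continuous_on_interior)
    qed
    hence "(\<lambda>n. p (a n)) \<longlonglongrightarrow> p y" by (rule isCont_tendsto_compose[OF _ a_lim])
    hence "(\<lambda>n. slope_energy (p (a n)) (real (Suc n) * (v (a n) - v (b n)))) \<longlonglongrightarrow> slope_energy (p y) (- d)"
      by (rule slope_energy_tendsto[OF _ s_lim])
    moreover have "slope_energy (p y) (- d) = slope_energy (p x) \<bar>deriv v x\<bar>"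
    proof -
      have "x \<in> {-1..1}" "y \<in> {-1..1}" using x by (auto simp: y_def)
      hence "p y \<le> p x" "p x \<le> p y" by (auto intro!: p_mono simp: y_def)
      hence "p y = p x" by simp
      thus ?thesis unfolding d(2)[symmetric] by (simp add: slope_energy_def)
    qed
    ultimately have "(\<lambda>n. ennreal (e (Suc n) (k n))) \<longlonglongrightarrow> ennreal (slope_energy (p x) \<bar>deriv v x\<bar>)"
      unfolding e_def a_def b_def by (intro tendsto_ennrealI) simp
    moreover have "\<phi> (Suc n) x = ennreal (e (Suc n) (k n))" for n
    proof -
      have "x \<in> shell (Suc n) (k n)" using ab[of n] by (auto simp: shell_def a_def b_def y_def)
      moreover have "x \<notin> shell (Suc n) j" if "j \<noteq> k n" for j
      proof
        assume "x \<in> shell (Suc n) j"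
        hence "real j \<le> real (Suc n) * y" "real (Suc n) * y < real (Suc j)"
          by (auto simp: shell_def y_def field_simps)
        with k[of n] have "real j < real (Suc (k n))" "real (k n) < real (Suc j)" by linarith+
        thus False using that by simp
      qed
      ultimately have "\<phi> (Suc n) x = (\<Sum>j\<in>{k n}. ennreal (e (Suc n) j))"
        unfolding \<phi>_def using kn[of n] by (intro sum.mono_neutral_cong_right) auto
      thus ?thesis by simp
    qed
    ultimately show ?thesis by simp
  qed
  have "var_exp_functional p v \<le> (\<integral>\<^sup>+x. liminf (\<lambda>n. \<phi> (Suc n) x) \<partial>lebesgue)"
    unfolding var_exp_functional_alt
  proof (rule nn_integral_mono_AE)
    show "AE x in lebesgue. ennreal (slope_energy (p x) \<bar>deriv v x\<bar>) * indicator {-1..1} x \<le> liminf (\<lambda>n. \<phi> (Suc n) x)"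
      using symmetrization_differentiable_ae[OF c]
    proof (rule AE_mp, intro AE_I2 impI)
      fix x assume H: "x \<in> {-1..1} \<longrightarrow> x \<noteq> 0 \<and> \<bar>x\<bar> < 1 \<and>
        (\<exists>d. (symmetrization u has_real_derivative d) (at \<bar>x\<bar>) \<and> \<bar>d\<bar> = \<bar>deriv (symmetrization u) x\<bar>)"
      show "ennreal (slope_energy (p x) \<bar>deriv v x\<bar>) * indicator {-1..1} x \<le> liminf (\<lambda>n. \<phi> (Suc n) x)"
      proof (cases "x \<in> {-1..1}")
        case True
        with H obtain d where "x \<noteq> 0" "\<bar>x\<bar> < 1" "(v has_real_derivative d) (at \<bar>x\<bar>)" "\<bar>d\<bar> = \<bar>deriv v x\<bar>"
          unfolding v_def by blast
        from lim_imp_Liminf[OF _ lim[OF this]] show ?thesis using True by simp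
      qed simp
    qed
  qed
  also have "\<dots> \<le> liminf (\<lambda>n. \<integral>\<^sup>+x. \<phi> (Suc n) x \<partial>lebesgue)"
  proof (rule nn_integral_liminf)
    show "\<phi> (Suc n) \<in> borel_measurable lebesgue" for n
      unfolding \<phi>_def
      by (intro borel_measurable_sum borel_measurable_times_ennreal borel_measurable_const
          borel_measurable_indicator shell_sets)
  qed
  also have "\<dots> \<le> var_exp_functional p u"
    by (intro Liminf_le always_eventually allI \<phi>_le) auto
  finally show ?thesis unfolding v_def .
qed

theorem theorem4:
  fixes p :: "real \<Rightarrow> real"
  assumes "continuous_on {-1..1} p"
    and "\<And>x. x \<in> {-1..1} \<Longrightarrow> p (- x) = p x"
    and "\<And>x. x \<in> {-1..1} \<Longrightarrow> p x \<ge> 1"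
  shows "(convex_on {-1..1} (\<lambda>x. (p x - 1) powr 0.37) \<longrightarrow>
            (\<forall>u\<in>W11_0. (\<forall>x\<in>{-1..1}. u x \<ge> 0) \<longrightarrow>
               var_exp_functional p (symmetrization u) \<le> var_exp_functional p u))
       \<and> ((\<forall>x\<in>{-1..1}. p x \<le> 2.36) \<and> convex_on {-1..1} (\<lambda>x. sqrt (p x - 1)) \<longrightarrow>
            (\<forall>u\<in>W11_0. (\<forall>x\<in>{-1..1}. u x \<ge> 0) \<longrightarrow>
               var_exp_functional p (symmetrization u) \<le> var_exp_functional p u))"
proof (intro conjI impI ballI; (elim conjE)?)
  fix u :: "real \<Rightarrow> real" 
  assume conv: "convex_on {-1..1} (\<lambda>x. (p x - 1) powr 0.37)" and u: "u \<in> W11_0" "\<forall>x\<in>{-1..1}. u x \<ge> 0"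
  have mono: "p x \<le> p y" if "\<bar>x\<bar> \<le> \<bar>y\<bar>" "y \<in> {-1..1}" for x y
    by (rule exponent_mono[OF conv _ assms(2,3) that]) simp_all
  show "var_exp_functional p (symmetrization u) \<le> var_exp_functional p u"
  proof (rule polya_szego_variable_exponent[OF u(1) _ assms(1,3) mono])
    show "2 * crossing_cost (p ((x1 + x2) / 2)) ((s1 + s2) / 2) \<le> crossing_cost (p x1) s1 + crossing_cost (p x2) s2"
      if "s1 > 0" "s2 > 0" "x1 \<in> {-1..1}" "x2 \<in> {-1..1}" for s1 s2 x1 x2
    proof (rule crossing_cost_exponent_midpoint[OF conv _ _ assms(3) _ _ that, of "p 1"])
      show "p x - 1 \<le> p 1" if "x \<in> {-1..1}" for x
      proof -
        have "p x \<le> p 1" using that by (intro mono) auto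
        thus ?thesis by simp
      qed
      show "p 1 > 0" using assms(3)[of 1] by simp
    qed (use hessian_det_037 in auto)
  qed (use u in auto)
next
  fix u :: "real \<Rightarrow> real" 
  assume p236: "\<forall>x\<in>{-1..1}. p x \<le> 2.36" and "convex_on {-1..1} (\<lambda>x. sqrt (p x - 1))"
    and u: "u \<in> W11_0" "\<forall>x\<in>{-1..1}. u x \<ge> 0"
  have conv: "convex_on {-1..1} (\<lambda>x. (p x - 1) powr (1/2))"
  proof -
    have eq: "(p x - 1) powr (1/2) = sqrt (p x - 1)" if "x \<in> {-1..1}" for x
      using assms(3)[OF that] by (simp add: powr_half_sqrt)
    show ?thesis
    proof (rule convex_onI)
      fix t x y :: real assume t: "0 < t" "t < 1" and xy: "x \<in> {-1..1}" "y \<in> {-1..1}"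
      have "(1 - t) *\<^sub>R x + t *\<^sub>R y \<in> {-1..1}"
        using xy t by (intro convexD[OF convex_real_interval(5)]) auto
      thus "(p ((1 - t) *\<^sub>R x + t *\<^sub>R y) - 1) powr (1/2)
          \<le> (1 - t) * (p x - 1) powr (1/2) + t * (p y - 1) powr (1/2)"
        using convex_onD[OF \<open>convex_on {-1..1} (\<lambda>x. sqrt (p x - 1))\<close>, of t x y] t xy by (simp only: eq)
    qed simp
  qed
  have mono: "p x \<le> p y" if "\<bar>x\<bar> \<le> \<bar>y\<bar>" "y \<in> {-1..1}" for x y
    by (rule exponent_mono[OF conv _ assms(2,3) that]) simp_all
  show "var_exp_functional p (symmetrization u) \<le> var_exp_functional p u"
  proof (rule polya_szego_variable_exponent[OF u(1) _ assms(1,3) mono])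
    show "2 * crossing_cost (p ((x1 + x2) / 2)) ((s1 + s2) / 2) \<le> crossing_cost (p x1) s1 + crossing_cost (p x2) s2"
      if "s1 > 0" "s2 > 0" "x1 \<in> {-1..1}" "x2 \<in> {-1..1}" for s1 s2 x1 x2
    proof (rule crossing_cost_exponent_midpoint[OF conv _ _ assms(3) _ _ that, of "1.36"])
      show "p x - 1 \<le> 1.36" if "x \<in> {-1..1}" for x using p236 that by fastforce
    qed (use hessian_det_half in auto)
  qed (use u in auto)
qed

end
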